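(* Let $\Sigma$ be a complete $n$-dimensional properly immersed self-expander in $\mathbb{R}^m$, $n<m$. If there are constants $0\le a<\frac12$, $b\ge0$ and $r_0>0$ such that the mean curvature vector $\mathbf{H}$ of $\Sigma$ satisfies $|\mathbf{H}|(x)\ge a|x|+b$ for all $x\in\Sigma\setminus B_{r_0}(0)$, then $$\int_\Sigma e^{-\frac{\alpha}{4}|x|^2}\,d\sigma=\infty,\qquad\text{where }\alpha=\frac{4a^2}{1-4a^2}.$$ In particular, if there are constants $b\ge0$ and $r_0>0$ such that $|\mathbf{H}|(x)\ge\frac{1}{2\sqrt2}|x|+b$ for all $x\in\Sigma\setminus B_{r_0}(0)$, then $$\int_\Sigma e^{-\frac{|x|^2}{4}}\,d\sigma=\infty.$$
   Context: For an $n$-dimensional smooth immersed submanifold $\Sigma$ of $\mathbb{R}^m$ (with induced metric and volume form $d\sigma$), $x$ denotes the position vector, the second fundamental form is $A(X,Y)=(\overline\nabla_XY)^\perp$ ($\overline\nabla$ the Euclidean connection, $\perp$ the normal projection), and the mean curvature vector $\mathbf{H}$ is the trace of $A$. $\Sigma$ is a self-expander if $\mathbf{H}=\frac12x^\perp$. $\Sigma$ is properly immersed if the preimage under the immersion of every compact subset of $\mathbb{R}^m$ is compact. $B_r(0)$ is the round ball in $\mathbb{R}^m$ of radius $r$ centered at the origin. *)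

theory Defs
  imports "HOL-Analysis.Analysis"
begin

section \<open>Smooth maps on open sets\<close>

text \<open>Only meant for open sets \<open>S\<close>: the derivatives are taken in the full space.\<close>

primrec Ck_on ::
  "nat \<Rightarrow> ('a::euclidean_space \<Rightarrow> 'b::euclidean_space) \<Rightarrow> 'a set \<Rightarrow> bool" where
  "Ck_on 0 f S \<longleftrightarrow> continuous_on S f"
| "Ck_on (Suc k) f S \<longleftrightarrow>
     (\<forall>x\<in>S. f differentiable (at x)) \<and>
     (\<forall>v. Ck_on k (\<lambda>x. frechet_derivative f (at x) v) S)"

definition smooth_on :: "('a::euclidean_space \<Rightarrow> 'b::euclidean_space) \<Rightarrow> 'a set \<Rightarrow> bool" where
  "smooth_on f S \<longleftrightarrow> (\<forall>k. Ck_on k f S)"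

section \<open>Smooth manifolds and immersions\<close>

text \<open>A chart is a pair \<open>(U, \<phi>)\<close>. A manifold is a second countable Hausdorff space
  (a type) together with a smooth atlas, which need not be maximal. Manifolds have no boundary
  and need not be connected; they are nonempty because types are.\<close>

type_synonym ('p, 'n) chart = "'p set \<times> ('p \<Rightarrow> real ^ 'n)"

definition chart_inv :: "('p, 'n) chart \<Rightarrow> real ^ 'n \<Rightarrow> 'p" where
  "chart_inv c = inv_into (fst c) (snd c)"

definition chart_range :: "('p, 'n) chart \<Rightarrow> (real ^ 'n) set" where
  "chart_range c = snd c ` fst c"

definition is_chart :: "('p::topological_space, 'n::finite) chart \<Rightarrow> bool" where
  "is_chart c \<longleftrightarrow> open (fst c) \<and> open (chart_range c) \<and>
     homeomorphism (fst c) (chart_range c) (snd c) (chart_inv c)"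

definition smooth_atlas ::
  "('p::{t2_space, second_countable_topology}, 'n::finite) chart set \<Rightarrow> bool" where
  "smooth_atlas \<A> \<longleftrightarrow>
     (\<forall>c\<in>\<A>. is_chart c) \<and>
     (\<Union>c\<in>\<A>. fst c) = UNIV \<and>
     (\<forall>c\<in>\<A>. \<forall>d\<in>\<A>. smooth_on (snd d \<circ> chart_inv c) (snd c ` (fst c \<inter> fst d)))"

definition chart_at :: "('p, 'n) chart set \<Rightarrow> 'p \<Rightarrow> ('p, 'n) chart" where
  "chart_at \<A> p = (SOME c. c \<in> \<A> \<and> p \<in> fst c)"

definition local_rep ::
  "('p \<Rightarrow> real ^ 'm) \<Rightarrow> ('p, 'n) chart \<Rightarrow> real ^ 'n \<Rightarrow> real ^ 'm" where
  "local_rep F c = F \<circ> chart_inv c"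

definition local_deriv ::
  "('p \<Rightarrow> real ^ 'm) \<Rightarrow> ('p, 'n::finite) chart \<Rightarrow> real ^ 'n \<Rightarrow> real ^ 'n \<Rightarrow> real ^ 'm" where
  "local_deriv F c x = frechet_derivative (local_rep F c) (at x)"

definition smooth_immersion ::
  "('p, 'n::finite) chart set \<Rightarrow> ('p \<Rightarrow> real ^ 'm) \<Rightarrow> bool" where
  "smooth_immersion \<A> F \<longleftrightarrow>
     (\<forall>c\<in>\<A>. smooth_on (local_rep F c) (chart_range c) \<and>
             (\<forall>x\<in>chart_range c. inj (local_deriv F c x)))"

definition proper_map_into :: "('p::topological_space \<Rightarrow> real ^ 'm) \<Rightarrow> bool" where
  "proper_map_into F \<longleftrightarrow> (\<forall>K. compact K \<longrightarrow> compact (F -` K))"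

section \<open>Induced metric, completeness and volume\<close>

text \<open>Gram matrix \<open>g\<^sub>i\<^sub>j\<close> of the induced metric in a chart.\<close>

definition gram :: "('p \<Rightarrow> real ^ 'm) \<Rightarrow> ('p, 'n::finite) chart \<Rightarrow> real ^ 'n \<Rightarrow> real ^ 'n ^ 'n" where
  "gram F c x = (\<chi> i j. local_deriv F c x (axis i 1) \<bullet> local_deriv F c x (axis j 1))"

text \<open>Riemannian distance: infimum of the lengths of piecewise \<open>C\<^sup>1\<close> curves, \<open>\<infinity>\<close> between
  different components. Since \<open>F\<close> is an immersion and \<open>\<gamma>\<close> is continuous, \<open>\<gamma>\<close> is piecewise
  \<open>C\<^sup>1\<close> iff \<open>F \<circ> \<gamma>\<close> is, and both have the same length.\<close>

definition intrinsic_dist ::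
  "('p::topological_space \<Rightarrow> real ^ 'm) \<Rightarrow> 'p \<Rightarrow> 'p \<Rightarrow> ennreal" where
  "intrinsic_dist F p q =
     (INF \<gamma> \<in> {\<gamma>. path \<gamma> \<and> pathstart \<gamma> = p \<and> pathfinish \<gamma> = q \<and>
                   (F \<circ> \<gamma>) piecewise_C1_differentiable_on {0..1}}.
        ennreal (integral {0..1} (\<lambda>t. norm (vector_derivative (F \<circ> \<gamma>) (at t)))))"

definition complete_immersion :: "('p::topological_space \<Rightarrow> real ^ 'm) \<Rightarrow> bool" where
  "complete_immersion F \<longleftrightarrow>
     (\<forall>s :: nat \<Rightarrow> 'p.
        (\<forall>\<epsilon>>0. \<exists>N. \<forall>i\<ge>N. \<forall>j\<ge>N. intrinsic_dist F (s i) (s j) < \<epsilon>) \<longrightarrow>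
        (\<exists>p. (\<lambda>i. intrinsic_dist F (s i) p) \<longlonglongrightarrow> 0))"

text \<open>The volume of the part of a set inside a chart:
  \<open>A \<mapsto> \<integral>\<^bsub>\<phi>(A \<inter> U)\<^esub> sqrt (det g) dx\<close>.\<close>

definition chart_volume ::
  "('p::topological_space \<Rightarrow> real ^ 'm) \<Rightarrow> ('p, 'n::finite) chart \<Rightarrow> 'p measure" where
  "chart_volume F c =
     distr (density (restrict_space lborel (chart_range c)) (\<lambda>x. ennreal (sqrt (det (gram F c x)))))
           borel (chart_inv c)"

text \<open>By the change of variables formula the measures \<open>chart_volume F c\<close> and \<open>chart_volume F d\<close>
  agree on the overlap of the charts. Their least upper bound in the lattice of Borel measures is
  therefore the unique Borel measure that restricts to \<open>chart_volume F c\<close> on the domain of every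
  chart \<open>c\<close>, that is, the Riemannian volume measure \<open>d\<sigma>\<close>.\<close>

definition volume_measure ::
  "('p::topological_space, 'n::finite) chart set \<Rightarrow> ('p \<Rightarrow> real ^ 'm) \<Rightarrow> 'p measure" where
  "volume_measure \<A> F = (SUP c\<in>\<A>. chart_volume F c)"

section \<open>Extrinsic geometry\<close>

definition tangent_space ::
  "('p, 'n::finite) chart set \<Rightarrow> ('p \<Rightarrow> real ^ 'm) \<Rightarrow> 'p \<Rightarrow> (real ^ 'm) set" where
  "tangent_space \<A> F p = (let c = chart_at \<A> p in range (local_deriv F c (snd c p)))"

definition normal_part ::
  "('p, 'n::finite) chart set \<Rightarrow> ('p \<Rightarrow> real ^ 'm) \<Rightarrow> 'p \<Rightarrow> real ^ 'm \<Rightarrow> real ^ 'm" where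
  "normal_part \<A> F p v =
     (THE w. w \<in> (tangent_space \<A> F p)\<^sup>\<bottom> \<and> v - w \<in> tangent_space \<A> F p)"

text \<open>Euclidean covariant derivative at \<open>p\<close> of a vector field \<open>Y\<close> along the immersion, in the
  direction with coordinates \<open>u\<close> in the chart at \<open>p\<close>.\<close>

definition ambient_connection ::
  "('p, 'n::finite) chart set \<Rightarrow> 'p \<Rightarrow> real ^ 'n \<Rightarrow> ('p \<Rightarrow> real ^ 'm) \<Rightarrow> real ^ 'm" where
  "ambient_connection \<A> p u Y =
     (let c = chart_at \<A> p in frechet_derivative (Y \<circ> chart_inv c) (at (snd c p)) u)"

text \<open>Tangent vector field with constant coordinates \<open>v\<close> in the chart \<open>c\<close>.\<close>

definition coord_field ::
  "('p \<Rightarrow> real ^ 'm) \<Rightarrow> ('p, 'n::finite) chart \<Rightarrow> real ^ 'n \<Rightarrow> 'p \<Rightarrow> real ^ 'm" where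
  "coord_field F c v q = local_deriv F c (snd c q) v"

text \<open>The vectors \<open>X, Y \<in> T\<^sub>p\<Sigma>\<close> are given by their coordinates \<open>u, v\<close> in the chart at
  \<open>p\<close>. As \<open>(\<nabla>\<^sub>X Y)\<^sup>\<bottom>\<close> depends only on \<open>Y\<close> at \<open>p\<close>, the vector \<open>Y\<close> may be
  extended by the field with constant coordinates.\<close>

definition second_fundamental_form ::
  "('p, 'n::finite) chart set \<Rightarrow> ('p \<Rightarrow> real ^ 'm) \<Rightarrow> 'p \<Rightarrow> real ^ 'n \<Rightarrow> real ^ 'n \<Rightarrow> real ^ 'm" where
  "second_fundamental_form \<A> F p u v =
     normal_part \<A> F p (ambient_connection \<A> p u (coord_field F (chart_at \<A> p) v))"

text \<open>Trace with respect to the induced metric: \<open>H = \<Sum>\<^sub>i\<^sub>j g\<^sup>i\<^sup>j A(\<partial>\<^sub>i, \<partial>\<^sub>j)\<close>.\<close>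

definition mean_curvature ::
  "('p, 'n::finite) chart set \<Rightarrow> ('p \<Rightarrow> real ^ 'm) \<Rightarrow> 'p \<Rightarrow> real ^ 'm" where
  "mean_curvature \<A> F p =
     (let c = chart_at \<A> p; g = gram F c (snd c p) in
      \<Sum>i\<in>UNIV. \<Sum>j\<in>UNIV.
        matrix_inv g $ i $ j *\<^sub>R second_fundamental_form \<A> F p (axis i 1) (axis j 1))"

definition self_expander ::
  "('p, 'n::finite) chart set \<Rightarrow> ('p \<Rightarrow> real ^ 'm) \<Rightarrow> bool" where
  "self_expander \<A> F \<longleftrightarrow>
     (\<forall>p. mean_curvature \<A> F p = (1/2) *\<^sub>R normal_part \<A> F p (F p))"

end

theory Submission
  imports Defs
begin

text \<open>
  Write \<open>u = |x|\<^sup>2\<close> on \<open>\<Sigma>\<close> and split the position vector into its tangential and normal parts,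
  \<open>x = x\<^sup>T + x\<^sup>\<bottom>\<close>. For every immersion \<open>div x\<^sup>T = n + \<langle>x\<^sup>\<bottom>, H\<rangle>\<close>
  (\<open>divergence_tangent_coords\<close>), so on a self-expander
  \<open>div x\<^sup>T = n + |x\<^sup>\<bottom>|\<^sup>2 / 2\<close>. If \<open>f\<close> is a \<open>C\<^sup>1\<close> function on the line that vanishes for large
  arguments, then \<open>f(u)\<close> has compact support because the immersion is proper, and integrating
  \<open>div (f(u) x\<^sup>T)\<close> gives (\<open>self_expander_integral_identity\<close>)
  \<open>\<integral> 2 f'(u) (u - |x\<^sup>\<bottom>|\<^sup>2) + f(u) (n + |x\<^sup>\<bottom>|\<^sup>2 / 2) d\<sigma> = 0\<close>.

  Take \<open>f(s) = \<theta>(s) \<chi>\<^sub>T(s) exp (- \<alpha> s / 4)\<close> with \<open>\<theta>\<close> nondecreasing and vanishing for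
  \<open>s \<le> r\<^sub>0\<^sup>2\<close>, and \<open>\<chi>\<^sub>T\<close> a decreasing cutoff at \<open>T\<close>. The derivative of the exponential turns
  \<open>n + |x\<^sup>\<bottom>|\<^sup>2 / 2\<close> into \<open>n + ((1 + \<alpha>) |x\<^sup>\<bottom>|\<^sup>2 - \<alpha> u) / 2\<close>. Since \<open>|x\<^sup>\<bottom>| = 2 |H|\<close>, the
  curvature bound says \<open>|x\<^sup>\<bottom>|\<^sup>2 \<ge> 4 a\<^sup>2 u\<close> where \<open>\<theta> > 0\<close>, and \<open>\<alpha>\<close> is exactly the number with
  \<open>4 a\<^sup>2 (1 + \<alpha>) = \<alpha>\<close>; hence this factor is at least \<open>n\<close>. The term with \<open>\<theta>'\<close> has the good sign, and
  the term with \<open>\<chi>\<^sub>T'\<close> is bounded by a multiple of \<open>exp (- \<alpha> u / 4)\<close> and tends to \<open>0\<close> pointwise as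
  \<open>T\<close> grows. If the weighted volume were finite, dominated convergence would therefore give
  \<open>n \<integral> \<theta>(u) exp (- \<alpha> u / 4) d\<sigma> \<le> 0\<close>, that is, \<open>u \<le> r\<^sub>0\<^sup>2\<close> almost everywhere. Then the identity
  for an \<open>f\<close> that equals \<open>1\<close> on \<open>[0, r\<^sub>0\<^sup>2]\<close> reads \<open>\<integral> n + |x\<^sup>\<bottom>|\<^sup>2 / 2 d\<sigma> = 0\<close>, so \<open>\<sigma>\<close> would be
  zero, which it is not. Testing with functions of \<open>u\<close> in this way replaces the coarea formula and also
  covers the exclusion of compact self-expanders.

  Before this argument can start, integration by parts has to be established on \<open>\<Sigma>\<close>. In a chart it is
  the vanishing of the integral of a partial derivative of a compactly supported \<open>C\<^sup>1\<close> function,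
  applied to \<open>\<surd>(det g)\<close> times the coordinates of \<open>\<zeta> x\<^sup>T\<close>. The geometric quantities do not depend on the
  chart, by the chain rule; the volume measure, a supremum of measures, coincides on every chart
  domain with the one computed in that chart (\<open>volume_measure_eq_chart_volume\<close>), by the change
  of variables formula; and functions supported in a chart suffice, by a partition of unity made of
  bump functions (\<open>integral_radial_div\<close>).
\<close>

section \<open>Continuously differentiable maps\<close>

definition C1_on :: "('a::euclidean_space \<Rightarrow> 'b::euclidean_space) \<Rightarrow> 'a set \<Rightarrow> bool" where
  "C1_on f S \<longleftrightarrow> Ck_on 1 f S"

lemma C1_on_iff:
  "C1_on f S \<longleftrightarrow> (\<forall>x\<in>S. f differentiable (at x)) \<and>
     (\<forall>v. continuous_on S (\<lambda>x. frechet_derivative f (at x) v))"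
  by (simp add: C1_on_def)

lemma C1_onI:
  assumes "\<And>x. x \<in> S \<Longrightarrow> (f has_derivative f' x) (at x)"
    and "\<And>v. continuous_on S (\<lambda>x. f' x v)"
  shows "C1_on f S"
  unfolding C1_on_iff
proof (intro conjI ballI allI)
  show "f differentiable (at x)" if "x \<in> S" for x
    using assms(1)[OF that] by (auto simp: differentiable_def)
  show "continuous_on S (\<lambda>x. frechet_derivative f (at x) v)" for v
    by (rule continuous_on_eq[OF assms(2)[of v]]) (simp add: frechet_derivative_at[OF assms(1), symmetric])
qed

lemma C1_on_has_derivative:
  "C1_on f S \<Longrightarrow> x \<in> S \<Longrightarrow> (f has_derivative frechet_derivative f (at x)) (at x)"
  unfolding C1_on_iff by (simp add: frechet_derivative_works)

lemma C1_on_continuous_deriv: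
  "C1_on f S \<Longrightarrow> continuous_on S (\<lambda>x. frechet_derivative f (at x) v)"
  unfolding C1_on_iff by simp

lemma C1_on_continuous: "C1_on f S \<Longrightarrow> continuous_on S f"
  by (meson C1_on_has_derivative continuous_at_imp_continuous_on has_derivative_continuous)

text \<open>For families of linear maps on a finite-dimensional space, pointwise continuity in the parameter is
  already joint continuity: only finitely many basis vectors matter.\<close>

lemma continuous_on_linear_family:
  fixes L :: "'a::topological_space \<Rightarrow> 'b::euclidean_space \<Rightarrow> 'c::real_normed_vector"
  assumes "\<And>x. x \<in> S \<Longrightarrow> linear (L x)"
    and "\<And>v. continuous_on S (\<lambda>x. L x v)"
    and "continuous_on S w"
  shows "continuous_on S (\<lambda>x. L x (w x))"
proof -
  have "L x (w x) = (\<Sum>b\<in>Basis. (w x \<bullet> b) *\<^sub>R L x b)" if "x \<in> S" for x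
  proof -
    have "L x (w x) = L x (\<Sum>b\<in>Basis. (w x \<bullet> b) *\<^sub>R b)" by (simp add: euclidean_representation)
    also have "\<dots> = (\<Sum>b\<in>Basis. (w x \<bullet> b) *\<^sub>R L x b)"
      using assms(1)[OF that] by (simp add: linear_sum linear_cmul)
    finally show ?thesis .
  qed
  moreover have "continuous_on S (\<lambda>x. \<Sum>b\<in>Basis. (w x \<bullet> b) *\<^sub>R L x b)"
    by (intro continuous_intros assms)
  ultimately show ?thesis by (simp cong: continuous_on_cong)
qed

lemma C1_on_subset: "C1_on f S \<Longrightarrow> T \<subseteq> S \<Longrightarrow> C1_on f T"
  unfolding C1_on_iff by (meson continuous_on_subset subset_eq)

lemma C1_on_cong:
  assumes "open S" "C1_on f S" "\<And>x. x \<in> S \<Longrightarrow> f x = g x"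
  shows "C1_on g S"
proof (rule C1_onI[where f' = "\<lambda>x. frechet_derivative f (at x)"])
  show "(g has_derivative frechet_derivative f (at x)) (at x)" if "x \<in> S" for x
    using has_derivative_transform_within_open[OF C1_on_has_derivative[OF assms(2) that] assms(1) that assms(3)] .
qed (rule C1_on_continuous_deriv[OF assms(2)])

lemma C1_on_Un:
  assumes "open S" "open T" "C1_on f S" "C1_on f T"
  shows "C1_on f (S \<union> T)"
  using assms unfolding C1_on_iff by (auto intro: continuous_on_open_Un)

lemma C1_on_const: "C1_on (\<lambda>x. c) S"
  by (rule C1_onI[where f' = "\<lambda>x v. 0"]) auto

lemma C1_on_linear: "bounded_linear f \<Longrightarrow> C1_on f S"
  by (rule C1_onI[where f' = "\<lambda>x v. f v"]) (auto intro: bounded_linear_imp_has_derivative)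

lemma C1_on_add: "C1_on f S \<Longrightarrow> C1_on g S \<Longrightarrow> C1_on (\<lambda>x. f x + g x) S"
  by (rule C1_onI[where f' = "\<lambda>x v. frechet_derivative f (at x) v + frechet_derivative g (at x) v"])
     (auto intro!: has_derivative_add C1_on_has_derivative continuous_intros C1_on_continuous_deriv)

lemma C1_on_sum: "(\<And>i. i \<in> I \<Longrightarrow> C1_on (f i) S) \<Longrightarrow> C1_on (\<lambda>x. \<Sum>i\<in>I. f i x) S"
  by (rule C1_onI[where f' = "\<lambda>x v. \<Sum>i\<in>I. frechet_derivative (f i) (at x) v"])
     (auto intro!: has_derivative_sum C1_on_has_derivative continuous_intros C1_on_continuous_deriv)

lemma C1_on_bilinear:
  assumes "bounded_bilinear pr" "C1_on f S" "C1_on g S"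
  shows "C1_on (\<lambda>x. pr (f x) (g x)) S"
proof (rule C1_onI)
  interpret bounded_bilinear pr by fact
  show "((\<lambda>x. pr (f x) (g x)) has_derivative
     (\<lambda>v. pr (f x) (frechet_derivative g (at x) v) + pr (frechet_derivative f (at x) v) (g x))) (at x)"
    if "x \<in> S" for x
    by (rule FDERIV) (use assms that C1_on_has_derivative in auto)
  show "continuous_on S (\<lambda>x. pr (f x) (frechet_derivative g (at x) v) + pr (frechet_derivative f (at x) v) (g x))" for v
    by (intro continuous_intros continuous_on C1_on_continuous_deriv C1_on_continuous assms)
qed

lemmas C1_on_mult = C1_on_bilinear[OF bounded_bilinear_mult]
lemmas C1_on_scaleR = C1_on_bilinear[OF bounded_bilinear_scaleR]
lemmas C1_on_inner = C1_on_bilinear[OF bounded_bilinear_inner]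

lemma C1_on_diff:
  assumes "C1_on f S" "C1_on g S" shows "C1_on (\<lambda>x. f x - g x) S"
  using C1_on_add[OF assms(1) C1_on_scaleR[OF C1_on_const[of "-1"] assms(2)]] by simp

lemma C1_on_prod:
  fixes f :: "'i \<Rightarrow> 'a::euclidean_space \<Rightarrow> real"
  assumes "\<And>i. i \<in> I \<Longrightarrow> C1_on (f i) S"
  shows "C1_on (\<lambda>x. \<Prod>i\<in>I. f i x) S"
  using assms
proof (induction I rule: infinite_finite_induct)
  case (insert i I)
  then show ?case using C1_on_mult[of "f i" S "\<lambda>x. \<Prod>i\<in>I. f i x"] by simp
qed (simp_all add: C1_on_const)

lemma C1_on_compose:
  assumes "C1_on f S" "C1_on g T" "f ` S \<subseteq> T"
  shows "C1_on (\<lambda>x. g (f x)) S"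
proof (rule C1_onI)
  show "((\<lambda>x. g (f x)) has_derivative
      (\<lambda>v. frechet_derivative g (at (f x)) (frechet_derivative f (at x) v))) (at x)" if "x \<in> S" for x
    using assms that by (intro has_derivative_compose[of f _ x UNIV g] C1_on_has_derivative) auto
  show "continuous_on S (\<lambda>x. frechet_derivative g (at (f x)) (frechet_derivative f (at x) v))" for v
  proof (rule continuous_on_linear_family[where L = "\<lambda>x. frechet_derivative g (at (f x))"])
    show "linear (frechet_derivative g (at (f x)))" if "x \<in> S" for x
      using C1_on_has_derivative[OF assms(2), of "f x"] assms(3) that has_derivative_linear by blast
    show "continuous_on S (\<lambda>x. frechet_derivative g (at (f x)) w)" for w
      using continuous_on_compose2[OF C1_on_continuous_deriv[OF assms(2)] C1_on_continuous[OF assms(1)] assms(3)] .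
  qed (rule C1_on_continuous_deriv[OF assms(1)])
qed

lemma C1_on_real:
  assumes "\<And>x. x \<in> S \<Longrightarrow> (f has_real_derivative f' x) (at x)" "continuous_on S f'"
  shows "C1_on f S"
  by (rule C1_onI[where f' = "\<lambda>x v. f' x * v"])
     (use assms in \<open>auto simp: has_field_derivative_def intro!: continuous_intros\<close>)

lemma C1_on_divide:
  fixes f g :: "'a::euclidean_space \<Rightarrow> real"
  assumes "C1_on f S" "C1_on g S" "\<And>x. x \<in> S \<Longrightarrow> g x \<noteq> 0"
  shows "C1_on (\<lambda>x. f x / g x) S"
proof -
  have "C1_on inverse (- {0::real})"
    by (rule C1_on_real[where f' = "\<lambda>x. - (inverse x * inverse x)"])
       (auto intro!: DERIV_inverse' derivative_eq_intros continuous_intros)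
  then have "C1_on (\<lambda>x. inverse (g x)) S"
    using assms by (intro C1_on_compose[OF assms(2)]) auto
  from C1_on_mult[OF assms(1) this] show ?thesis by (simp add: divide_inverse)
qed

lemma C1_on_sqrt:
  assumes "C1_on g S" "\<And>x. x \<in> S \<Longrightarrow> g x > 0"
  shows "C1_on (\<lambda>x. sqrt (g x)) S"
proof -
  have "C1_on sqrt {0<..}"
    by (rule C1_on_real[where f' = "\<lambda>x. inverse (sqrt x) / 2"])
       (auto intro!: DERIV_real_sqrt continuous_intros)
  then show ?thesis
    using assms by (intro C1_on_compose[OF assms(1)]) auto
qed

lemma C1_on_vec_nth: "C1_on f S \<Longrightarrow> C1_on (\<lambda>x. f x $ i) S" for f :: "_ \<Rightarrow> real ^ 'n"
  using C1_on_compose[OF _ C1_on_linear[OF bounded_linear_vec_nth], of f S UNIV] by simp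

lemma C1_on_vecI:
  fixes f :: "'a::euclidean_space \<Rightarrow> 'b::euclidean_space ^ 'n"
  assumes "\<And>i. C1_on (\<lambda>x. f x $ i) S"
  shows "C1_on f S"
proof -
  have "linear (axis i :: 'b \<Rightarrow> 'b ^ 'n)" for i
    by (rule linearI) (auto simp: vec_eq_iff axis_def)
  then have lin: "bounded_linear (axis i :: 'b \<Rightarrow> 'b ^ 'n)" for i
    by (simp add: linear_conv_bounded_linear)
  have eq: "(\<lambda>x. \<Sum>i\<in>UNIV. axis i (f x $ i)) = f"
    by (simp add: fun_eq_iff vec_eq_iff axis_def)
  have "C1_on (\<lambda>x. axis i (f x $ i) :: 'b ^ 'n) S" for i
    using C1_on_compose[OF assms C1_on_linear[OF lin], of i UNIV] by simp
  then have "C1_on (\<lambda>x. \<Sum>i\<in>UNIV. axis i (f x $ i)) S" by (intro C1_on_sum)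
  then show ?thesis by (simp only: eq)
qed

lemma C1_on_det:
  fixes A :: "'a::euclidean_space \<Rightarrow> real ^ 'n ^ 'n"
  assumes "\<And>i j. C1_on (\<lambda>x. A x $ i $ j) S"
  shows "C1_on (\<lambda>x. det (A x)) S"
  unfolding det_def by (intro C1_on_sum C1_on_mult C1_on_const C1_on_prod assms)

section \<open>Symmetry of second derivatives\<close>

text \<open>Two applications of the mean value theorem: first to the difference of \<open>f\<close> in the direction \<open>w\<close>,
  as a function of the step in the direction \<open>v\<close>, then to the derivative \<open>f' v\<close> along \<open>w\<close>. The left-hand
  side is symmetric in \<open>v\<close> and \<open>w\<close>, which is where the symmetry of second derivatives comes from.\<close>

lemma double_difference_mvt:
  fixes f :: "'a::real_normed_vector \<Rightarrow> real"
  assumes h: "h > 0"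
    and f': "\<And>s t. 0 \<le> s \<Longrightarrow> s \<le> h \<Longrightarrow> 0 \<le> t \<Longrightarrow> t \<le> h \<Longrightarrow>
      (f has_derivative f' (x + s *\<^sub>R v + t *\<^sub>R w)) (at (x + s *\<^sub>R v + t *\<^sub>R w))"
    and f'': "\<And>s t. 0 \<le> s \<Longrightarrow> s \<le> h \<Longrightarrow> 0 \<le> t \<Longrightarrow> t \<le> h \<Longrightarrow>
      ((\<lambda>y. f' y v) has_derivative f'' (x + s *\<^sub>R v + t *\<^sub>R w)) (at (x + s *\<^sub>R v + t *\<^sub>R w))"
  obtains s t where "0 \<le> s" "s \<le> h" "0 \<le> t" "t \<le> h"
    "f (x + h *\<^sub>R v + h *\<^sub>R w) - f (x + h *\<^sub>R v) - f (x + h *\<^sub>R w) + f x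
      = h * h * f'' (x + s *\<^sub>R v + t *\<^sub>R w) w"
proof -
  define k where "k s = f (x + s *\<^sub>R v + h *\<^sub>R w) - f (x + s *\<^sub>R v)" for s
  have k': "(k has_derivative (\<lambda>r. r * (f' (x + s *\<^sub>R v + h *\<^sub>R w) v - f' (x + s *\<^sub>R v) v))) (at s)"
    if "0 \<le> s" "s \<le> h" for s
  proof -
    have a: "((\<lambda>s. f (x + s *\<^sub>R v + t *\<^sub>R w)) has_derivative (\<lambda>r. f' (x + s *\<^sub>R v + t *\<^sub>R w) (r *\<^sub>R v))) (at s)"
      if "0 \<le> t" "t \<le> h" for t
      by (rule has_derivative_compose[where g = f and f = "\<lambda>s. x + s *\<^sub>R v + t *\<^sub>R w"])
         (auto intro!: derivative_eq_intros f' that \<open>0 \<le> s\<close> \<open>s \<le> h\<close>)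
    have b: "linear (f' (x + s *\<^sub>R v + t *\<^sub>R w))" if "0 \<le> t" "t \<le> h" for t
      using f'[OF \<open>0 \<le> s\<close> \<open>s \<le> h\<close> that] has_derivative_linear by blast
    have "(k has_derivative (\<lambda>r. f' (x + s *\<^sub>R v + h *\<^sub>R w) (r *\<^sub>R v) - f' (x + s *\<^sub>R v + 0 *\<^sub>R w) (r *\<^sub>R v))) (at s)"
      unfolding k_def using has_derivative_diff[OF a[of h] a[of 0]] h by simp
    then show ?thesis using b[of h] b[of 0] h by (simp add: linear_cmul algebra_simps)
  qed
  have "\<exists>s\<in>{0<..<h}. k h - k 0 = (h - 0) * (f' (x + s *\<^sub>R v + h *\<^sub>R w) v - f' (x + s *\<^sub>R v) v)"
    by (rule mvt_simple[OF h]) (rule has_derivative_at_withinI, rule k')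
  then obtain s where s: "s \<in> {0<..<h}" "k h - k 0 = (h - 0) * (f' (x + s *\<^sub>R v + h *\<^sub>R w) v - f' (x + s *\<^sub>R v) v)"
    by blast
  define l where "l t = f' (x + s *\<^sub>R v + t *\<^sub>R w) v" for t
  have l': "(l has_derivative (\<lambda>r. r * f'' (x + s *\<^sub>R v + t *\<^sub>R w) w)) (at t)" if "0 \<le> t" "t \<le> h" for t
  proof -
    have "(l has_derivative (\<lambda>r. f'' (x + s *\<^sub>R v + t *\<^sub>R w) (r *\<^sub>R w))) (at t)"
      unfolding l_def
      by (rule has_derivative_compose[where g = "\<lambda>y. f' y v" and f = "\<lambda>t. x + s *\<^sub>R v + t *\<^sub>R w"])
         (use s that in \<open>auto intro!: derivative_eq_intros f''\<close>)
    moreover have "linear (f'' (x + s *\<^sub>R v + t *\<^sub>R w))"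
      using f''[of s t] s that has_derivative_linear by fastforce
    ultimately show ?thesis by (simp add: linear_cmul)
  qed
  have "\<exists>t\<in>{0<..<h}. l h - l 0 = (h - 0) * f'' (x + s *\<^sub>R v + t *\<^sub>R w) w"
    by (rule mvt_simple[OF h]) (rule has_derivative_at_withinI, rule l')
  then obtain t where t: "t \<in> {0<..<h}" "l h - l 0 = (h - 0) * f'' (x + s *\<^sub>R v + t *\<^sub>R w) w"
    by blast
  show ?thesis
  proof (rule that[of s t])
    have "f (x + h *\<^sub>R v + h *\<^sub>R w) - f (x + h *\<^sub>R v) - f (x + h *\<^sub>R w) + f x = k h - k 0"
      by (simp add: k_def)
    also have "\<dots> = h * (l h - l 0)" using s by (simp add: l_def)
    also have "\<dots> = h * h * f'' (x + s *\<^sub>R v + t *\<^sub>R w) w" using t by simp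
    finally show "f (x + h *\<^sub>R v + h *\<^sub>R w) - f (x + h *\<^sub>R v) - f (x + h *\<^sub>R w) + f x
      = h * h * f'' (x + s *\<^sub>R v + t *\<^sub>R w) w" .
  qed (use s t in auto)
qed

text \<open>On a small parallelogram the symmetric double difference is \<open>h\<^sup>2\<close> times a nearby value of
  either mixed derivative, and both are continuous at \<open>x\<close>.\<close>

lemma second_derivative_symmetric_real:
  fixes f :: "'a::euclidean_space \<Rightarrow> real"
  assumes S: "open S" "x \<in> S" and f: "\<And>y. y \<in> S \<Longrightarrow> (f has_derivative f' y) (at y)"
    and f': "\<And>v y. y \<in> S \<Longrightarrow> ((\<lambda>y. f' y v) has_derivative f'' v y) (at y)"
    and cont: "\<And>v w. continuous_on S (\<lambda>y. f'' v y w)"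
  shows "f'' v x w = f'' w x v"
proof -
  have "\<bar>f'' v x w - f'' w x v\<bar> \<le> 2 * e" if e: "e > 0" for e
  proof -
    have near: "\<exists>d>0. \<forall>y. dist y x < d \<longrightarrow> y \<in> S \<and> \<bar>f'' v y w - f'' v x w\<bar> < e" for v w
    proof -
      have "isCont (\<lambda>y. f'' v y w) x" using cont S continuous_on_eq_continuous_at by blast
      then obtain d where d: "d > 0" "\<forall>y. dist y x < d \<longrightarrow> dist (f'' v y w) (f'' v x w) < e"
        unfolding continuous_at_eps_delta using e by blast
      obtain d' where d': "d' > 0" "ball x d' \<subseteq> S" using S open_contains_ball by blast
      show ?thesis
        by (rule exI[of _ "min d d'"]) (use d d' in \<open>auto simp: dist_real_def dist_commute subset_eq\<close>)
    qed
    obtain d1 where d1: "d1 > 0" "\<And>y. dist y x < d1 \<Longrightarrow> y \<in> S \<and> \<bar>f'' v y w - f'' v x w\<bar> < e"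
      using near[of v w] by blast
    obtain d2 where d2: "d2 > 0" "\<And>y. dist y x < d2 \<Longrightarrow> y \<in> S \<and> \<bar>f'' w y v - f'' w x v\<bar> < e"
      using near[of w v] by blast
    define h where "h = min d1 d2 / (norm v + norm w + 1)"
    have nn: "norm v + norm w + 1 > 0" using norm_ge_zero[of v] norm_ge_zero[of w] by linarith
    have h: "h > 0" using d1 d2 nn by (simp add: h_def)
    have hb: "h * (norm v + norm w + 1) = min d1 d2" using nn by (simp add: h_def)
    have small: "dist (x + s *\<^sub>R v + t *\<^sub>R w) x < min d1 d2"
      if "0 \<le> s" "s \<le> h" "0 \<le> t" "t \<le> h" for s t
    proof -
      have "dist (x + s *\<^sub>R v + t *\<^sub>R w) x = norm (s *\<^sub>R v + t *\<^sub>R w)" by (simp add: dist_norm algebra_simps)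
      also have "\<dots> \<le> s * norm v + t * norm w"
        using norm_triangle_ineq[of "s *\<^sub>R v" "t *\<^sub>R w"] that by simp
      also have "\<dots> \<le> h * norm v + h * norm w" using that by (intro add_mono mult_right_mono) auto
      also have "\<dots> < h * (norm v + norm w + 1)" using h by (simp add: algebra_simps)
      finally show ?thesis using hb by simp
    qed
    have inS: "x + s *\<^sub>R v + t *\<^sub>R w \<in> S" if "0 \<le> s" "s \<le> h" "0 \<le> t" "t \<le> h" for s t
      using small[OF that] d1 by simp
    have inS': "x + s *\<^sub>R w + t *\<^sub>R v \<in> S" if "0 \<le> s" "s \<le> h" "0 \<le> t" "t \<le> h" for s t
      using inS[of t s] that by (simp add: algebra_simps)
    obtain s t where st: "0 \<le> s" "s \<le> h" "0 \<le> t" "t \<le> h"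
      "f (x + h *\<^sub>R v + h *\<^sub>R w) - f (x + h *\<^sub>R v) - f (x + h *\<^sub>R w) + f x
        = h * h * f'' v (x + s *\<^sub>R v + t *\<^sub>R w) w"
      using double_difference_mvt[OF h, of f f' x v w "f'' v", OF f[OF inS] f'[OF inS]] by blast
    obtain s' t' where st': "0 \<le> s'" "s' \<le> h" "0 \<le> t'" "t' \<le> h"
      "f (x + h *\<^sub>R w + h *\<^sub>R v) - f (x + h *\<^sub>R w) - f (x + h *\<^sub>R v) + f x
        = h * h * f'' w (x + s' *\<^sub>R w + t' *\<^sub>R v) v"
      using double_difference_mvt[OF h, of f f' x w v "f'' w", OF f[OF inS'] f'[OF inS']] by blast
    have "h * h * f'' v (x + s *\<^sub>R v + t *\<^sub>R w) w = h * h * f'' w (x + s' *\<^sub>R w + t' *\<^sub>R v) v"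
      using st(5) st'(5) by (simp add: algebra_simps)
    then have eq: "f'' v (x + s *\<^sub>R v + t *\<^sub>R w) w = f'' w (x + s' *\<^sub>R w + t' *\<^sub>R v) v" using h by simp
    have "dist (x + s' *\<^sub>R w + t' *\<^sub>R v) x < min d1 d2" using small[of t' s'] st' by (simp add: algebra_simps)
    then have "\<bar>f'' w (x + s' *\<^sub>R w + t' *\<^sub>R v) v - f'' w x v\<bar> < e" using d2 by simp
    moreover have "\<bar>f'' v (x + s *\<^sub>R v + t *\<^sub>R w) w - f'' v x w\<bar> < e" using d1 small st by simp
    ultimately show ?thesis using eq by linarith
  qed
  note * = this
  have "\<bar>f'' v x w - f'' w x v\<bar> \<le> 0 + e" if "e > 0" for e
    by (rule order_trans[OF *[of "e/2"]]) (use that in auto)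
  then have "\<bar>f'' v x w - f'' w x v\<bar> \<le> 0" using field_le_epsilon by blast
  then show ?thesis by simp
qed

lemma second_derivative_symmetric:
  fixes f :: "'a::euclidean_space \<Rightarrow> 'b::euclidean_space"
  assumes S: "open S" "x \<in> S" and f: "\<And>y. y \<in> S \<Longrightarrow> (f has_derivative f' y) (at y)"
    and f': "\<And>v y. y \<in> S \<Longrightarrow> ((\<lambda>y. f' y v) has_derivative f'' v y) (at y)"
    and cont: "\<And>v w. continuous_on S (\<lambda>y. f'' v y w)"
  shows "f'' v x w = f'' w x v"
proof (rule euclidean_eqI)
  fix b :: 'b
  show "f'' v x w \<bullet> b = f'' w x v \<bullet> b"
    by (rule second_derivative_symmetric_real[OF S, where f = "\<lambda>y. f y \<bullet> b" and f' = "\<lambda>y v. f' y v \<bullet> b"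
          and f'' = "\<lambda>v y w. f'' v y w \<bullet> b"])
       (auto intro!: has_derivative_inner_left f f' continuous_intros cont)
qed

section \<open>Matrices and the derivative of the determinant\<close>

lemma linear_expand_axis:
  fixes L :: "real ^ 'n::finite \<Rightarrow> 'b::real_vector"
  assumes "linear L" shows "L v = (\<Sum>i\<in>UNIV. v $ i *\<^sub>R L (axis i 1))"
proof -
  have "L v = L (\<Sum>i\<in>UNIV. v $ i *\<^sub>R axis i 1)"
    by (simp add: basis_expansion scalar_mult_eq_scaleR[symmetric])
  then show ?thesis using assms by (simp add: linear_sum linear_cmul)
qed

lemma matrix_inv_mult:
  fixes A :: "real ^ 'n ^ 'n"
  assumes "det A \<noteq> 0"
  shows "A ** matrix_inv A = mat 1" "matrix_inv A ** A = mat 1"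
proof -
  have "\<exists>B. A ** B = mat 1 \<and> B ** A = mat 1"
    using assms by (simp add: invertible_det_nz[symmetric] invertible_def)
  from someI_ex[OF this] show "A ** matrix_inv A = mat 1" "matrix_inv A ** A = mat 1"
    by (simp_all add: matrix_inv_def)
qed

lemma matrix_inv_eqI:
  fixes A :: "real ^ 'n ^ 'n"
  assumes "B ** A = mat 1"
  shows "matrix_inv A = B"
proof -
  have "det A \<noteq> 0" using assms det_mul[of B A] by auto
  then have "B = B ** (A ** matrix_inv A)" by (simp add: matrix_inv_mult)
  then show ?thesis using assms by (simp add: matrix_mul_assoc)
qed

lemma linear_matrix_mult_right: "linear (\<lambda>M::real^'n^'k. (W::real^'k^'m) ** M)"
  by (rule linearI)
     (simp_all add: vec_eq_iff matrix_matrix_mult_def sum_distrib_left sum.distrib algebra_simps)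

text \<open>At the identity matrix, the derivative of the term of a permutation \<open>p\<close> in the Leibniz formula
  contains, for all indices \<open>j\<close> but one, a factor that vanishes if \<open>p j \<noteq> j\<close>. As \<open>p \<noteq> id\<close> moves at least two indices, only
  the term of the identity survives.\<close>

lemma has_derivative_det_mat_1: "(det has_derivative trace) (at (mat 1 :: real^'n^'n))"
proof -
  let ?P = "{p. p permutes (UNIV :: 'n set)}"
  have "((\<lambda>A::real^'n^'n. \<Sum>p\<in>?P. of_int (sign p) * (\<Prod>i\<in>UNIV. A$i$p i)) has_derivative
     (\<lambda>B. \<Sum>p\<in>?P. of_int (sign p) * (\<Sum>i\<in>UNIV. B$i$p i * (\<Prod>j\<in>UNIV - {i}. mat 1 $j$p j)))) (at (mat 1))"
    by (intro has_derivative_sum has_derivative_mult_right has_derivative_prod bounded_linear_imp_has_derivative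
        bounded_linear_compose[OF bounded_linear_vec_nth bounded_linear_vec_nth])
  moreover have "(\<Sum>p\<in>?P. of_int (sign p) * (\<Sum>i\<in>UNIV. B$i$p i * (\<Prod>j\<in>UNIV - {i}. mat 1 $j$p j))) = trace B"
    for B :: "real^'n^'n"
  proof -
    have "(\<Sum>i\<in>UNIV. B$i$p i * (\<Prod>j\<in>UNIV - {i}. mat 1 $j$p j)) = 0" if "p \<in> ?P - {id}" for p
    proof (rule sum.neutral, rule ballI)
      fix i
      have "\<exists>j\<in>UNIV - {i}. p j \<noteq> j"
      proof (rule ccontr)
        assume *: "\<not> (\<exists>j\<in>UNIV - {i}. p j \<noteq> j)"
        have "inj p" using that permutes_inj by auto
        then have "p i = i" using * by (metis DiffI UNIV_I injD singletonD)
        then have "p = id" using * by (auto simp: fun_eq_iff)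
        then show False using that by simp
      qed
      then show "B$i$p i * (\<Prod>j\<in>UNIV - {i}. mat 1 $j$p j) = 0"
        by (auto simp: mat_def prod_zero_iff)
    qed
    then have "(\<Sum>p\<in>?P. of_int (sign p) * (\<Sum>i\<in>UNIV. B$i$p i * (\<Prod>j\<in>UNIV - {i}. mat 1 $j$p j)))
      = (\<Sum>p\<in>{id}. of_int (sign p) * (\<Sum>i\<in>UNIV. B$i$p i * (\<Prod>j\<in>UNIV - {i}. mat 1 $j$p j)))"
      by (intro sum.mono_neutral_right) (auto simp: finite_permutations permutes_id)
    also have "\<dots> = trace B" by (simp add: trace_def mat_def)
    finally show ?thesis .
  qed
  ultimately show ?thesis by (simp add: det_def[abs_def])
qed

text \<open>Jacobi's formula. Factoring \<open>A(x)\<close> out of \<open>A(y)\<close> moves the base point to the identity matrix.\<close>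

lemma has_derivative_det:
  fixes A :: "'a::real_normed_vector \<Rightarrow> real ^ 'n ^ 'n"
  assumes A: "(A has_derivative A') (at x)" and nz: "det (A x) \<noteq> 0"
  shows "((\<lambda>y. det (A y)) has_derivative (\<lambda>h. det (A x) * trace (matrix_inv (A x) ** A' h))) (at x)"
proof -
  let ?W = "matrix_inv (A x)"
  have split: "det (A y) = det (A x) * det (?W ** A y)" for y
  proof -
    have "A y = A x ** (?W ** A y)" by (simp add: matrix_mul_assoc matrix_inv_mult nz)
    then show ?thesis by (metis det_mul)
  qed
  have lin: "((\<lambda>y. ?W ** A y) has_derivative (\<lambda>h. ?W ** A' h)) (at x)"
    using bounded_linear.has_derivative[OF _ A] linear_matrix_mult_right[of ?W] linear_conv_bounded_linear by blast
  have "((\<lambda>y. det (?W ** A y)) has_derivative (\<lambda>h. trace (?W ** A' h))) (at x)"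
    by (rule has_derivative_compose[OF lin]) (simp add: matrix_inv_mult nz has_derivative_det_mat_1)
  then have "((\<lambda>y. det (A x) * det (?W ** A y)) has_derivative (\<lambda>h. det (A x) * trace (?W ** A' h))) (at x)"
    by (rule has_derivative_mult_right)
  then show ?thesis by (simp add: split[symmetric])
qed

section \<open>Integrals of derivatives of compactly supported functions\<close>

lemma has_derivative_zero_outside:
  assumes "(f has_derivative f') (at x)" "closed C" "x \<notin> C" "\<And>x. x \<notin> C \<Longrightarrow> f x = 0"
  shows "f' = (\<lambda>v. 0)"
proof -
  have "((\<lambda>x. 0) has_derivative f') (at x)"
    by (rule has_derivative_transform_within_open[OF assms(1), of "- C"]) (use assms in auto)
  then show ?thesis using has_derivative_const has_derivative_unique by blast
qed

text \<open>The difference quotients in the direction \<open>v\<close> have integral \<open>0\<close> because Lebesgue measure is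
  translation invariant. They are bounded by the maximum of the derivative and supported in a fixed
  compact set, so dominated convergence passes this to their limit.\<close>

lemma integral_directional_derivative_eq_0:
  fixes f :: "'a::euclidean_space \<Rightarrow> real"
  assumes der: "\<And>x. (f has_derivative f' x) (at x)"
    and cont: "continuous_on UNIV (\<lambda>x. f' x v)"
    and C: "compact C" "\<And>x. x \<notin> C \<Longrightarrow> f x = 0"
  shows "integrable lborel (\<lambda>x. f' x v)" "integral\<^sup>L lborel (\<lambda>x. f' x v) = 0"
proof -
  have z: "f' x v = 0" if "x \<notin> C" for x
    using has_derivative_zero_outside[OF der compact_imp_closed[OF C(1)] that C(2)] by simp
  have "compact ((\<lambda>x. f' x v) ` C)"
    by (rule compact_continuous_image[OF continuous_on_subset[OF cont] C(1)]) simp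
  then obtain B where B: "\<And>x. x \<in> C \<Longrightarrow> \<bar>f' x v\<bar> \<le> B" "B > 0"
    using compact_imp_bounded bounded_pos by (metis imageI real_norm_def)
  have B': "\<bar>f' x v\<bar> \<le> B" for x by (cases "x \<in> C") (use B z in auto)
  have [measurable]: "f \<in> borel_measurable borel" "(\<lambda>x. f' x v) \<in> borel_measurable borel"
    using der cont by (auto intro!: borel_measurable_continuous_onI continuous_at_imp_continuous_on
        intro: has_derivative_continuous)
  have "integrable lborel (\<lambda>x. indicator C x *\<^sub>R f' x v)"
    using borel_integrable_compact[OF C(1)] cont continuous_on_subset by blast
  moreover have "(\<lambda>x. indicator C x *\<^sub>R f' x v) = (\<lambda>x. f' x v)"
    using z by (auto simp: indicator_def fun_eq_iff)
  ultimately show int: "integrable lborel (\<lambda>x. f' x v)" by (simp only:)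
  have intf: "integrable lborel f"
  proof -
    have "continuous_on C f"
      by (intro continuous_at_imp_continuous_on ballI has_derivative_continuous[OF der])
    then have "integrable lborel (\<lambda>x. indicator C x *\<^sub>R f x)" by (rule borel_integrable_compact[OF C(1)])
    moreover have "(\<lambda>x. indicator C x *\<^sub>R f x) = f" using C by (auto simp: indicator_def fun_eq_iff)
    ultimately show ?thesis by (simp only:)
  qed
  define t where "t n = inverse (real (Suc n))" for n
  have t: "0 < t n" "t n \<le> 1" for n by (auto simp: t_def inverse_eq_divide)
  define q where "q n x = (f (t n *\<^sub>R v + x) - f x) / t n" for n x
  \<comment> \<open>The set swept out by moving \<open>C\<close> by at most \<open>- v\<close>; it supports all difference quotients.\<close>
  define D where "D = (\<lambda>(y, s). y - s *\<^sub>R v) ` (C \<times> {0..1::real})"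
  have line: "((\<lambda>s. f (s *\<^sub>R v + x)) has_real_derivative f' (s *\<^sub>R v + x) v) (at s)" for s x
  proof -
    have "((\<lambda>s. f (s *\<^sub>R v + x)) has_derivative (\<lambda>r. f' (s *\<^sub>R v + x) (r *\<^sub>R v))) (at s)"
      by (rule has_derivative_compose[where f = "\<lambda>s. s *\<^sub>R v + x"]) (auto intro!: derivative_eq_intros der)
    then show ?thesis
      using linear_cmul[OF has_derivative_linear[OF der]]
      by (simp add: has_field_derivative_def mult.commute[of _ "f' (s *\<^sub>R v + x) v"])
  qed
  have qbound: "\<bar>q n x\<bar> \<le> B" for n x
  proof -
    have "\<exists>z>0. z < t n \<and> f (t n *\<^sub>R v + x) - f (0 *\<^sub>R v + x) = (t n - 0) * f' (z *\<^sub>R v + x) v"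
      by (rule MVT2[OF t(1)]) (rule line)
    then obtain z where "f (t n *\<^sub>R v + x) - f x = t n * f' (z *\<^sub>R v + x) v" by auto
    then have "q n x = f' (z *\<^sub>R v + x) v" using t(1)[of n] by (simp add: q_def)
    then show ?thesis using B' by simp
  qed
  have qzero: "q n x = 0" if "x \<notin> D" for n x
  proof -
    have "x \<notin> C" using that image_eqI[of x "\<lambda>(y, s). y - s *\<^sub>R v" "(x, 0)" "C \<times> {0..1}"] by (auto simp: D_def)
    moreover have "t n *\<^sub>R v + x \<notin> C"
      using that t[of n] image_eqI[of x "\<lambda>(y, s). y - s *\<^sub>R v" "(t n *\<^sub>R v + x, t n)" "C \<times> {0..1}"]
      by (auto simp: D_def)
    ultimately show ?thesis using C by (simp add: q_def)
  qed
  have "compact D" unfolding D_def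
    by (intro compact_continuous_image compact_Times C(1) compact_Icc)
       (auto simp: case_prod_unfold intro!: continuous_intros)
  then have intD: "integrable lborel (\<lambda>x. B * indicator D x)"
    by (intro integrable_mult_right integrable_real_indicator emeasure_bounded_finite compact_imp_bounded)
       (simp_all add: borel_compact)
  have conv: "(\<lambda>n. integral\<^sup>L lborel (q n)) \<longlonglongrightarrow> integral\<^sup>L lborel (\<lambda>x. f' x v)"
  proof (rule integral_dominated_convergence[OF _ _ intD])
    show "AE x in lborel. (\<lambda>n. q n x) \<longlonglongrightarrow> f' x v"
    proof (rule AE_I2)
      fix x
      have "((\<lambda>h. (f (h *\<^sub>R v + x) - f x) / h) \<longlongrightarrow> f' x v) (at 0)"
        using line[of x 0] by (simp add: DERIV_def)
      moreover have "filterlim t (at 0) sequentially"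
        unfolding t_def filterlim_at using LIMSEQ_inverse_real_of_nat by auto
      ultimately show "(\<lambda>n. q n x) \<longlonglongrightarrow> f' x v"
        unfolding q_def by (rule filterlim_compose)
    qed
    show "AE x in lborel. norm (q n x) \<le> B * indicator D x" for n
      using qbound qzero B(2) by (auto intro!: AE_I2 simp: indicator_def)
    show "q n \<in> borel_measurable lborel" for n unfolding q_def by measurable
  qed auto
  have "integral\<^sup>L lborel (q n) = 0" for n
  proof -
    have i2: "integrable (distr lborel borel ((+) (t n *\<^sub>R v))) f" by (simp add: lborel_distr_plus intf)
    then have i3: "integrable lborel (\<lambda>x. f (t n *\<^sub>R v + x))" by (subst (asm) integrable_distr_eq) auto
    have "integral\<^sup>L lborel (\<lambda>x. f (t n *\<^sub>R v + x)) = integral\<^sup>L (distr lborel borel ((+) (t n *\<^sub>R v))) f"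
      by (subst integral_distr) auto
    then have "integral\<^sup>L lborel (\<lambda>x. f (t n *\<^sub>R v + x)) = integral\<^sup>L lborel f" by (simp add: lborel_distr_plus)
    then show ?thesis unfolding q_def using i3 intf by simp
  qed
  then show "integral\<^sup>L lborel (\<lambda>x. f' x v) = 0" using conv LIMSEQ_unique[OF _ tendsto_const] by simp
qed

section \<open>The divergence of the tangential position field in coordinates\<close>

text \<open>The algebra behind \<open>div x\<^sup>T = n + \<langle>x\<^sup>\<bottom>, g\<^sup>i\<^sup>j \<partial>\<^sub>i\<partial>\<^sub>jF\<rangle>\<close> at one point. Here \<open>P i = \<partial>\<^sub>iF\<close>,
  \<open>Q i j = \<partial>\<^sub>i\<partial>\<^sub>jF\<close>, \<open>W = g\<^sup>-\<^sup>1\<close>, \<open>g' k = \<partial>\<^sub>kg\<close>, and \<open>X\<close> are the coordinates of \<open>x\<^sup>T\<close> with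
  derivatives \<open>X' k\<close>. The assumption on \<open>X'\<close> is the derivative of the normal equations
  \<open>(g X)\<^sub>i = \<langle>x, \<partial>\<^sub>iF\<rangle>\<close>; the left-hand side is \<open>\<partial>\<^sub>k (\<surd>(det g) X\<^sup>k) / \<surd>(det g)\<close> by Jacobi's formula.
  Solving for \<open>\<partial>\<^sub>kX\<^sup>k\<close> yields \<open>n\<close>, the term \<open>\<langle>x, g\<^sup>i\<^sup>jQ\<^sub>i\<^sub>j\<rangle>\<close>, and two terms from \<open>\<partial>\<^sub>kg\<close>: the sum of
  \<open>X\<^sub>l T\<^sub>l\<close> is \<open>\<langle>x\<^sup>T, g\<^sup>i\<^sup>jQ\<^sub>i\<^sub>j\<rangle>\<close>, and the sum of \<open>X\<^sub>l U\<^sub>l\<close> cancels the trace.\<close>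

lemma sqrt_det_divergence_algebra:
  fixes g W :: "real ^ 'n ^ 'n" and P :: "'n \<Rightarrow> 'v::real_inner" and Q :: "'n \<Rightarrow> 'n \<Rightarrow> 'v"
    and g' :: "'n \<Rightarrow> real ^ 'n ^ 'n" and X :: "real ^ 'n" and X' :: "'n \<Rightarrow> real ^ 'n" and x :: 'v
  assumes W: "W ** g = mat 1" and Wsym: "\<And>i j. W$i$j = W$j$i"
    and g: "\<And>i j. g$i$j = P i \<bullet> P j"
    and Q: "\<And>i j. Q i j = Q j i"
    and g': "\<And>k i j. g' k $i$j = Q k i \<bullet> P j + P i \<bullet> Q k j"
    and X': "\<And>k i. (g *v X' k) $ i + (g' k *v X) $ i = P k \<bullet> P i + x \<bullet> Q k i"
  shows "(\<Sum>k\<in>UNIV. trace (W ** g' k) / 2 * X$k + X' k $ k) =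
    real CARD('n) + (x - (\<Sum>l\<in>UNIV. X$l *\<^sub>R P l)) \<bullet> (\<Sum>i\<in>UNIV. \<Sum>j\<in>UNIV. W$i$j *\<^sub>R Q i j)"
proof -
  define U where "U l = (\<Sum>k\<in>UNIV. \<Sum>i\<in>UNIV. W$k$i * (P i \<bullet> Q k l))" for l
  define T where "T l = (\<Sum>k\<in>UNIV. \<Sum>i\<in>UNIV. W$k$i * (Q k i \<bullet> P l))" for l
  have tr: "trace (W ** g' k) / 2 = U k" for k
  proof -
    have "trace (W ** g' k) = (\<Sum>i\<in>UNIV. \<Sum>j\<in>UNIV. W$i$j * (Q k j \<bullet> P i)) + (\<Sum>i\<in>UNIV. \<Sum>j\<in>UNIV. W$i$j * (P j \<bullet> Q k i))"
      by (simp add: trace_def matrix_matrix_mult_def g' distrib_left sum.distrib)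
    also have "(\<Sum>i\<in>UNIV. \<Sum>j\<in>UNIV. W$i$j * (Q k j \<bullet> P i)) = (\<Sum>i\<in>UNIV. \<Sum>j\<in>UNIV. W$i$j * (P j \<bullet> Q k i))"
      by (subst sum.swap, intro sum.cong refl) (simp add: Wsym[of _ "_::'n"] inner_commute)
    also have "(\<Sum>i\<in>UNIV. \<Sum>j\<in>UNIV. W$i$j * (P j \<bullet> Q k i)) = U k"
      unfolding U_def by (simp add: Q[of k])
    finally show ?thesis by simp
  qed
  have X'eq: "X' k $ k = (\<Sum>i\<in>UNIV. W$k$i * (P k \<bullet> P i)) + (\<Sum>i\<in>UNIV. W$k$i * (x \<bullet> Q k i))
     - (\<Sum>i\<in>UNIV. \<Sum>l\<in>UNIV. X$l * (W$k$i * (Q k i \<bullet> P l) + W$k$i * (P i \<bullet> Q k l)))" for k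
  proof -
    have "X' k = W *v (g *v X' k)" by (simp add: matrix_vector_mul_assoc W)
    also have "g *v X' k = (\<chi> i. P k \<bullet> P i + x \<bullet> Q k i - (g' k *v X) $ i)"
      using X'[of k] by (simp add: vec_eq_iff algebra_simps)
    finally have "X' k $ k = (\<Sum>i\<in>UNIV. W$k$i * (P k \<bullet> P i + x \<bullet> Q k i - (g' k *v X) $ i))"
      by (metis (no_types, lifting) matrix_vector_mult_def sum.cong vec_lambda_beta)
    also have "\<dots> = (\<Sum>i\<in>UNIV. W$k$i * (P k \<bullet> P i)) + (\<Sum>i\<in>UNIV. W$k$i * (x \<bullet> Q k i))
     - (\<Sum>i\<in>UNIV. \<Sum>l\<in>UNIV. X$l * (W$k$i * (Q k i \<bullet> P l) + W$k$i * (P i \<bullet> Q k l)))"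
      by (simp add: matrix_vector_mult_def g' sum_distrib_left right_diff_distrib distrib_left sum.distrib sum_subtractf algebra_simps)
    finally show ?thesis .
  qed
  have n: "(\<Sum>k\<in>UNIV. \<Sum>i\<in>UNIV. W$k$i * (P k \<bullet> P i)) = real CARD('n)"
  proof -
    have "(\<Sum>k\<in>UNIV. \<Sum>i\<in>UNIV. W$k$i * (P k \<bullet> P i)) = trace (W ** g)"
      by (simp add: trace_def matrix_matrix_mult_def g inner_commute)
    then show ?thesis by (simp add: W trace_I)
  qed
  have x: "(\<Sum>k\<in>UNIV. \<Sum>i\<in>UNIV. W$k$i * (x \<bullet> Q k i)) = x \<bullet> (\<Sum>i\<in>UNIV. \<Sum>j\<in>UNIV. W$i$j *\<^sub>R Q i j)"
    by (simp add: inner_sum_right)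
  have TU: "(\<Sum>k\<in>UNIV. \<Sum>i\<in>UNIV. \<Sum>l\<in>UNIV. X$l * (W$k$i * (Q k i \<bullet> P l) + W$k$i * (P i \<bullet> Q k l)))
    = (\<Sum>l\<in>UNIV. X$l * T l) + (\<Sum>l\<in>UNIV. X$l * U l)"
  proof -
    have "(\<Sum>k\<in>UNIV. \<Sum>i\<in>UNIV. \<Sum>l\<in>UNIV. X$l * (W$k$i * (Q k i \<bullet> P l) + W$k$i * (P i \<bullet> Q k l)))
      = (\<Sum>l\<in>UNIV. \<Sum>k\<in>UNIV. \<Sum>i\<in>UNIV. X$l * (W$k$i * (Q k i \<bullet> P l) + W$k$i * (P i \<bullet> Q k l)))"
      by (subst sum.swap[where A = "UNIV :: 'n set"]) (rule sum.swap)
    then show ?thesis by (simp add: T_def U_def sum_distrib_left sum.distrib distrib_left)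
  qed
  have Teq: "(\<Sum>l\<in>UNIV. X$l * T l) = (\<Sum>l\<in>UNIV. X$l *\<^sub>R P l) \<bullet> (\<Sum>i\<in>UNIV. \<Sum>j\<in>UNIV. W$i$j *\<^sub>R Q i j)"
  proof -
    have "T l = P l \<bullet> (\<Sum>i\<in>UNIV. \<Sum>j\<in>UNIV. W$i$j *\<^sub>R Q i j)" for l
      by (simp add: T_def inner_sum_right inner_commute)
    then show ?thesis by (simp add: inner_sum_left)
  qed
  have "(\<Sum>k\<in>UNIV. trace (W ** g' k) / 2 * X$k + X' k $ k)
    = (\<Sum>k\<in>UNIV. X$k * U k) + (\<Sum>k\<in>UNIV. X' k $ k)"
    by (simp add: tr sum.distrib mult.commute)
  also have "(\<Sum>k\<in>UNIV. X' k $ k) = real CARD('n) + x \<bullet> (\<Sum>i\<in>UNIV. \<Sum>j\<in>UNIV. W$i$j *\<^sub>R Q i j)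
     - ((\<Sum>l\<in>UNIV. X$l * T l) + (\<Sum>l\<in>UNIV. X$l * U l))"
    unfolding X'eq sum_subtractf sum.distrib n x TU ..
  finally show ?thesis by (simp add: Teq inner_diff_left)
qed

text \<open>The second derivative \<open>\<partial>\<^sub>u\<partial>\<^sub>vF\<close> of the immersion in a chart, with the outer derivative in the
  direction of the first argument, as in the second fundamental form.\<close>

definition hess ::
  "('p \<Rightarrow> real ^ 'm) \<Rightarrow> ('p, 'n::finite) chart \<Rightarrow> real ^ 'n \<Rightarrow> real ^ 'n \<Rightarrow> real ^ 'n \<Rightarrow> real ^ 'm" where
  "hess F c y u v = frechet_derivative (\<lambda>z. local_deriv F c z v) (at y) u"

text \<open>The full vector \<open>g\<^sup>i\<^sup>j \<partial>\<^sub>i\<partial>\<^sub>jF\<close>, whose normal part is the mean curvature vector. Only its inner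
  product with normal vectors is independent of the chart.\<close>

definition trace_hess :: "('p \<Rightarrow> real ^ 'm) \<Rightarrow> ('p, 'n::finite) chart \<Rightarrow> real ^ 'n \<Rightarrow> real ^ 'm" where
  "trace_hess F c y =
     (\<Sum>i\<in>UNIV. \<Sum>j\<in>UNIV. matrix_inv (gram F c y) $ i $ j *\<^sub>R hess F c y (axis i 1) (axis j 1))"

definition vol_density :: "('p \<Rightarrow> real ^ 'm) \<Rightarrow> ('p, 'n::finite) chart \<Rightarrow> real ^ 'n \<Rightarrow> real" where
  "vol_density F c y = sqrt (det (gram F c y))"

text \<open>The solution of the normal equations for the orthogonal projection of the position vector
  to the tangent space: the coordinates of \<open>x\<^sup>T\<close> in the basis \<open>\<partial>\<^sub>iF\<close>.\<close>

definition tangent_coords :: "('p \<Rightarrow> real ^ 'm) \<Rightarrow> ('p, 'n::finite) chart \<Rightarrow> real ^ 'n \<Rightarrow> real ^ 'n" where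
  "tangent_coords F c y =
     matrix_inv (gram F c y) *v (\<chi> i. local_rep F c y \<bullet> local_deriv F c y (axis i 1))"

definition normal_position :: "('p \<Rightarrow> real ^ 'm) \<Rightarrow> ('p, 'n::finite) chart \<Rightarrow> real ^ 'n \<Rightarrow> real ^ 'm" where
  "normal_position F c y = local_rep F c y - local_deriv F c y (tangent_coords F c y)"

locale immersed_patch =
  fixes F :: "'p \<Rightarrow> real ^ 'm::finite" and c :: "('p, 'n::finite) chart"
  assumes open_range: "open (chart_range c)"
    and twice_differentiable: "Ck_on 2 (local_rep F c) (chart_range c)"
    and inj_deriv: "y \<in> chart_range c \<Longrightarrow> inj (local_deriv F c y)"
begin

abbreviation "S \<equiv> chart_range c"
abbreviation "G \<equiv> local_rep F c"
abbreviation "D \<equiv> local_deriv F c"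
abbreviation "g \<equiv> gram F c"

lemma C1_on_D: "C1_on (\<lambda>y. D y v) S"
  using twice_differentiable by (simp add: numeral_2_eq_2 C1_on_iff local_deriv_def)

lemma has_derivative_G: "y \<in> S \<Longrightarrow> (G has_derivative D y) (at y)"
  using twice_differentiable by (simp add: numeral_2_eq_2 local_deriv_def frechet_derivative_works)

lemma linear_D: "y \<in> S \<Longrightarrow> linear (D y)"
  using has_derivative_G has_derivative_linear by blast

lemma C1_on_G: "C1_on G S"
  by (rule C1_onI[OF has_derivative_G]) (auto intro: C1_on_continuous C1_on_D)

lemma has_derivative_D: "y \<in> S \<Longrightarrow> ((\<lambda>y. D y v) has_derivative (\<lambda>u. hess F c y u v)) (at y)"
  unfolding hess_def using C1_on_has_derivative[OF C1_on_D] .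

lemma hess_symmetric: "y \<in> S \<Longrightarrow> hess F c y u v = hess F c y v u"
  using second_derivative_symmetric[OF open_range, of y G D "\<lambda>v y u. hess F c y u v" v u]
    has_derivative_G has_derivative_D C1_on_continuous_deriv[OF C1_on_D]
  by (simp add: hess_def)

lemma linear_hess_left: "y \<in> S \<Longrightarrow> linear (\<lambda>u. hess F c y u v)"
  using has_derivative_D has_derivative_linear by blast

lemma linear_hess_right:
  assumes y: "y \<in> S" shows "linear (\<lambda>v. hess F c y u v)"
  using linear_hess_left[OF y, of u] by (simp add: hess_symmetric[OF y, of u])

lemma D_expand: "y \<in> S \<Longrightarrow> D y v = (\<Sum>i\<in>UNIV. v $ i *\<^sub>R D y (axis i 1))"
  by (rule linear_expand_axis[OF linear_D])

lemma inner_gram: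
  assumes "y \<in> S" shows "v \<bullet> (g y *v w) = D y v \<bullet> D y w"
  unfolding D_expand[OF assms, of v] D_expand[OF assms, of w]
  by (simp add: inner_vec_def[of v] matrix_vector_mult_def gram_def inner_sum_left inner_sum_right
      sum_distrib_left mult_ac) (rule sum.swap)

lemma gram_symmetric: "g y $ i $ j = g y $ j $ i"
  by (simp add: gram_def inner_commute)

lemma D_eq_0: "y \<in> S \<Longrightarrow> D y v = 0 \<Longrightarrow> v = 0"
  using inj_deriv linear_D by (meson linear_injective_0)

text \<open>The segment from the identity matrix to the Gram matrix consists of positive definite, hence
  invertible, matrices; so the determinant cannot change sign along it.\<close>

lemma det_gram_pos:
  assumes y: "y \<in> S" shows "det (g y) > 0"
proof (rule ccontr)
  assume neg: "\<not> det (g y) > 0"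
  define h :: "real \<Rightarrow> real^'n^'n" where "h t = (1 - t) *\<^sub>R mat 1 + t *\<^sub>R g y" for t
  have "continuous_on {0..1} (\<lambda>t. det (h t))"
    by (intro C1_on_continuous[OF C1_on_det])
       (auto simp: h_def intro!: C1_on_real derivative_eq_intros continuous_intros)
  moreover have "det (h 0) = 1" "det (h 1) \<le> 0" using neg by (simp_all add: h_def)
  ultimately obtain t where t: "0 \<le> t" "t \<le> 1" "det (h t) = 0"
    using IVT2'[of "\<lambda>t. det (h t)" 1 0 0] by auto
  then obtain v where v: "v \<noteq> 0" "h t *v v = 0"
    using invertible_det_nz[of "h t"] matrix_left_invertible_ker[of "h t"] invertible_left_inverse[of "h t"] by auto
  have "h t *v v = (1 - t) *\<^sub>R v + t *\<^sub>R (g y *v v)"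
    by (simp add: h_def matrix_vector_mult_add_rdistrib scaleR_matrix_vector_assoc[symmetric])
  then have "0 = (1 - t) * (v \<bullet> v) + t * (v \<bullet> (g y *v v))"
    using v(2) by (metis inner_add_right inner_scaleR_right inner_zero_right)
  moreover have "v \<bullet> v > 0" using v by simp
  moreover have "v \<bullet> (g y *v v) > 0" using v D_eq_0[OF y] inner_gram[OF y] by auto
  ultimately show False using t
    by (metis add_nonneg_eq_0_iff diff_ge_0_iff_ge less_eq_real_def mult_eq_0_iff mult_nonneg_nonneg order_less_irrefl right_minus_eq zero_neq_one)
qed

lemma vol_density_pos: "y \<in> S \<Longrightarrow> vol_density F c y > 0"
  by (simp add: vol_density_def det_gram_pos)

lemmas gram_inverse = matrix_inv_mult[OF less_imp_neq[OF det_gram_pos, symmetric]]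

lemma C1_on_gram: "C1_on (\<lambda>y. g y $ i $ j) S"
  unfolding gram_def by (simp add: C1_on_inner C1_on_D)

lemma C1_on_vol_density: "C1_on (vol_density F c) S"
  unfolding vol_density_def[abs_def] by (intro C1_on_sqrt C1_on_det C1_on_gram det_gram_pos)

lemma gram_tangent_coords:
  assumes "y \<in> S" shows "g y *v tangent_coords F c y = (\<chi> i. G y \<bullet> D y (axis i 1))"
  by (simp add: tangent_coords_def matrix_vector_mul_assoc gram_inverse assms)

text \<open>By Cramer's rule the coordinates of \<open>x\<^sup>T\<close> are quotients of determinants with \<open>C\<^sup>1\<close>
  entries, so the matrix inverse need not be differentiated.\<close>

lemma C1_on_tangent_coords: "C1_on (tangent_coords F c) S"
proof (rule C1_on_vecI)
  fix k
  let ?A = "\<lambda>y. \<chi> i j. if j = k then G y \<bullet> D y (axis i 1) else g y $ i $ j"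
  have "C1_on (\<lambda>y. det (?A y) / det (g y)) S"
  proof (intro C1_on_divide C1_on_det C1_on_gram)
    show "C1_on (\<lambda>x. ?A x $ i $ j) S" for i j
      using C1_on_gram[of i j] C1_on_inner[OF C1_on_G C1_on_D, of "axis i 1"] by (cases "j = k") simp_all
  qed (use det_gram_pos in force)
  then show "C1_on (\<lambda>y. tangent_coords F c y $ k) S"
  proof (rule C1_on_cong[OF open_range])
    fix y assume y: "y \<in> S"
    then have "det (g y) \<noteq> 0" using det_gram_pos by force
    from iffD1[OF cramer[OF this] gram_tangent_coords[OF y]]
    have "tangent_coords F c y $ k
      = det (\<chi> i j. if j = k then (\<chi> i. G y \<bullet> D y (axis i 1)) $ i else g y $ i $ j) / det (g y)"
      by (metis (lifting) vec_lambda_beta)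
    then show "det (?A y) / det (g y) = tangent_coords F c y $ k"
      by (simp only: vec_lambda_beta)
  qed
qed

lemma normal_position_orthogonal:
  assumes y: "y \<in> S" shows "normal_position F c y \<bullet> D y v = 0"
proof -
  have "D y (tangent_coords F c y) \<bullet> D y v = v \<bullet> (g y *v tangent_coords F c y)"
    by (simp add: inner_gram[OF y] inner_commute)
  also have "\<dots> = G y \<bullet> D y v"
    unfolding gram_tangent_coords[OF y] D_expand[OF y, of v] by (simp add: inner_vec_def[of v] inner_sum_right)
  finally show ?thesis by (simp add: normal_position_def inner_diff_left)
qed

lemma matrix_inv_gram_symmetric:
  assumes y: "y \<in> S" shows "matrix_inv (g y) $ i $ j = matrix_inv (g y) $ j $ i"
proof -
  have "transpose (g y) = g y"
    unfolding vec_eq_iff transpose_def using gram_symmetric[of y] by simp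
  then have "transpose (matrix_inv (g y)) ** g y = mat 1"
    using gram_inverse(1)[OF y] matrix_transpose_mul[of "g y" "matrix_inv (g y)"] by (simp add: transpose_mat)
  from matrix_inv_eqI[OF this] have "matrix_inv (g y) = transpose (matrix_inv (g y))" .
  from arg_cong[OF this, of "\<lambda>M. M $ i $ j"] show ?thesis by (simp add: transpose_def)
qed

lemma has_derivative_vol_density:
  assumes y: "y \<in> S"
  shows "(vol_density F c has_derivative (\<lambda>h. vol_density F c y *
    (trace (matrix_inv (g y) ** (\<chi> i j. hess F c y h (axis i 1) \<bullet> D y (axis j 1) + D y (axis i 1) \<bullet> hess F c y h (axis j 1))) / 2))) (at y)"
proof -
  define g' where "g' = frechet_derivative g (at y)"
  have g: "(g has_derivative g') (at y)"
    unfolding g'_def by (rule C1_on_has_derivative[OF _ y]) (intro C1_on_vecI C1_on_gram)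
  have g'eq: "g' h = (\<chi> i j. hess F c y h (axis i 1) \<bullet> D y (axis j 1) + D y (axis i 1) \<bullet> hess F c y h (axis j 1))" for h
  proof -
    have "g' h $ i $ j = D y (axis i 1) \<bullet> hess F c y h (axis j 1) + hess F c y h (axis i 1) \<bullet> D y (axis j 1)" for i j
    proof -
      have "((\<lambda>y. g y $ i $ j) has_derivative (\<lambda>h. g' h $ i $ j)) (at y)"
        by (intro bounded_linear.has_derivative[OF bounded_linear_vec_nth] g)
      from has_derivative_unique[OF this] have "(\<lambda>h. g' h $ i $ j) = k" if "((\<lambda>y. g y $ i $ j) has_derivative k) (at y)" for k
        using that by blast
      note uniq = fun_cong[OF this, of _ h]
      have "((\<lambda>y. g y $ i $ j) has_derivative
          (\<lambda>h. D y (axis i 1) \<bullet> hess F c y h (axis j 1) + hess F c y h (axis i 1) \<bullet> D y (axis j 1))) (at y)"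
        unfolding gram_def using has_derivative_inner[OF has_derivative_D[OF y] has_derivative_D[OF y]] by simp
      from uniq[OF this] show ?thesis .
    qed
    then show ?thesis by (simp add: vec_eq_iff add.commute)
  qed
  have pos: "det (g y) > 0" by (rule det_gram_pos[OF y])
  have "((\<lambda>y. det (g y)) has_derivative (\<lambda>h. det (g y) * trace (matrix_inv (g y) ** g' h))) (at y)"
    using has_derivative_det[OF g] pos by simp
  note d = has_derivative_real_sqrt[OF pos this]
  have "det (g y) * t * (inverse (sqrt (det (g y))) / 2) = sqrt (det (g y)) * (t / 2)" for t
  proof -
    have "det (g y) * t * (inverse (sqrt (det (g y))) / 2) = det (g y) / sqrt (det (g y)) * (t / 2)"
      by (simp only: divide_inverse mult_ac)
    then show ?thesis by (simp only: real_div_sqrt[OF less_imp_le[OF pos]])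
  qed
  with d have "((\<lambda>y. sqrt (det (g y))) has_derivative (\<lambda>h. sqrt (det (g y)) * (trace (matrix_inv (g y) ** g' h) / 2))) (at y)"
    by (simp only:)
  then show ?thesis unfolding vol_density_def[abs_def] g'eq by simp
qed

text \<open>The divergence formula \<open>div x\<^sup>T = n + \<langle>x\<^sup>\<bottom>, H\<rangle>\<close> in coordinates, before the self-expander
  equation is used.\<close>

lemma divergence_tangent_coords:
  assumes y: "y \<in> S"
  shows "(\<Sum>k\<in>UNIV. frechet_derivative (\<lambda>y. vol_density F c y * tangent_coords F c y $ k) (at y) (axis k 1))
    = vol_density F c y * (real CARD('n) + normal_position F c y \<bullet> trace_hess F c y)"
proof -
  let ?X = "tangent_coords F c"
  define X' where "X' = frechet_derivative ?X (at y)"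
  have X: "(?X has_derivative X') (at y)"
    unfolding X'_def by (rule C1_on_has_derivative[OF C1_on_tangent_coords y])
  have Xn: "((\<lambda>y. ?X y $ k) has_derivative (\<lambda>h. X' h $ k)) (at y)" for k
    by (intro bounded_linear.has_derivative[OF bounded_linear_vec_nth] X)
  define g' where "g' h = (\<chi> i j. hess F c y h (axis i 1) \<bullet> D y (axis j 1) + D y (axis i 1) \<bullet> hess F c y h (axis j 1))" for h
  \<comment> \<open>The normal equations hold on the whole chart, so both sides have the same derivative.\<close>
  have eqn: "(g y *v X' h) $ i + (g' h *v ?X y) $ i = D y h \<bullet> D y (axis i 1) + G y \<bullet> hess F c y h (axis i 1)" for h i
  proof -
    have g: "((\<lambda>y. g y $ i $ j) has_derivative (\<lambda>h. g' h $ i $ j)) (at y)" for j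
      unfolding gram_def g'_def using has_derivative_inner[OF has_derivative_D[OF y] has_derivative_D[OF y]]
      by (simp add: add.commute)
    have "((\<lambda>y. \<Sum>j\<in>UNIV. g y $ i $ j * ?X y $ j) has_derivative
        (\<lambda>h. \<Sum>j\<in>UNIV. g y $ i $ j * X' h $ j + g' h $ i $ j * ?X y $ j)) (at y)"
      by (intro has_derivative_sum has_derivative_mult g Xn)
    then have 1: "((\<lambda>y. G y \<bullet> D y (axis i 1)) has_derivative
        (\<lambda>h. \<Sum>j\<in>UNIV. g y $ i $ j * X' h $ j + g' h $ i $ j * ?X y $ j)) (at y)"
    proof (rule has_derivative_transform_within_open[OF _ open_range y])
      fix z assume "z \<in> S"
      from gram_tangent_coords[OF this] show "(\<Sum>j\<in>UNIV. g z $ i $ j * ?X z $ j) = G z \<bullet> D z (axis i 1)"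
        by (simp add: vec_eq_iff matrix_vector_mult_def)
    qed
    have 2: "((\<lambda>y. G y \<bullet> D y (axis i 1)) has_derivative (\<lambda>h. G y \<bullet> hess F c y h (axis i 1) + D y h \<bullet> D y (axis i 1))) (at y)"
      by (rule has_derivative_inner[OF has_derivative_G[OF y] has_derivative_D[OF y]])
    have "(\<Sum>j\<in>UNIV. g y $ i $ j * X' h $ j + g' h $ i $ j * ?X y $ j) = G y \<bullet> hess F c y h (axis i 1) + D y h \<bullet> D y (axis i 1)"
      using fun_cong[OF has_derivative_unique[OF 1 2], of h] .
    then show ?thesis by (simp add: matrix_vector_mult_def sum.distrib)
  qed
  have fd: "frechet_derivative (\<lambda>y. vol_density F c y * ?X y $ k) (at y) h
     = vol_density F c y * (trace (matrix_inv (g y) ** g' h) / 2 * ?X y $ k + X' h $ k)" for k h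
  proof -
    have "((\<lambda>y. vol_density F c y * ?X y $ k) has_derivative (\<lambda>h. vol_density F c y * X' h $ k +
       (vol_density F c y * (trace (matrix_inv (g y) ** g' h) / 2)) * ?X y $ k)) (at y)"
      unfolding g'_def by (intro has_derivative_mult has_derivative_vol_density y Xn)
    from frechet_derivative_at[OF this, symmetric] show ?thesis by (simp add: algebra_simps)
  qed
  have "(\<Sum>k\<in>UNIV. trace (matrix_inv (g y) ** g' (axis k 1)) / 2 * ?X y $ k + X' (axis k 1) $ k)
    = real CARD('n) + (G y - (\<Sum>l\<in>UNIV. ?X y $ l *\<^sub>R D y (axis l 1))) \<bullet>
      (\<Sum>i\<in>UNIV. \<Sum>j\<in>UNIV. matrix_inv (g y) $ i $ j *\<^sub>R hess F c y (axis i 1) (axis j 1))"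
  proof (rule sqrt_det_divergence_algebra[where g = "g y" and g' = "\<lambda>k. g' (axis k 1)"])
    show "matrix_inv (g y) ** g y = mat 1" by (rule gram_inverse(2)[OF y])
    show "matrix_inv (g y) $ i $ j = matrix_inv (g y) $ j $ i" for i j
      by (rule matrix_inv_gram_symmetric[OF y])
    show "hess F c y (axis i 1) (axis j 1) = hess F c y (axis j 1) (axis i 1)" for i j
      by (rule hess_symmetric[OF y])
    show "(g y *v X' (axis k 1)) $ i + (g' (axis k 1) *v ?X y) $ i
      = D y (axis k 1) \<bullet> D y (axis i 1) + G y \<bullet> hess F c y (axis k 1) (axis i 1)" for k i
      by (rule eqn)
  qed (simp_all add: gram_def g'_def)
  then show ?thesis
    unfolding fd sum_distrib_left[symmetric]
    by (simp add: normal_position_def trace_hess_def D_expand[OF y, symmetric])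
qed

text \<open>The divergence theorem for \<open>\<zeta> x\<^sup>T\<close> with \<open>\<zeta>\<close> supported inside a chart.\<close>

lemma integral_divergence_in_chart:
  assumes \<zeta>: "C1_on \<zeta> S" and C: "compact C" "C \<subseteq> S" "\<And>y. y \<in> S - C \<Longrightarrow> \<zeta> y = 0"
  defines "E \<equiv> \<lambda>y. indicator S y * (vol_density F c y *
    (frechet_derivative \<zeta> (at y) (tangent_coords F c y) +
     \<zeta> y * (real CARD('n) + normal_position F c y \<bullet> trace_hess F c y)))"
  shows "integrable lborel E" "integral\<^sup>L lborel E = 0"
proof -
  let ?V = "\<lambda>k y. vol_density F c y * tangent_coords F c y $ k"
  \<comment> \<open>The components of \<open>\<surd>(det g) \<zeta> x\<^sup>T\<close>, extended by zero to the whole space; they are \<open>C\<^sup>1\<close>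
    because they vanish outside a compact subset of the chart range.\<close>
  define \<Phi> where "\<Phi> k y = (if y \<in> S then \<zeta> y * ?V k y else 0)" for k y
  have VC1: "C1_on (?V k) S" for k
    by (intro C1_on_mult C1_on_vol_density C1_on_vec_nth C1_on_tangent_coords)
  have \<Phi>0: "\<Phi> k y = 0" if "y \<notin> C" for k y using C that by (auto simp: \<Phi>_def)
  have C1: "C1_on (\<Phi> k) UNIV" for k
  proof -
    have "C1_on (\<Phi> k) S"
      by (rule C1_on_cong[OF open_range C1_on_mult[OF \<zeta> VC1[of k]]]) (simp add: \<Phi>_def)
    moreover have "C1_on (\<Phi> k) (- C)"
      by (rule C1_on_cong[OF _ C1_on_const[of 0]]) (use \<Phi>0 open_Compl[OF compact_imp_closed[OF C(1)]] in auto)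
    moreover have "S \<union> - C = UNIV" using C by auto
    ultimately show ?thesis
      using C1_on_Un[OF open_range, of "- C" "\<Phi> k"] compact_imp_closed[OF C(1)] by auto
  qed
  let ?\<Phi>' = "\<lambda>k y. frechet_derivative (\<Phi> k) (at y)"
  have der: "(\<Phi> k has_derivative ?\<Phi>' k y) (at y)" for k y using C1_on_has_derivative[OF C1] by simp
  have int: "integrable lborel (\<lambda>y. ?\<Phi>' k y (axis k 1))" "integral\<^sup>L lborel (\<lambda>y. ?\<Phi>' k y (axis k 1)) = 0" for k
    using integral_directional_derivative_eq_0[OF der C1_on_continuous_deriv[OF C1] C(1) \<Phi>0] by auto
  have E: "E = (\<lambda>y. \<Sum>k\<in>UNIV. ?\<Phi>' k y (axis k 1))"
  proof
    fix y
    show "E y = (\<Sum>k\<in>UNIV. ?\<Phi>' k y (axis k 1))"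
    proof (cases "y \<in> S")
      case True
      have \<zeta>': "(\<zeta> has_derivative frechet_derivative \<zeta> (at y)) (at y)" by (rule C1_on_has_derivative[OF \<zeta> True])
      have "?\<Phi>' k y h = \<zeta> y * frechet_derivative (?V k) (at y) h + frechet_derivative \<zeta> (at y) h * ?V k y" for k h
      proof -
        have "((\<lambda>y. \<zeta> y * ?V k y) has_derivative
           (\<lambda>h. \<zeta> y * frechet_derivative (?V k) (at y) h + frechet_derivative \<zeta> (at y) h * ?V k y)) (at y)"
          by (intro has_derivative_mult \<zeta>' C1_on_has_derivative[OF VC1 True])
        then have "(\<Phi> k has_derivative
           (\<lambda>h. \<zeta> y * frechet_derivative (?V k) (at y) h + frechet_derivative \<zeta> (at y) h * ?V k y)) (at y)"
          by (rule has_derivative_transform_within_open[OF _ open_range True]) (simp add: \<Phi>_def)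
        from fun_cong[OF has_derivative_unique[OF der this]] show ?thesis by simp
      qed
      then have "(\<Sum>k\<in>UNIV. ?\<Phi>' k y (axis k 1)) = \<zeta> y * (\<Sum>k\<in>UNIV. frechet_derivative (?V k) (at y) (axis k 1))
         + vol_density F c y * (\<Sum>k\<in>UNIV. tangent_coords F c y $ k * frechet_derivative \<zeta> (at y) (axis k 1))"
        by (simp add: sum.distrib sum_distrib_left mult_ac)
      also have "(\<Sum>k\<in>UNIV. tangent_coords F c y $ k * frechet_derivative \<zeta> (at y) (axis k 1))
        = frechet_derivative \<zeta> (at y) (tangent_coords F c y)"
      proof -
        have "linear (frechet_derivative \<zeta> (at y))" using \<zeta>' has_derivative_linear by blast
        then have "frechet_derivative \<zeta> (at y) (\<Sum>k\<in>UNIV. tangent_coords F c y $ k *\<^sub>R axis k 1)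
          = (\<Sum>k\<in>UNIV. tangent_coords F c y $ k * frechet_derivative \<zeta> (at y) (axis k 1))"
          by (simp add: linear_sum linear_cmul)
        then show ?thesis by (simp add: basis_expansion scalar_mult_eq_scaleR[symmetric])
      qed
      finally show ?thesis
        unfolding divergence_tangent_coords[OF True] using True by (simp add: E_def algebra_simps)
    next
      case False
      then have "y \<notin> C" using C by auto
      then have "?\<Phi>' k y = (\<lambda>h. 0)" for k
        by (rule has_derivative_zero_outside[OF der compact_imp_closed[OF C(1)]]) (rule \<Phi>0)
      then show ?thesis using False by (simp add: E_def)
    qed
  qed
  show "integrable lborel E" "integral\<^sup>L lborel E = 0"
    unfolding E using int by (simp_all add: Bochner_Integration.integral_sum)
qed

end

section \<open>Change of variables for arbitrary finite index types\<close>

text \<open>The theorem \<open>has_absolute_integral_change_of_variables\<close> concerns coordinates that are indexed by a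
  well-ordered type. The following type is a well-ordered copy of an arbitrary finite index type;
  renaming the coordinates changes neither Lebesgue measure nor determinants, so the theorem
  transfers.\<close>

typedef 'n ordered_index = "{..<CARD('n::finite)}"
  by (rule exI[of _ 0]) simp

instantiation ordered_index :: (finite) wellorder
begin

definition less_eq_ordered_index :: "'a ordered_index \<Rightarrow> 'a ordered_index \<Rightarrow> bool" where
  "less_eq_ordered_index i j \<longleftrightarrow> Rep_ordered_index i \<le> Rep_ordered_index j"

definition less_ordered_index :: "'a ordered_index \<Rightarrow> 'a ordered_index \<Rightarrow> bool" where
  "less_ordered_index i j \<longleftrightarrow> Rep_ordered_index i < Rep_ordered_index j"

instance
proof
  fix P :: "'a ordered_index \<Rightarrow> bool" and a :: "'a ordered_index"
  assume step: "\<And>x. (\<And>y. y < x \<Longrightarrow> P y) \<Longrightarrow> P x"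
  show "P a"
  proof (induction a rule: measure_induct_rule[of Rep_ordered_index])
    case (less x)
    show ?case by (rule step) (rule less, simp add: less_ordered_index_def)
  qed
qed (auto simp: less_eq_ordered_index_def less_ordered_index_def Rep_ordered_index_inject)

end

lemma card_ordered_index: "card (UNIV :: 'n::finite ordered_index set) = CARD('n)"
  by (subst type_definition.card[OF type_definition_ordered_index]) simp

instance ordered_index :: (finite) finite
proof
  show "finite (UNIV :: 'a ordered_index set)"
    by (rule card_ge_0_finite) (simp add: card_ordered_index)
qed

definition reindex :: "('b \<Rightarrow> 'a) \<Rightarrow> real ^ 'a \<Rightarrow> real ^ 'b" where
  "reindex e x = (\<chi> k. x $ e k)"

lemma linear_reindex: "linear (reindex e)" for e :: "'b::finite \<Rightarrow> 'a::finite"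
  by (rule linearI) (simp_all add: reindex_def vec_eq_iff)

lemma continuous_reindex: "continuous_on UNIV (reindex e)" for e :: "'b::finite \<Rightarrow> 'a::finite"
  by (simp add: linear_continuous_on linear_conv_bounded_linear[symmetric] linear_reindex)

lemma reindex_measurable[measurable]: "reindex e \<in> borel_measurable borel" for e :: "'b::finite \<Rightarrow> 'a::finite"
  by (rule borel_measurable_continuous_onI[OF continuous_reindex])

lemma reindex_reindex: "reindex e (reindex d x) = reindex (d \<circ> e) x"
  by (simp add: reindex_def)

lemma reindex_id: "reindex id x = x"
  by (simp add: reindex_def)

text \<open>A renaming of coordinates permutes the sides of a box, and boxes determine Lebesgue measure.\<close>

lemma lborel_reindex:
  fixes e :: "'b::finite \<Rightarrow> 'a::finite"
  assumes "bij e"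
  shows "distr lborel borel (reindex e) = lborel"
proof (rule lborel_eqI[symmetric])
  fix l u :: "real ^ 'b" assume lu: "\<And>b. b \<in> Basis \<Longrightarrow> l \<bullet> b \<le> u \<bullet> b"
  let ?r = "reindex (inv e)"
  have le: "l $ k \<le> u $ k" for k
    using lu[of "axis k 1"] by (simp add: inner_axis axis_in_Basis_iff)
  have "reindex e -` box l u = box (?r l) (?r u)"
  proof -
    have "(\<forall>k. l $ k < x $ e k \<and> x $ e k < u $ k) \<longleftrightarrow> (\<forall>i. l $ inv e i < x $ i \<and> x $ i < u $ inv e i)" for x :: "real ^ 'a"
      using assms by (metis bij_inv_eq_iff)
    then show ?thesis by (auto simp: mem_box_cart reindex_def)
  qed
  then have "emeasure (distr lborel borel (reindex e)) (box l u) = emeasure lborel (box (?r l) (?r u))"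
    by (subst emeasure_distr) auto
  also have "\<dots> = ennreal (\<Prod>i\<in>UNIV. ?r u $ i - ?r l $ i)"
  proof -
    have "\<forall>b\<in>Basis. ?r l \<bullet> b \<le> ?r u \<bullet> b"
      using le by (auto simp: Basis_vec_def inner_axis reindex_def)
    then have "emeasure lborel (box (?r l) (?r u)) = (\<Prod>b\<in>Basis. (?r u - ?r l) \<bullet> b)"
      by (subst emeasure_lborel_box) auto
    also have "(\<Prod>b\<in>Basis. (?r u - ?r l) \<bullet> b) = (\<Prod>i\<in>UNIV. ?r u $ i - ?r l $ i)"
      by (subst Basis_vec_def) (simp add: UNION_singleton_eq_range prod.reindex inj_def axis_eq_axis inner_axis)
    finally show ?thesis .
  qed
  also have "(\<Prod>i\<in>UNIV. ?r u $ i - ?r l $ i) = (\<Prod>k\<in>UNIV. u $ k - l $ k)"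
    using prod.reindex_bij_betw[OF bij_imp_bij_inv[OF assms], of "\<lambda>k. u $ k - l $ k"]
    by (simp add: reindex_def)
  also have "\<dots> = (\<Prod>b\<in>Basis. (u - l) \<bullet> b)"
    by (subst Basis_vec_def) (simp add: UNION_singleton_eq_range prod.reindex inj_def axis_eq_axis inner_axis)
  finally show "emeasure (distr lborel borel (reindex e)) (box l u) = ennreal (\<Prod>b\<in>Basis. (u - l) \<bullet> b)" .
qed simp

lemma det_reindex:
  fixes A :: "real ^ 'a ^ 'a" and e :: "'b::finite \<Rightarrow> 'a::finite"
  assumes e: "bij e"
  shows "det (\<chi> i j. A $ e i $ e j) = det A"
proof -
  let ?m = "map_permutation (UNIV::'b set) e"
  let ?m' = "map_permutation (UNIV::'a set) (inv e)"
  have m: "?m p = e \<circ> p \<circ> inv e" for p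
    using e bij_is_surj[OF e] by (simp add: map_permutation_def fun_eq_iff restrict_id_def)
  have m': "?m' p = inv e \<circ> p \<circ> e" for p
    using e bij_is_surj[OF bij_imp_bij_inv[OF e]] by (simp add: map_permutation_def fun_eq_iff restrict_id_def inv_inv_eq)
  have perm: "?m p permutes UNIV" if "p permutes UNIV" for p
    by (rule map_permutation_permutes) (use e that in auto)
  have perm': "?m' p permutes UNIV" if "p permutes UNIV" for p
    by (rule map_permutation_permutes) (use e bij_imp_bij_inv that in auto)
  have inv1: "e (inv e i) = i" "inv e (e k) = k" for i k
    using e by (simp_all add: bij_is_surj surj_f_inv_f bij_is_inj)
  show ?thesis
    unfolding det_def
  proof (rule sum.reindex_bij_witness[where i = ?m' and j = ?m])
    fix p :: "'b \<Rightarrow> 'b" assume p: "p \<in> {p. p permutes UNIV}"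
    show "?m' (?m p) = p" by (simp add: m m' fun_eq_iff inv1)
    show "?m p \<in> {p. p permutes UNIV}" using perm p by simp
    have "sign (?m p) = sign p"
      by (rule sign_map_permutation) (use e bij_is_inj p in auto)
    moreover have "(\<Prod>i\<in>UNIV. A $ i $ ?m p i) = (\<Prod>k\<in>UNIV. A $ e k $ e (p k))"
      using prod.reindex_bij_betw[OF e, of "\<lambda>i. A $ i $ ?m p i"] by (simp add: m inv1)
    ultimately show "of_int (sign (?m p)) * (\<Prod>i\<in>UNIV. A $ i $ ?m p i) =
      of_int (sign p) * (\<Prod>i\<in>UNIV. (\<chi> i j. A $ e i $ e j) $ i $ p i)" by simp
  next
    fix p :: "'a \<Rightarrow> 'a" assume p: "p \<in> {p. p permutes UNIV}"
    show "?m (?m' p) = p" by (simp add: m m' fun_eq_iff inv1)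
    show "?m' p \<in> {p. p permutes UNIV}" using perm' p by simp
  qed
qed

text \<open>For a nonnegative integrand, absolute integrability of the vector-valued integrand in the change of
  variables theorem is the same as existence of the scalar integral.\<close>

lemma has_integral_iff_absolutely_integrable_vec:
  fixes f :: "'a::euclidean_space \<Rightarrow> real"
  assumes "\<And>x. x \<in> A \<Longrightarrow> 0 \<le> f x"
  shows "(\<lambda>x. vec (f x) :: real^1) absolutely_integrable_on A \<and> integral A (\<lambda>x. vec (f x) :: real^1) = vec r
     \<longleftrightarrow> (f has_integral r) A"
proof
  assume *: "(\<lambda>x. vec (f x) :: real^1) absolutely_integrable_on A \<and> integral A (\<lambda>x. vec (f x) :: real^1) = vec r"
  then have "((\<lambda>x. vec (f x) :: real^1) has_integral vec r) A"
    using set_lebesgue_integral_eq_integral(1) integrable_integral by metis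
  from has_integral_linear[OF this bounded_linear_vec_nth[of 1]] show "(f has_integral r) A"
    by (simp add: o_def)
next
  assume r: "(f has_integral r) A"
  have lin: "bounded_linear (vec :: real \<Rightarrow> real^1)"
    unfolding linear_conv_bounded_linear[symmetric] by (rule linearI) (simp_all add: vec_eq_iff)
  have "f absolutely_integrable_on A"
    using absolutely_integrable_on_iff_nonneg[of A f] assms r by blast
  from absolutely_integrable_linear[OF this lin] has_integral_linear[OF r lin]
  show "(\<lambda>x. vec (f x) :: real^1) absolutely_integrable_on A \<and> integral A (\<lambda>x. vec (f x) :: real^1) = vec r"
    by (auto simp: o_def)
qed

lemma has_integral_iff_nn_integral_on:
  fixes f :: "'a::euclidean_space \<Rightarrow> real"
  assumes nn: "\<And>x. x \<in> A \<Longrightarrow> 0 \<le> f x" and meas: "(\<lambda>x. indicator A x * f x) \<in> borel_measurable borel"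
  shows "(f has_integral r) A \<longleftrightarrow> (\<integral>\<^sup>+x. ennreal (indicator A x * f x) \<partial>lborel) = ennreal r \<and> 0 \<le> r"
proof -
  have "(f has_integral r) A \<longleftrightarrow> ((\<lambda>x. indicator A x * f x) has_integral r) UNIV"
  proof -
    have "(\<lambda>x. indicator A x * f x) = (\<lambda>x. if x \<in> A then f x else 0)"
      by (auto simp: indicator_def fun_eq_iff)
    then show ?thesis by (simp only: has_integral_restrict_UNIV)
  qed
  also have "\<dots> \<longleftrightarrow> (\<lambda>x. indicator A x * f x) \<in> lebesgue \<rightarrow>\<^sub>M borel \<and>
      (\<integral>\<^sup>+x. ennreal (indicator A x * f x) \<partial>lebesgue) = ennreal r \<and> 0 \<le> r"
    by (rule has_integral_iff_nn_integral_lebesgue) (use nn in \<open>auto simp: indicator_def\<close>)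
  finally show ?thesis
    using meas by (simp add: nn_integral_completion measurable_completion)
qed

text \<open>The theorem on absolutely integrable functions says that one side is finite with value \<open>r\<close> iff the
  other one is. So the two sides also agree when they are infinite.\<close>

lemma nn_integral_change_of_variables_ordered:
  fixes f :: "real ^ 'n::{finite,wellorder} \<Rightarrow> real" and \<tau> :: "real ^ 'n::_ \<Rightarrow> real ^ 'n::_"
  assumes A: "A \<in> sets borel"
    and der: "\<And>x. x \<in> A \<Longrightarrow> (\<tau> has_derivative \<tau>' x) (at x)"
    and inj: "inj_on \<tau> A" and nn: "\<And>y. y \<in> \<tau> ` A \<Longrightarrow> 0 \<le> f y"
    and meas: "(\<lambda>x. indicator A x * (\<bar>det (matrix (\<tau>' x))\<bar> * f (\<tau> x))) \<in> borel_measurable borel"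
      "(\<lambda>y. indicator (\<tau> ` A) y * f y) \<in> borel_measurable borel"
  shows "(\<integral>\<^sup>+x. ennreal (indicator A x * (\<bar>det (matrix (\<tau>' x))\<bar> * f (\<tau> x))) \<partial>lborel)
    = (\<integral>\<^sup>+y. ennreal (indicator (\<tau> ` A) y * f y) \<partial>lborel)" (is "?l = ?r")
proof -
  have "A \<in> sets lebesgue" using A by (simp add: sets_completionI_sets)
  from has_absolute_integral_change_of_variables[OF this has_derivative_at_withinI[OF der] inj,
      of "\<lambda>y. vec (f y) :: real^1" "vec _"]
  have "((\<lambda>x. vec (\<bar>det (matrix (\<tau>' x))\<bar> * f (\<tau> x)) :: real^1) absolutely_integrable_on A \<and>
       integral A (\<lambda>x. vec (\<bar>det (matrix (\<tau>' x))\<bar> * f (\<tau> x)) :: real^1) = vec r) \<longleftrightarrow>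
    ((\<lambda>y. vec (f y) :: real^1) absolutely_integrable_on \<tau> ` A \<and> integral (\<tau> ` A) (\<lambda>y. vec (f y) :: real^1) = vec r)" for r
    by (simp add: vec_cmul scalar_mult_eq_scaleR)
  then have "((\<lambda>x. \<bar>det (matrix (\<tau>' x))\<bar> * f (\<tau> x)) has_integral r) A \<longleftrightarrow> (f has_integral r) (\<tau> ` A)" for r
    using has_integral_iff_absolutely_integrable_vec[of A "\<lambda>x. \<bar>det (matrix (\<tau>' x))\<bar> * f (\<tau> x)" r]
      has_integral_iff_absolutely_integrable_vec[of "\<tau> ` A" f r] nn by auto
  then have iff: "(?l = ennreal r \<and> 0 \<le> r) \<longleftrightarrow> (?r = ennreal r \<and> 0 \<le> r)" for r
    using has_integral_iff_nn_integral_on[OF _ meas(1), of r] has_integral_iff_nn_integral_on[OF _ meas(2), of r] nn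
    by auto
  show ?thesis
  proof (cases "?l = \<infinity>")
    case True
    show ?thesis
    proof (cases ?r)
      case (real r) then show ?thesis using iff[of r] by auto
    qed (use True in simp)
  next
    case False
    then obtain r where "?l = ennreal r" "0 \<le> r" by (cases ?l) auto
    then show ?thesis using iff[of r] by auto
  qed
qed

theorem nn_integral_change_of_variables:
  fixes f :: "real ^ 'n::finite \<Rightarrow> real" and \<tau> :: "real ^ 'n \<Rightarrow> real ^ 'n"
  assumes A: "A \<in> sets borel"
    and der: "\<And>x. x \<in> A \<Longrightarrow> (\<tau> has_derivative \<tau>' x) (at x)"
    and inj: "inj_on \<tau> A" and nn: "\<And>y. y \<in> \<tau> ` A \<Longrightarrow> 0 \<le> f y"
    and meas: "(\<lambda>x. indicator A x * (\<bar>det (matrix (\<tau>' x))\<bar> * f (\<tau> x))) \<in> borel_measurable borel"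
      "(\<lambda>y. indicator (\<tau> ` A) y * f y) \<in> borel_measurable borel"
  shows "(\<integral>\<^sup>+x. ennreal (indicator A x * (\<bar>det (matrix (\<tau>' x))\<bar> * f (\<tau> x))) \<partial>lborel)
    = (\<integral>\<^sup>+y. ennreal (indicator (\<tau> ` A) y * f y) \<partial>lborel)"
proof -
  obtain e :: "'n ordered_index \<Rightarrow> 'n" where e: "bij e"
    using finite_same_card_bij[of "UNIV :: 'n ordered_index set" "UNIV :: 'n set"] by (auto simp: card_ordered_index)
  let ?R = "reindex e" and ?Q = "reindex (inv e) :: real ^ 'n ordered_index \<Rightarrow> real ^ 'n"
  have QR: "?Q (?R x) = x" for x
    by (simp add: reindex_reindex reindex_id bij_is_surj[OF e, unfolded surj_iff])
  have RQ: "?R (?Q x) = x" for x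
    using e by (simp add: reindex_reindex reindex_id bij_is_inj)
  let ?B = "?Q -` A" and ?\<sigma> = "\<lambda>x. ?R (\<tau> (?Q x))" and ?\<sigma>' = "\<lambda>x h. ?R (\<tau>' (?Q x) (?Q h))"
  have det: "det (matrix (?\<sigma>' x)) = det (matrix (\<tau>' (?Q x)))" if "?Q x \<in> A" for x
  proof -
    have "?Q (axis j 1) = axis (e j) 1" for j
    proof -
      have "inv e i = j \<longleftrightarrow> i = e j" for i using bij_inv_eq_iff[OF e, of j i] by auto
      then show ?thesis by (simp add: reindex_def axis_def)
    qed
    then have "matrix (?\<sigma>' x) = (\<chi> i j. matrix (\<tau>' (?Q x)) $ e i $ e j)"
      by (simp add: matrix_def reindex_def)
    then show ?thesis using det_reindex[OF e] by simp
  qed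
  have img: "?\<sigma> ` ?B = ?Q -` (\<tau> ` A)"
  proof (intro equalityI subsetI)
    fix y assume "y \<in> ?Q -` (\<tau> ` A)"
    then obtain x where "x \<in> A" "?Q y = \<tau> x" by auto
    then have "y = ?\<sigma> (?R x)" using QR RQ by metis
    moreover have "?R x \<in> ?B" using \<open>x \<in> A\<close> by (simp add: QR)
    ultimately show "y \<in> ?\<sigma> ` ?B" by (rule image_eqI)
  qed (auto simp: QR)
  have ind: "indicator (?Q -` X) x = (indicator X (?Q x) :: real)" for X x by (simp add: indicator_def)
  have int: "(\<integral>\<^sup>+x. ennreal (h (?Q x)) \<partial>lborel) = (\<integral>\<^sup>+y. ennreal (h y) \<partial>lborel)"
    if [measurable]: "h \<in> borel_measurable borel" for h :: "real ^ 'n \<Rightarrow> real"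
  proof -
    have "(\<integral>\<^sup>+y. ennreal (h y) \<partial>lborel) = (\<integral>\<^sup>+y. ennreal (h y) \<partial>distr lborel borel ?Q)"
      using lborel_reindex[OF bij_imp_bij_inv[OF e]] by simp
    then show ?thesis by (subst (asm) nn_integral_distr) auto
  qed
  have "(\<integral>\<^sup>+x. ennreal (indicator ?B x * (\<bar>det (matrix (?\<sigma>' x))\<bar> * f (?Q (?\<sigma> x)))) \<partial>lborel)
    = (\<integral>\<^sup>+y. ennreal (indicator (?\<sigma> ` ?B) y * f (?Q y)) \<partial>lborel)"
  proof (rule nn_integral_change_of_variables_ordered)
    have "?Q -` A \<inter> space borel \<in> sets borel" by (rule measurable_sets[OF _ A]) simp
    then show "?B \<in> sets borel" by simp
    show "(?\<sigma> has_derivative ?\<sigma>' x) (at x)" if "x \<in> ?B" for x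
    proof -
      have "((\<lambda>x. \<tau> (?Q x)) has_derivative (\<lambda>h. \<tau>' (?Q x) (?Q h))) (at x)"
        by (rule has_derivative_compose[where f = ?Q])
           (use that der linear_reindex linear_imp_has_derivative in auto)
      then show ?thesis
        using bounded_linear.has_derivative linear_reindex linear_conv_bounded_linear by blast
    qed
    show "inj_on ?\<sigma> ?B"
    proof (rule inj_onI)
      fix x y assume "x \<in> ?B" "y \<in> ?B" "?\<sigma> x = ?\<sigma> y"
      then have "\<tau> (?Q x) = \<tau> (?Q y)" using QR by metis
      then have "?Q x = ?Q y" using inj_onD[OF inj] \<open>x \<in> ?B\<close> \<open>y \<in> ?B\<close> by auto
      then show "x = y" using RQ by metis
    qed
    show "0 \<le> f (?Q y)" if "y \<in> ?\<sigma> ` ?B" for y using that nn unfolding img by auto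
    have "(\<lambda>x. indicator A (?Q x) * (\<bar>det (matrix (\<tau>' (?Q x)))\<bar> * f (\<tau> (?Q x)))) \<in> borel_measurable borel"
      using measurable_compose[OF reindex_measurable[of "inv e"] meas(1)] by simp
    also have "(\<lambda>x. indicator A (?Q x) * (\<bar>det (matrix (\<tau>' (?Q x)))\<bar> * f (\<tau> (?Q x))))
      = (\<lambda>x. indicator ?B x * (\<bar>det (matrix (?\<sigma>' x))\<bar> * f (?Q (?\<sigma> x))))"
      by (auto simp: fun_eq_iff indicator_def det QR)
    finally show "(\<lambda>x. indicator ?B x * (\<bar>det (matrix (?\<sigma>' x))\<bar> * f (?Q (?\<sigma> x)))) \<in> borel_measurable borel" .
    show "(\<lambda>y. indicator (?\<sigma> ` ?B) y * f (?Q y)) \<in> borel_measurable borel"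
      unfolding img ind using measurable_compose[OF reindex_measurable[of "inv e"] meas(2)] by simp
  qed
  moreover have "(\<integral>\<^sup>+x. ennreal (indicator ?B x * (\<bar>det (matrix (?\<sigma>' x))\<bar> * f (?Q (?\<sigma> x)))) \<partial>lborel)
    = (\<integral>\<^sup>+x. ennreal (indicator A (?Q x) * (\<bar>det (matrix (\<tau>' (?Q x)))\<bar> * f (\<tau> (?Q x)))) \<partial>lborel)"
    by (intro nn_integral_cong) (auto simp: indicator_def det QR)
  ultimately show ?thesis
    unfolding img ind using int[OF meas(1)] int[OF meas(2)] by simp
qed

section \<open>Changing charts\<close>

text \<open>The coordinate change from \<open>c\<close> to \<open>d\<close>; it is only meaningful on \<open>overlap c d\<close>, the part of the range of
  \<open>c\<close> that comes from points in both charts.\<close>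

definition transition :: "('p, 'n) chart \<Rightarrow> ('p, 'n) chart \<Rightarrow> real ^ 'n \<Rightarrow> real ^ 'n" where
  "transition c d = snd d \<circ> chart_inv c"

definition overlap :: "('p, 'n) chart \<Rightarrow> ('p, 'n) chart \<Rightarrow> (real ^ 'n) set" where
  "overlap c d = snd c ` (fst c \<inter> fst d)"

locale immersed_manifold =
  fixes \<A> :: "('p::{t2_space, second_countable_topology}, 'n::finite) chart set"
    and F :: "'p \<Rightarrow> real ^ 'm::finite"
  assumes atlas: "smooth_atlas \<A>" and immersion: "smooth_immersion \<A> F"
begin

lemma is_chart: "c \<in> \<A> \<Longrightarrow> is_chart c"
  using atlas by (simp add: smooth_atlas_def)

lemma
  assumes "c \<in> \<A>"
  shows open_domain: "open (fst c)" and open_chart_range: "open (chart_range c)"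
    and continuous_chart: "continuous_on (fst c) (snd c)"
    and continuous_chart_inv: "continuous_on (chart_range c) (chart_inv c)"
    and chart_inv_chart: "p \<in> fst c \<Longrightarrow> chart_inv c (snd c p) = p"
    and chart_chart_inv: "y \<in> chart_range c \<Longrightarrow> snd c (chart_inv c y) = y"
    and chart_in_range: "p \<in> fst c \<Longrightarrow> snd c p \<in> chart_range c"
    and chart_inv_in_domain: "y \<in> chart_range c \<Longrightarrow> chart_inv c y \<in> fst c"
  using is_chart[OF assms] unfolding is_chart_def homeomorphism_def chart_range_def
  by auto

lemma ex_chart: obtains c where "c \<in> \<A>" "p \<in> fst c"
proof -
  have "p \<in> (\<Union>c\<in>\<A>. fst c)" using atlas by (simp add: smooth_atlas_def)
  then show thesis using that by blast
qed

lemma chart_at: "chart_at \<A> p \<in> \<A>" "p \<in> fst (chart_at \<A> p)"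
proof -
  have "\<exists>c. c \<in> \<A> \<and> p \<in> fst c" using ex_chart by metis
  from someI_ex[OF this] show "chart_at \<A> p \<in> \<A>" "p \<in> fst (chart_at \<A> p)"
    by (auto simp: chart_at_def)
qed

lemma patch: "c \<in> \<A> \<Longrightarrow> immersed_patch F c"
  using immersion open_chart_range
  by unfold_locales (auto simp: smooth_immersion_def smooth_on_def)

lemma open_overlap:
  assumes "c \<in> \<A>" "d \<in> \<A>" shows "open (overlap c d)"
proof -
  have "overlap c d = chart_range c \<inter> chart_inv c -` (fst d)"
    using chart_inv_chart[OF assms(1)] chart_chart_inv[OF assms(1)] chart_inv_in_domain[OF assms(1)]
    by (force simp: overlap_def chart_range_def)
  then show ?thesis
    using continuous_open_preimage[OF continuous_chart_inv open_chart_range open_domain] assms by simp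
qed

lemma overlap_subset: "overlap c d \<subseteq> chart_range c"
  by (auto simp: overlap_def chart_range_def)

lemma transition_in_overlap:
  "c \<in> \<A> \<Longrightarrow> y \<in> overlap c d \<Longrightarrow> transition c d y \<in> overlap d c"
  by (auto simp: overlap_def transition_def chart_inv_chart)

lemma transition_transition:
  "c \<in> \<A> \<Longrightarrow> d \<in> \<A> \<Longrightarrow> y \<in> overlap c d \<Longrightarrow> transition d c (transition c d y) = y"
  by (auto simp: overlap_def transition_def chart_inv_chart)

lemma transition_chart: "c \<in> \<A> \<Longrightarrow> p \<in> fst c \<Longrightarrow> transition c d (snd c p) = snd d p"
  by (simp add: transition_def chart_inv_chart)

lemma smooth_transition:
  assumes "c \<in> \<A>" "d \<in> \<A>"
  shows "Ck_on 2 (transition c d) (overlap c d)"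
  using assms atlas by (simp add: smooth_atlas_def smooth_on_def transition_def overlap_def)

lemma C1_on_transition:
  assumes "c \<in> \<A>" "d \<in> \<A>"
  shows "C1_on (transition c d) (overlap c d)"
    and "C1_on (\<lambda>y. frechet_derivative (transition c d) (at y) v) (overlap c d)"
proof -
  show 2: "C1_on (\<lambda>y. frechet_derivative (transition c d) (at y) v) (overlap c d)" for v
    using smooth_transition[OF assms] by (simp add: numeral_2_eq_2 C1_on_iff)
  show "C1_on (transition c d) (overlap c d)"
    using smooth_transition[OF assms] C1_on_continuous[OF 2]
    by (simp add: numeral_2_eq_2 C1_on_iff)
qed

context
  fixes c d :: "('p, 'n) chart" and y :: "real ^ 'n" and \<tau>' :: "real ^ 'n \<Rightarrow> real ^ 'n"
  assumes cd: "c \<in> \<A>" "d \<in> \<A>" and y: "y \<in> overlap c d"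
  defines "\<tau>' \<equiv> frechet_derivative (transition c d) (at y)"
begin

interpretation c: immersed_patch F c by (rule patch[OF cd(1)])
interpretation d: immersed_patch F d by (rule patch[OF cd(2)])

lemma y_in: "y \<in> chart_range c" "transition c d y \<in> chart_range d"
  using y overlap_subset transition_in_overlap[OF cd(1) y] by blast+

lemma has_derivative_transition: "(transition c d has_derivative \<tau>') (at y)"
  unfolding \<tau>'_def by (rule C1_on_has_derivative[OF C1_on_transition(1)[OF cd] y])

lemma linear_transition_deriv: "linear \<tau>'"
  using has_derivative_transition has_derivative_linear by blast

lemma local_rep_transition: "z \<in> overlap c d \<Longrightarrow> local_rep F d (transition c d z) = local_rep F c z"
  using cd by (auto simp: overlap_def local_rep_def transition_def chart_inv_chart)

lemma local_deriv_transition: "local_deriv F c y v = local_deriv F d (transition c d y) (\<tau>' v)"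
proof -
  have "((\<lambda>z. local_rep F d (transition c d z)) has_derivative
      (\<lambda>v. local_deriv F d (transition c d y) (\<tau>' v))) (at y)"
    by (rule has_derivative_compose[OF has_derivative_transition d.has_derivative_G[OF y_in(2)]])
  then have "(local_rep F c has_derivative (\<lambda>v. local_deriv F d (transition c d y) (\<tau>' v))) (at y)"
    by (rule has_derivative_transform_within_open[OF _ open_overlap[OF cd] y]) (rule local_rep_transition)
  from fun_cong[OF has_derivative_unique[OF c.has_derivative_G[OF y_in(1)] this]] show ?thesis .
qed

lemma bij_transition_deriv: "bij \<tau>'"
proof -
  have inj: "inj \<tau>'"
  proof (rule injI)
    fix u v assume "\<tau>' u = \<tau>' v"
    then have "local_deriv F c y u = local_deriv F c y v" by (simp add: local_deriv_transition)
    then show "u = v" using c.inj_deriv[OF y_in(1)] by (simp add: inj_def)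
  qed
  then show ?thesis
    using linear_injective_imp_surjective[OF linear_transition_deriv] by (simp add: bij_def)
qed

text \<open>The transformation rule \<open>g\<^sub>c = P\<^sup>t g\<^sub>d P\<close> with the Jacobian \<open>P\<close> of the coordinate change, tested on
  pairs of vectors.\<close>

lemma gram_transition:
  "gram F c y = transpose (matrix \<tau>') ** gram F d (transition c d y) ** matrix \<tau>'"
proof -
  have "(gram F c y *v v) \<bullet> u = ((transpose (matrix \<tau>') ** gram F d (transition c d y) ** matrix \<tau>') *v v) \<bullet> u" for u v
  proof -
    have "((transpose (matrix \<tau>') ** gram F d (transition c d y) ** matrix \<tau>') *v v) \<bullet> u
      = (\<tau>' u) \<bullet> (gram F d (transition c d y) *v \<tau>' v)"
      by (simp add: matrix_vector_mul_assoc[symmetric] transpose_matrix_vector dot_lmul_matrix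
          matrix_vector_mul(2)[OF linear_transition_deriv, THEN fun_cong]) (rule inner_commute)
    also have "\<dots> = local_deriv F c y u \<bullet> local_deriv F c y v"
      by (simp add: d.inner_gram[OF y_in(2)] local_deriv_transition)
    finally show ?thesis by (simp add: c.inner_gram[OF y_in(1), symmetric] inner_commute)
  qed
  then have "gram F c y *v v = (transpose (matrix \<tau>') ** gram F d (transition c d y) ** matrix \<tau>') *v v" for v
    using vector_eq_rdot by blast
  then show ?thesis by (simp add: matrix_eq)
qed

lemma vol_density_transition:
  "vol_density F c y = \<bar>det (matrix \<tau>')\<bar> * vol_density F d (transition c d y)"
  unfolding vol_density_def gram_transition
  by (simp add: det_mul det_transpose real_sqrt_mult)

text \<open>Both sides describe the tangential part of the same vector \<open>x\<close>: the difference of their images is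
  both tangential and normal.\<close>

lemma tangent_coords_transition:
  "tangent_coords F d (transition c d y) = \<tau>' (tangent_coords F c y)"
proof -
  let ?w = "tangent_coords F d (transition c d y) - \<tau>' (tangent_coords F c y)"
  let ?D = "local_deriv F d (transition c d y)"
  have lin: "linear ?D" by (rule d.linear_D[OF y_in(2)])
  have G: "local_rep F d (transition c d y) = local_rep F c y" using local_rep_transition y by simp
  have "?D ?w \<bullet> ?D v = 0" for v
  proof -
    obtain u where u: "v = \<tau>' u" using bij_transition_deriv bij_pointE by metis
    have "?D ?w = normal_position F c y - normal_position F d (transition c d y)"
      using lin by (simp add: linear_diff normal_position_def G local_deriv_transition)
    then show ?thesis
      using c.normal_position_orthogonal[OF y_in(1), of u] d.normal_position_orthogonal[OF y_in(2), of v] u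
      by (simp add: inner_diff_left local_deriv_transition)
  qed
  from this[of ?w] have "?D ?w = 0" by simp
  then have "?w = 0" by (rule d.D_eq_0[OF y_in(2)])
  then show ?thesis by simp
qed

lemma normal_position_transition:
  "normal_position F d (transition c d y) = normal_position F c y"
  using local_rep_transition y
  by (simp add: normal_position_def tangent_coords_transition local_deriv_transition)

text \<open>The chain rule for second derivatives. The derivative of the Jacobian contributes only a tangential
  vector, so the normal part of the second derivative is a tensor.\<close>

lemma hess_transition:
  obtains w where "hess F c y u v = hess F d (transition c d y) (\<tau>' u) (\<tau>' v)
    + local_deriv F d (transition c d y) w"
proof -
  define \<sigma> where "\<sigma> z = frechet_derivative (transition c d) (at z) v" for z
  obtain \<sigma>' where \<sigma>': "(\<sigma> has_derivative \<sigma>') (at y)"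
    unfolding \<sigma>_def using C1_on_has_derivative[OF C1_on_transition(2)[OF cd] y] by blast
  let ?D = "\<lambda>z. local_deriv F d (transition c d z)"
  have "((\<lambda>z. \<Sum>i\<in>UNIV. \<sigma> z $ i *\<^sub>R ?D z (axis i 1)) has_derivative
     (\<lambda>u. \<Sum>i\<in>UNIV. \<sigma> y $ i *\<^sub>R hess F d (transition c d y) (\<tau>' u) (axis i 1) + \<sigma>' u $ i *\<^sub>R ?D y (axis i 1))) (at y)"
    by (intro has_derivative_sum has_derivative_scaleR
        has_derivative_compose[OF has_derivative_transition d.has_derivative_D[OF y_in(2)]]
        bounded_linear.has_derivative[OF bounded_linear_vec_nth] \<sigma>')
  also have "(\<lambda>u. \<Sum>i\<in>UNIV. \<sigma> y $ i *\<^sub>R hess F d (transition c d y) (\<tau>' u) (axis i 1) + \<sigma>' u $ i *\<^sub>R ?D y (axis i 1))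
    = (\<lambda>u. hess F d (transition c d y) (\<tau>' u) (\<sigma> y) + ?D y (\<sigma>' u))"
    unfolding linear_expand_axis[OF d.linear_hess_right[OF y_in(2)], of _ "\<sigma> y"]
      linear_expand_axis[OF d.linear_D[OF y_in(2)], of "\<sigma>' _"] by (simp add: sum.distrib)
  finally have "((\<lambda>z. local_deriv F c z v) has_derivative
      (\<lambda>u. hess F d (transition c d y) (\<tau>' u) (\<sigma> y) + ?D y (\<sigma>' u))) (at y)"
  proof (rule has_derivative_transform_within_open[OF _ open_overlap[OF cd] y])
    fix z assume z: "z \<in> overlap c d"
    then have "transition c d z \<in> chart_range d" using overlap_subset transition_in_overlap[OF cd(1) z] by blast
    then show "(\<Sum>i\<in>UNIV. \<sigma> z $ i *\<^sub>R ?D z (axis i 1)) = local_deriv F c z v"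
      using z linear_expand_axis[OF d.linear_D, of "transition c d z" "\<sigma> z"]
        immersed_manifold.local_deriv_transition[OF immersed_manifold_axioms cd z, of v] by (simp add: \<sigma>_def)
  qed
  from fun_cong[OF has_derivative_unique[OF c.has_derivative_D[OF y_in(1)] this], of u]
  show ?thesis using that[of "\<sigma>' u"] by (simp add: \<sigma>_def \<tau>'_def)
qed

text \<open>Taking the inner product with the normal vector \<open>x\<^sup>\<bottom>\<close> kills the tangential correction in
  \<open>hess_transition\<close>. The remaining bilinear form is traced with \<open>g\<^sub>d\<^sup>-\<^sup>1 = P g\<^sub>c\<^sup>-\<^sup>1 P\<^sup>t\<close>, which compensates the two
  Jacobians.\<close>

lemma trace_hess_transition:
  "normal_position F c y \<bullet> trace_hess F c y
    = normal_position F c y \<bullet> trace_hess F d (transition c d y)"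
proof -
  let ?N = "normal_position F c y" and ?T = "matrix \<tau>'" and ?z = "transition c d y"
  let ?W = "matrix_inv (gram F c y)" and ?V = "matrix_inv (gram F d ?z)"
  let ?B = "\<lambda>u v. ?N \<bullet> hess F d ?z u v"
  have T: "det ?T \<noteq> 0"
    using vol_density_transition c.vol_density_pos[OF y_in(1)] by auto
  have "?T ** ?W ** transpose ?T ** gram F d ?z = mat 1"
  proof -
    have "?T ** ?W ** transpose ?T ** gram F d ?z = ?T ** (?W ** (transpose ?T ** gram F d ?z ** ?T)) ** matrix_inv ?T"
      by (simp add: matrix_mul_assoc[symmetric] matrix_inv_mult[OF T])
    also have "\<dots> = mat 1"
      by (simp add: gram_transition[symmetric] c.gram_inverse[OF y_in(1)] matrix_inv_mult[OF T])
    finally show ?thesis .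
  qed
  from matrix_inv_eqI[OF this] have V: "?V = ?T ** ?W ** transpose ?T" .
  have B: "?N \<bullet> hess F c y (axis i 1) (axis j 1) = (\<Sum>k\<in>UNIV. \<Sum>l\<in>UNIV. ?T $ k $ i * ?T $ l $ j * ?B (axis k 1) (axis l 1))" for i j
  proof -
    obtain w where w: "hess F c y (axis i 1) (axis j 1) = hess F d ?z (\<tau>' (axis i 1)) (\<tau>' (axis j 1)) + local_deriv F d ?z w"
      by (rule hess_transition)
    have "?N \<bullet> local_deriv F d ?z w = 0"
      using d.normal_position_orthogonal[OF y_in(2)] by (simp add: normal_position_transition)
    moreover have "hess F d ?z (\<tau>' (axis i 1)) (\<tau>' (axis j 1))
       = (\<Sum>k\<in>UNIV. \<Sum>l\<in>UNIV. (?T $ k $ i * ?T $ l $ j) *\<^sub>R hess F d ?z (axis k 1) (axis l 1))"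
      unfolding linear_expand_axis[OF d.linear_hess_left[OF y_in(2)], of "\<tau>' (axis i 1)"]
        linear_expand_axis[OF d.linear_hess_right[OF y_in(2)], of _ "\<tau>' (axis j 1)"]
      by (subst sum.swap) (simp add: matrix_def scaleR_sum_right mult.commute)
    ultimately show ?thesis by (simp add: w inner_add_right inner_sum_right)
  qed
  have "?N \<bullet> trace_hess F d ?z = (\<Sum>k\<in>UNIV. \<Sum>l\<in>UNIV. (\<Sum>j\<in>UNIV. (\<Sum>i\<in>UNIV. ?T $ k $ i * ?W $ i $ j) * ?T $ l $ j) * ?B (axis k 1) (axis l 1))"
    by (simp add: trace_hess_def V inner_sum_right matrix_matrix_mult_def transpose_def)
  also have "\<dots> = (\<Sum>k\<in>UNIV. \<Sum>l\<in>UNIV. \<Sum>j\<in>UNIV. \<Sum>i\<in>UNIV. ?W $ i $ j * (?T $ k $ i * ?T $ l $ j * ?B (axis k 1) (axis l 1)))"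
    by (simp add: sum_distrib_right sum_distrib_left mult_ac)
  also have "\<dots> = (\<Sum>k\<in>UNIV. \<Sum>j\<in>UNIV. \<Sum>i\<in>UNIV. \<Sum>l\<in>UNIV. ?W $ i $ j * (?T $ k $ i * ?T $ l $ j * ?B (axis k 1) (axis l 1)))"
    by (rule sum.cong[OF refl], rule trans[OF sum.swap], rule sum.cong[OF refl], rule sum.swap)
  also have "\<dots> = (\<Sum>j\<in>UNIV. \<Sum>i\<in>UNIV. \<Sum>k\<in>UNIV. \<Sum>l\<in>UNIV. ?W $ i $ j * (?T $ k $ i * ?T $ l $ j * ?B (axis k 1) (axis l 1)))"
    by (rule trans[OF sum.swap], rule sum.cong[OF refl], rule sum.swap)
  also have "\<dots> = (\<Sum>i\<in>UNIV. \<Sum>j\<in>UNIV. ?W $ i $ j * (?N \<bullet> hess F c y (axis i 1) (axis j 1)))"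
    by (subst sum.swap) (simp add: B sum_distrib_left)
  also have "\<dots> = ?N \<bullet> trace_hess F c y"
    by (simp add: trace_hess_def inner_sum_right)
  finally show ?thesis by simp
qed

end

definition normal_field :: "'p \<Rightarrow> real ^ 'm" where
  "normal_field p = normal_part \<A> F p (F p)"

lemma normal_part_eqI:
  assumes "w \<in> (tangent_space \<A> F p)\<^sup>\<bottom>" "v - w \<in> tangent_space \<A> F p"
  shows "normal_part \<A> F p v = w"
  unfolding normal_part_def
proof (rule the_equality)
  interpret c: immersed_patch F "chart_at \<A> p" by (rule patch[OF chart_at(1)])
  have sub: "subspace (tangent_space \<A> F p)"
    using c.linear_D[OF chart_in_range[OF chart_at]] by (auto simp: tangent_space_def Let_def intro: linear_subspace_image)
  show "w \<in> (tangent_space \<A> F p)\<^sup>\<bottom> \<and> v - w \<in> tangent_space \<A> F p" using assms by simp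
  fix w' assume w': "w' \<in> (tangent_space \<A> F p)\<^sup>\<bottom> \<and> v - w' \<in> tangent_space \<A> F p"
  have "(v - w) - (v - w') \<in> tangent_space \<A> F p" using subspace_diff[OF sub] assms w' by blast
  then have t: "w' - w \<in> tangent_space \<A> F p" by simp
  have "w' - w \<in> (tangent_space \<A> F p)\<^sup>\<bottom>"
    using subspace_diff[OF subspace_orthogonal_comp] assms w' by blast
  with t have "(w' - w) \<bullet> (w' - w) = 0" by (auto simp: orthogonal_comp_def orthogonal_def)
  then show "w' = w" by simp
qed

lemma normal_part_decomposition:
  "normal_part \<A> F p v \<in> (tangent_space \<A> F p)\<^sup>\<bottom>" "v - normal_part \<A> F p v \<in> tangent_space \<A> F p"
proof -
  interpret c: immersed_patch F "chart_at \<A> p" by (rule patch[OF chart_at(1)])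
  have sub: "subspace (tangent_space \<A> F p)"
    using c.linear_D[OF chart_in_range[OF chart_at]] by (auto simp: tangent_space_def Let_def intro: linear_subspace_image)
  obtain t w where tw: "t \<in> tangent_space \<A> F p" "w \<in> (tangent_space \<A> F p)\<^sup>\<bottom>" "v = t + w"
    using subspace_sum_orthogonal_comp[OF sub] set_plus_elim by (metis UNIV_I)
  then have "normal_part \<A> F p v = w" by (intro normal_part_eqI) auto
  with tw show "normal_part \<A> F p v \<in> (tangent_space \<A> F p)\<^sup>\<bottom>" "v - normal_part \<A> F p v \<in> tangent_space \<A> F p"
    by auto
qed

lemma normal_field_eq:
  assumes "c \<in> \<A>" "p \<in> fst c"
  shows "normal_field p = normal_position F c (snd c p)"
proof -
  let ?c = "chart_at \<A> p"
  interpret c: immersed_patch F "?c" by (rule patch[OF chart_at(1)])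
  have y: "snd ?c p \<in> chart_range ?c" by (rule chart_in_range[OF chart_at])
  have *: "normal_field p = normal_position F ?c (snd ?c p)"
    unfolding normal_field_def
  proof (rule normal_part_eqI)
    show "normal_position F ?c (snd ?c p) \<in> (tangent_space \<A> F p)\<^sup>\<bottom>"
      using c.normal_position_orthogonal[OF y]
      by (auto simp: tangent_space_def Let_def orthogonal_comp_def orthogonal_def inner_commute)
    have "F p = local_rep F ?c (snd ?c p)" by (simp add: local_rep_def chart_inv_chart[OF chart_at])
    then show "F p - normal_position F ?c (snd ?c p) \<in> tangent_space \<A> F p"
      by (auto simp: tangent_space_def Let_def normal_position_def)
  qed
  have "snd ?c p \<in> overlap ?c c" using chart_at(2) assms by (auto simp: overlap_def)
  from normal_position_transition[OF chart_at(1) assms(1) this, unfolded transition_chart[OF chart_at]]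
  have "normal_position F c (snd c p) = normal_position F ?c (snd ?c p)" .
  with * show ?thesis by simp
qed

text \<open>The mean curvature is computed in the chart that \<open>chart_at\<close> happens to select. This makes its only
  component that matters, the one along \<open>x\<^sup>\<bottom>\<close>, available in all charts.\<close>

lemma normal_field_inner_mean_curvature:
  assumes "c \<in> \<A>" "p \<in> fst c"
  shows "normal_field p \<bullet> mean_curvature \<A> F p = normal_field p \<bullet> trace_hess F c (snd c p)"
proof -
  let ?c = "chart_at \<A> p"
  let ?y = "snd ?c p"
  interpret c: immersed_patch F "?c" by (rule patch[OF chart_at(1)])
  have y: "?y \<in> chart_range ?c" by (rule chart_in_range[OF chart_at])
  have amb: "ambient_connection \<A> p u (coord_field F ?c v) = hess F ?c ?y u v" for u v
  proof -
    have "(coord_field F ?c v \<circ> chart_inv ?c has_derivative (\<lambda>u. hess F ?c ?y u v)) (at ?y)"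
      by (rule has_derivative_transform_within_open[OF c.has_derivative_D[OF y] c.open_range y])
         (simp add: coord_field_def chart_chart_inv[OF chart_at(1)])
    from fun_cong[OF frechet_derivative_at[OF this, symmetric], of u] show ?thesis
      by (simp add: ambient_connection_def Let_def)
  qed
  have "normal_field p \<bullet> normal_part \<A> F p v = normal_field p \<bullet> v" for v
  proof -
    have "normal_field p \<bullet> (v - normal_part \<A> F p v) = 0"
      using normal_part_decomposition(1)[of p "F p"] normal_part_decomposition(2)[of v p]
      by (auto simp: normal_field_def orthogonal_comp_def orthogonal_def inner_commute)
    then show ?thesis by (simp add: inner_diff_right)
  qed
  then have "normal_field p \<bullet> mean_curvature \<A> F p = normal_field p \<bullet> trace_hess F ?c ?y"
    by (simp add: mean_curvature_def Let_def trace_hess_def inner_sum_right second_fundamental_form_def amb)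
  note * = this
  have "?y \<in> overlap ?c c" using chart_at(2) assms by (auto simp: overlap_def)
  from trace_hess_transition[OF chart_at(1) assms(1) this, unfolded transition_chart[OF chart_at]] *
  show ?thesis by (simp add: normal_field_eq[OF chart_at])
qed

end

section \<open>The volume measure in charts\<close>

lemma emeasure_le_Sup_measure:
  fixes M :: "'i \<Rightarrow> 'a measure"
  assumes "i \<in> I" "sets (M i) = sets (SUP i\<in>I. M i)"
  shows "emeasure (M i) A \<le> emeasure (SUP i\<in>I. M i) A"
  using SUP_upper[OF assms(1), of M] assms(2) sets_eq_imp_space_eq[OF assms(2)]
  by (auto simp: le_measure_iff le_fun_def)

context immersed_manifold begin

abbreviation "\<sigma> \<equiv> volume_measure \<A> F"

lemma sets_chart_volume [simp, measurable_cong]: "sets (chart_volume F c) = sets borel"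
  by (simp add: chart_volume_def)

lemma borel_domain: "c \<in> \<A> \<Longrightarrow> fst c \<in> sets borel"
  by (simp add: open_domain)

lemma borel_range: "c \<in> \<A> \<Longrightarrow> chart_range c \<in> sets borel"
  by (simp add: open_chart_range)

lemma measurable_chart_inv:
  "c \<in> \<A> \<Longrightarrow> chart_inv c \<in> borel_measurable (restrict_space lborel (chart_range c))"
  using borel_measurable_continuous_on_restrict[OF continuous_chart_inv]
  by (simp cong: measurable_cong_sets add: sets_restrict_space_cong[of lborel borel])

lemma continuous_vol_density: "c \<in> \<A> \<Longrightarrow> continuous_on (chart_range c) (vol_density F c)"
  by (rule C1_on_continuous[OF immersed_patch.C1_on_vol_density[OF patch]])

lemma measurable_vol_density:
  "c \<in> \<A> \<Longrightarrow> vol_density F c \<in> borel_measurable (restrict_space lborel (chart_range c))"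
  using borel_measurable_continuous_on_restrict[OF continuous_vol_density]
  by (simp cong: measurable_cong_sets add: sets_restrict_space_cong[of lborel borel])

lemma borel_preimage:
  assumes "c \<in> \<A>" "A \<in> sets borel"
  shows "chart_range c \<inter> chart_inv c -` A \<in> sets borel"
proof -
  have "chart_inv c -` A \<inter> space (restrict_space lborel (chart_range c)) \<in> sets (restrict_space lborel (chart_range c))"
    by (rule measurable_sets[OF measurable_chart_inv[OF assms(1)] assms(2)])
  then have "chart_inv c -` A \<inter> chart_range c \<in> sets (restrict_space lborel (chart_range c))"
    by (simp add: space_restrict_space)
  then show ?thesis using borel_range[OF assms(1)]
    by (subst (asm) sets_restrict_space_iff) (auto simp: Int_commute)
qed

lemma chart_volume_altdef:
  "chart_volume F c = distr (density (restrict_space lborel (chart_range c)) (\<lambda>y. ennreal (vol_density F c y)))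
     borel (chart_inv c)"
  by (simp add: chart_volume_def vol_density_def)

lemma emeasure_chart_volume:
  assumes c: "c \<in> \<A>" and A: "A \<in> sets borel"
  shows "emeasure (chart_volume F c) A =
    (\<integral>\<^sup>+y. ennreal (indicator (chart_range c \<inter> chart_inv c -` A) y * vol_density F c y) \<partial>lborel)"
proof -
  let ?R = "restrict_space lborel (chart_range c)"
  note [measurable] = measurable_chart_inv[OF c] measurable_vol_density[OF c]
  have S: "chart_range c \<inter> space lborel \<in> sets lborel" using borel_range[OF c] by simp
  have m: "chart_inv c -` A \<inter> space ?R \<in> sets ?R"
    by (rule measurable_sets[OF measurable_chart_inv[OF c] A])
  have "emeasure (chart_volume F c) A = emeasure (density ?R (\<lambda>y. ennreal (vol_density F c y))) (chart_inv c -` A \<inter> space ?R)"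
    unfolding chart_volume_altdef by (subst emeasure_distr) (use A in auto)
  also have "\<dots> = (\<integral>\<^sup>+y. ennreal (vol_density F c y) * indicator (chart_inv c -` A \<inter> space ?R) y \<partial>?R)"
    by (rule emeasure_density) (use m in auto)
  also have "\<dots> = (\<integral>\<^sup>+y. ennreal (vol_density F c y) * indicator (chart_inv c -` A \<inter> space ?R) y * indicator (chart_range c) y \<partial>lborel)"
    by (rule nn_integral_restrict_space[OF S])
  also have "\<dots> = (\<integral>\<^sup>+y. ennreal (indicator (chart_range c \<inter> chart_inv c -` A) y * vol_density F c y) \<partial>lborel)"
    by (intro nn_integral_cong) (auto simp: indicator_def space_restrict_space)
  finally show ?thesis .
qed

lemma measurable_indicator_vol_density:
  assumes "c \<in> \<A>" "B \<in> sets borel" "B \<subseteq> chart_range c"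
  shows "(\<lambda>y. indicator B y * vol_density F c y) \<in> borel_measurable borel"
proof -
  have [measurable]: "(\<lambda>y. indicator (chart_range c) y *\<^sub>R vol_density F c y) \<in> borel_measurable borel"
    by (intro borel_measurable_continuous_on_indicator borel_range continuous_vol_density assms)
  note [measurable] = assms(2)
  have "(\<lambda>y. indicator B y * (indicator (chart_range c) y *\<^sub>R vol_density F c y)) \<in> borel_measurable borel"
    by measurable
  also have "(\<lambda>y. indicator B y * (indicator (chart_range c) y *\<^sub>R vol_density F c y)) = (\<lambda>y. indicator B y * vol_density F c y)"
    using assms(3) by (auto simp: indicator_def fun_eq_iff)
  finally show ?thesis .
qed

text \<open>The coordinate change maps the part of one chart range over \<open>A\<close> onto the part of the other one, and
  the Jacobian factor is absorbed by \<open>vol_density_transition\<close>.\<close>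

lemma chart_volume_eq:
  assumes c: "c \<in> \<A>" and d: "d \<in> \<A>" and A: "A \<in> sets borel" "A \<subseteq> fst c" "A \<subseteq> fst d"
  shows "emeasure (chart_volume F c) A = emeasure (chart_volume F d) A"
proof -
  let ?B = "chart_range c \<inter> chart_inv c -` A"
  let ?C = "chart_range d \<inter> chart_inv d -` A"
  let ?\<tau> = "transition c d"
  let ?\<tau>' = "\<lambda>y. frechet_derivative ?\<tau> (at y)"
  have B: "?B \<subseteq> overlap c d"
  proof
    fix y assume "y \<in> ?B"
    then have "y = snd c (chart_inv c y)" "chart_inv c y \<in> fst c \<inter> fst d"
      using A chart_chart_inv[OF c] by auto
    then show "y \<in> overlap c d" unfolding overlap_def by blast
  qed
  have img: "?\<tau> ` ?B = ?C"
  proof (intro equalityI subsetI)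
    fix z assume "z \<in> ?\<tau> ` ?B"
    then obtain y where y: "y \<in> ?B" "z = ?\<tau> y" by auto
    then have *: "chart_inv c y \<in> A" "chart_inv c y \<in> fst d" using A by auto
    then have "chart_inv d z = chart_inv c y" by (simp add: y(2) transition_def chart_inv_chart[OF d])
    then show "z \<in> ?C" using * chart_in_range[OF d *(2)] y(2) by (simp add: transition_def)
  next
    fix z assume z: "z \<in> ?C"
    then have *: "chart_inv d z \<in> A" "chart_inv d z \<in> fst c" using A by auto
    have "z = ?\<tau> (snd c (chart_inv d z))"
      using z by (simp add: transition_chart[OF c *(2)] chart_chart_inv[OF d])
    moreover have "snd c (chart_inv d z) \<in> ?B"
      using * by (simp add: chart_inv_chart[OF c] chart_in_range[OF c])
    ultimately show "z \<in> ?\<tau> ` ?B" by (rule image_eqI)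
  qed
  have eq: "indicator ?B y * (\<bar>det (matrix (?\<tau>' y))\<bar> * vol_density F d (?\<tau> y)) = indicator ?B y * vol_density F c y" for y
  proof (cases "y \<in> ?B")
    case True
    then have "y \<in> overlap c d" using B by blast
    from vol_density_transition[OF c d this] show ?thesis by simp
  qed (simp add: indicator_def)
  have "emeasure (chart_volume F c) A = (\<integral>\<^sup>+y. ennreal (indicator ?B y * vol_density F c y) \<partial>lborel)"
    by (rule emeasure_chart_volume[OF c A(1)])
  also have "\<dots> = (\<integral>\<^sup>+y. ennreal (indicator ?B y * (\<bar>det (matrix (?\<tau>' y))\<bar> * vol_density F d (?\<tau> y))) \<partial>lborel)"
    by (simp only: eq)
  also have "\<dots> = (\<integral>\<^sup>+z. ennreal (indicator (?\<tau> ` ?B) z * vol_density F d z) \<partial>lborel)"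
  proof (rule nn_integral_change_of_variables)
    show "?B \<in> sets borel" by (rule borel_preimage[OF c A(1)])
    show "(?\<tau> has_derivative ?\<tau>' y) (at y)" if "y \<in> ?B" for y
      using has_derivative_transition[OF c d] B that by blast
    show "inj_on ?\<tau> ?B"
      by (rule inj_on_inverseI[of _ "transition d c"]) (use B transition_transition[OF c d] in blast)
    show "0 \<le> vol_density F d z" if "z \<in> ?\<tau> ` ?B" for z
      using immersed_patch.vol_density_pos[OF patch[OF d], of z] that unfolding img by simp
    show "(\<lambda>y. indicator ?B y * (\<bar>det (matrix (?\<tau>' y))\<bar> * vol_density F d (?\<tau> y))) \<in> borel_measurable borel"
      unfolding eq by (intro measurable_indicator_vol_density c borel_preimage A) auto
    show "(\<lambda>z. indicator (?\<tau> ` ?B) z * vol_density F d z) \<in> borel_measurable borel"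
      unfolding img by (intro measurable_indicator_vol_density d borel_preimage A) auto
  qed
  also have "\<dots> = emeasure (chart_volume F d) A"
    unfolding img by (rule emeasure_chart_volume[OF d A(1), symmetric])
  finally show ?thesis .
qed

lemma emeasure_chart_volume_Int:
  assumes c: "c \<in> \<A>" and A: "A \<in> sets borel"
  shows "emeasure (chart_volume F c) A = emeasure (chart_volume F c) (A \<inter> fst c)"
proof -
  have "chart_range c \<inter> chart_inv c -` A = chart_range c \<inter> chart_inv c -` (A \<inter> fst c)"
    using chart_inv_in_domain[OF c] by auto
  moreover have "A \<inter> fst c \<in> sets borel" using A borel_domain[OF c] by blast
  ultimately show ?thesis using c A by (simp add: emeasure_chart_volume)
qed

lemma atlas_nonempty: "\<A> \<noteq> {}"
  using chart_at by auto

lemma sets_volume_measure [simp, measurable_cong]: "sets \<sigma> = sets borel"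
  unfolding volume_measure_def by (rule sets_SUP[OF _ atlas_nonempty]) simp

lemma space_volume_measure [simp]: "space \<sigma> = UNIV"
  using sets_eq_imp_space_eq[OF sets_volume_measure] by simp

text \<open>The supremum is bounded below by each of its members. For the upper bound it suffices to exhibit one
  measure above all chart volumes that agrees with the volume of \<open>c\<close> inside the domain of \<open>c\<close>. The
  measure \<open>\<nu>\<close> that gives infinite mass to every set not contained in this domain does it.\<close>

lemma volume_measure_eq_chart_volume:
  assumes c: "c \<in> \<A>" and A: "A \<in> sets borel" "A \<subseteq> fst c"
  shows "emeasure \<sigma> A = emeasure (chart_volume F c) A"
proof (rule antisym)
  show "emeasure (chart_volume F c) A \<le> emeasure \<sigma> A"
    unfolding volume_measure_def
    by (rule emeasure_le_Sup_measure[OF c]) (simp add: sets_volume_measure[unfolded volume_measure_def])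
  define f where "f B = (if B \<subseteq> fst c then emeasure (chart_volume F c) B else \<infinity>)" for B
  define \<nu> where "\<nu> = measure_of UNIV (sets borel) f"
  have ca: "countably_additive (sets borel) f"
  proof (rule countably_additiveI)
    fix B :: "nat \<Rightarrow> 'p set" assume B: "range B \<subseteq> sets borel" "disjoint_family B" "\<Union> (range B) \<in> sets borel"
    show "(\<Sum>i. f (B i)) = f (\<Union> (range B))"
    proof (cases "\<Union> (range B) \<subseteq> fst c")
      case True
      then have "f (B i) = emeasure (chart_volume F c) (B i)" for i by (auto simp: f_def)
      then show ?thesis using True B suminf_emeasure[of B "chart_volume F c"] by (simp add: f_def)
    next
      case False
      then obtain i where "\<not> B i \<subseteq> fst c" by blast
      then have "f (B i) = \<infinity>" by (simp add: f_def)
      moreover have "f (B i) \<le> (\<Sum>i. f (B i))"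
        using sum_le_suminf[of "\<lambda>i. f (B i)" "{i}"] by simp
      ultimately show ?thesis using False by (simp add: f_def top_unique)
    qed
  qed
  have sets: "sets \<nu> = sets borel" unfolding \<nu>_def using sets.sigma_sets_eq[of "borel :: 'p measure"] by (simp add: sets_measure_of_conv)
  have em: "emeasure \<nu> B = f B" if "B \<in> sets borel" for B
    unfolding \<nu>_def
    by (rule emeasure_measure_of_sigma[OF _ _ ca that])
       (use sets.sigma_algebra_axioms[of "borel :: 'p measure"] in \<open>auto simp: positive_def f_def\<close>)
  have "chart_volume F d \<le> \<nu>" if d: "d \<in> \<A>" for d
  proof -
    have "emeasure (chart_volume F d) B \<le> f B" if B: "B \<in> sets borel" for B
    proof (cases "B \<subseteq> fst c")
      case True
      have "emeasure (chart_volume F d) B = emeasure (chart_volume F d) (B \<inter> fst d)"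
        by (rule emeasure_chart_volume_Int[OF d B])
      also have "\<dots> = emeasure (chart_volume F c) (B \<inter> fst d)"
        by (rule chart_volume_eq[OF d c]) (use True B borel_domain[OF d] in auto)
      also have "\<dots> \<le> emeasure (chart_volume F c) B"
        using B by (intro emeasure_mono) auto
      finally show ?thesis using True by (simp add: f_def)
    qed (simp add: f_def)
    then show ?thesis by (subst le_measure) (simp_all add: sets em)
  qed
  then have "\<sigma> \<le> \<nu>" unfolding volume_measure_def by (rule SUP_least)
  then have "emeasure \<sigma> A \<le> emeasure \<nu> A"
    using A by (subst (asm) le_measure) (simp_all add: sets)
  then show "emeasure \<sigma> A \<le> emeasure (chart_volume F c) A"
    using A by (simp add: em f_def)
qed

lemma density_volume_measure:
  assumes c: "c \<in> \<A>"
  shows "density \<sigma> (indicator (fst c)) = chart_volume F c"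
proof (rule measure_eqI)
  fix A assume "A \<in> sets (density \<sigma> (indicator (fst c)))"
  then have A: "A \<in> sets borel" by simp
  have "emeasure (density \<sigma> (indicator (fst c))) A = emeasure \<sigma> (fst c \<inter> A)"
    by (rule emeasure_restricted) (use A borel_domain[OF c] in auto)
  also have "\<dots> = emeasure (chart_volume F c) (A \<inter> fst c)"
    using volume_measure_eq_chart_volume[OF c, of "fst c \<inter> A"] A borel_domain[OF c] by (auto simp: Int_commute)
  also have "\<dots> = emeasure (chart_volume F c) A" by (rule emeasure_chart_volume_Int[OF c A, symmetric])
  finally show "emeasure (density \<sigma> (indicator (fst c))) A = emeasure (chart_volume F c) A" .
qed simp

lemma
  fixes h :: "'p \<Rightarrow> real"
  assumes c: "c \<in> \<A>" and h[measurable]: "h \<in> borel_measurable borel" and z: "\<And>p. p \<notin> fst c \<Longrightarrow> h p = 0"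
  defines "H \<equiv> \<lambda>y. indicator (chart_range c) y * (vol_density F c y * h (chart_inv c y))"
  shows integrable_volume_chart: "integrable \<sigma> h \<longleftrightarrow> integrable lborel H"
    and integral_volume_chart: "integral\<^sup>L \<sigma> h = integral\<^sup>L lborel H"
proof -
  let ?R = "restrict_space lborel (chart_range c)"
  note [measurable] = measurable_chart_inv[OF c] measurable_vol_density[OF c] borel_domain[OF c]
  have S: "chart_range c \<inter> space lborel \<in> sets lborel" using borel_range[OF c] by simp
  have nn: "AE y in ?R. 0 \<le> vol_density F c y"
    using immersed_patch.vol_density_pos[OF patch[OF c]] by (intro AE_I2) (auto simp: space_restrict_space less_imp_le)
  have ind: "(\<lambda>p. indicator (fst c) p * h p) = h" using z by (auto simp: indicator_def fun_eq_iff)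
  have dens: "density \<sigma> (\<lambda>p. ennreal (indicator (fst c) p)) = chart_volume F c"
    using density_volume_measure[OF c] by (simp add: ennreal_indicator)
  have hm: "(\<lambda>y. h (chart_inv c y)) \<in> borel_measurable ?R" by measurable
  have "integrable \<sigma> h \<longleftrightarrow> integrable (chart_volume F c) h"
    unfolding dens[symmetric] by (subst integrable_density) (auto simp: ind)
  also have "\<dots> \<longleftrightarrow> integrable (density ?R (\<lambda>y. ennreal (vol_density F c y))) (\<lambda>y. h (chart_inv c y))"
    unfolding chart_volume_altdef by (rule integrable_distr_eq) auto
  also have "\<dots> \<longleftrightarrow> integrable ?R (\<lambda>y. vol_density F c y *\<^sub>R h (chart_inv c y))"
    by (rule integrable_density) (use nn hm in auto)
  also have "\<dots> \<longleftrightarrow> integrable lborel H"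
    unfolding H_def by (subst integrable_restrict_space[OF S]) simp
  finally show "integrable \<sigma> h \<longleftrightarrow> integrable lborel H" .
  have "integral\<^sup>L \<sigma> h = integral\<^sup>L (chart_volume F c) h"
    unfolding dens[symmetric] by (subst integral_density) (auto simp: ind)
  also have "\<dots> = integral\<^sup>L (density ?R (\<lambda>y. ennreal (vol_density F c y))) (\<lambda>y. h (chart_inv c y))"
    unfolding chart_volume_altdef by (rule integral_distr) auto
  also have "\<dots> = integral\<^sup>L ?R (\<lambda>y. vol_density F c y *\<^sub>R h (chart_inv c y))"
    by (rule integral_density) (use nn hm in auto)
  also have "\<dots> = integral\<^sup>L lborel H"
    unfolding H_def by (subst integral_restrict_space[OF S]) simp
  finally show "integral\<^sup>L \<sigma> h = integral\<^sup>L lborel H" .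
qed

lemma volume_measure_nonzero: "emeasure \<sigma> UNIV \<noteq> 0"
proof
  assume 0: "emeasure \<sigma> UNIV = 0"
  fix p :: 'p
  let ?c = "chart_at \<A> p"
  have "emeasure \<sigma> (fst ?c) \<le> emeasure \<sigma> UNIV" by (rule emeasure_mono) auto
  with 0 have "emeasure \<sigma> (fst ?c) = 0" by simp
  then have "emeasure (chart_volume F ?c) (fst ?c) = 0"
    using volume_measure_eq_chart_volume[OF chart_at(1) borel_domain[OF chart_at(1)], of p p] by simp
  moreover have "chart_range ?c \<inter> chart_inv ?c -` fst ?c = chart_range ?c"
    using chart_inv_in_domain[OF chart_at(1)] by auto
  ultimately have "(\<integral>\<^sup>+y. ennreal (indicator (chart_range ?c) y * vol_density F ?c y) \<partial>lborel) = 0"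
    using emeasure_chart_volume[OF chart_at(1) borel_domain[OF chart_at(1)]] by simp
  then have "AE y in lborel. ennreal (indicator (chart_range ?c) y * vol_density F ?c y) = 0"
    using measurable_indicator_vol_density[OF chart_at(1)[of p] borel_range[OF chart_at(1)[of p]] subset_refl]
    by (subst (asm) nn_integral_0_iff_AE) auto
  then have "AE y in lborel. y \<notin> chart_range ?c"
    by eventually_elim (use immersed_patch.vol_density_pos[OF patch[OF chart_at(1)]] in \<open>force simp: indicator_def split: if_splits\<close>)
  then have "emeasure lborel (chart_range ?c) = 0"
    using borel_range[OF chart_at(1)] by (subst (asm) AE_iff_measurable[of "chart_range ?c"]) auto
  moreover have "\<not> negligible (chart_range ?c)"
    using open_chart_range[OF chart_at(1)] chart_in_range[OF chart_at] open_not_negligible by blast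
  ultimately show False
    using borel_range[OF chart_at(1)] by (auto simp: negligible_iff_null_sets null_sets_def)
qed

end

section \<open>Integration by parts on the submanifold\<close>

text \<open>The building block of all cutoff functions below: a \<open>C\<^sup>1\<close> function that vanishes on a half-line.\<close>

lemma has_real_derivative_max_square:
  "((\<lambda>s::real. (max 0 s)\<^sup>2) has_real_derivative 2 * max 0 s) (at s)"
proof (cases s "0::real" rule: linorder_cases)
  case less
  have "((\<lambda>s::real. 0) has_real_derivative 0) (at s)" by simp
  then have "((\<lambda>s::real. (max 0 s)\<^sup>2) has_real_derivative 0) (at s)"
    by (rule has_field_derivative_transform_within_open[where S = "{..<0}"]) (use less in auto)
  then show ?thesis using less by simp
next
  case equal
  have "((\<lambda>h::real. max 0 h) \<longlongrightarrow> max 0 0) (at 0)" by (intro tendsto_intros)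
  moreover have "\<forall>\<^sub>F h in at 0. max 0 h = ((max 0 (0 + h))\<^sup>2 - (max 0 0)\<^sup>2) / (h::real)"
    by (auto simp: eventually_at_filter max_def power2_eq_square)
  ultimately show ?thesis unfolding equal DERIV_def
    by (auto intro: Lim_transform_eventually)
next
  case greater
  have "((\<lambda>s::real. s\<^sup>2) has_real_derivative 2 * s) (at s)" by (auto intro!: derivative_eq_intros)
  then have "((\<lambda>s::real. (max 0 s)\<^sup>2) has_real_derivative 2 * s) (at s)"
    by (rule has_field_derivative_transform_within_open[where S = "{0<..}"]) (use greater in auto)
  then show ?thesis using greater by simp
qed

lemma C1_on_max_square: "C1_on (\<lambda>s::real. (max 0 s)\<^sup>2) UNIV"
  by (rule C1_on_real[OF has_real_derivative_max_square]) (intro continuous_intros)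

context immersed_manifold begin

definition C1_fun :: "('p \<Rightarrow> 'b::euclidean_space) \<Rightarrow> bool" where
  "C1_fun \<zeta> \<longleftrightarrow> (\<forall>c\<in>\<A>. C1_on (\<zeta> \<circ> chart_inv c) (chart_range c))"

text \<open>The derivative \<open>\<langle>\<nabla>\<zeta>, x\<^sup>T\<rangle>\<close> of \<open>\<zeta>\<close> along the tangential part of the position vector.\<close>

definition radial_deriv :: "('p \<Rightarrow> real) \<Rightarrow> 'p \<Rightarrow> real" where
  "radial_deriv \<zeta> p = (let c = chart_at \<A> p in
     frechet_derivative (\<zeta> \<circ> chart_inv c) (at (snd c p)) (tangent_coords F c (snd c p)))"

text \<open>On a self-expander this is \<open>div (\<zeta> x\<^sup>T)\<close>, since there \<open>div x\<^sup>T = n + |x\<^sup>\<bottom>|\<^sup>2 / 2\<close>.\<close>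

definition radial_div :: "('p \<Rightarrow> real) \<Rightarrow> 'p \<Rightarrow> real" where
  "radial_div \<zeta> p = radial_deriv \<zeta> p + \<zeta> p * (real CARD('n) + (norm (normal_field p))\<^sup>2 / 2)"

lemma open_chart_preimage:
  assumes "c \<in> \<A>" "open W" shows "open (chart_range c \<inter> chart_inv c -` W)"
  using continuous_open_preimage[OF continuous_chart_inv open_chart_range] assms by blast

lemma continuous_in_charts:
  fixes h :: "'p \<Rightarrow> 'b::topological_space"
  assumes "\<And>c. c \<in> \<A> \<Longrightarrow> continuous_on (chart_range c) (h \<circ> chart_inv c)"
  shows "continuous_on UNIV h"
proof -
  have "isCont h p" for p
  proof -
    let ?c = "chart_at \<A> p"
    have "continuous_on (fst ?c) ((h \<circ> chart_inv ?c) \<circ> snd ?c)"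
      by (rule continuous_on_compose[OF continuous_chart[OF chart_at(1)]])
         (use assms[OF chart_at(1), of p] in \<open>simp add: chart_range_def\<close>)
    then have "continuous_on (fst ?c) h"
      by (rule continuous_on_eq) (simp add: chart_inv_chart[OF chart_at(1)])
    then show ?thesis
      using continuous_on_eq_continuous_at[OF open_domain[OF chart_at(1)]] chart_at(2) by blast
  qed
  then show ?thesis by (simp add: continuous_at_imp_continuous_on)
qed

lemma C1_fun_continuous: "C1_fun \<zeta> \<Longrightarrow> continuous_on UNIV \<zeta>"
  by (rule continuous_in_charts, rule C1_on_continuous) (simp add: C1_fun_def)

lemma C1_fun_F: "C1_fun F"
  using immersed_patch.C1_on_G[OF patch] by (simp add: C1_fun_def local_rep_def)

lemma C1_fun_mult: "C1_fun f \<Longrightarrow> C1_fun h \<Longrightarrow> C1_fun (\<lambda>p. f p * h p :: real)"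
  using C1_on_mult by (force simp: C1_fun_def o_def)

lemma C1_fun_sum: "(\<And>i. i \<in> I \<Longrightarrow> C1_fun (f i)) \<Longrightarrow> C1_fun (\<lambda>p. \<Sum>i\<in>I. f i p)"
  unfolding C1_fun_def o_def by (auto intro!: C1_on_sum)

lemma C1_fun_in_charts: "C1_fun \<zeta> \<Longrightarrow> c \<in> \<A> \<Longrightarrow> C1_on (\<zeta> \<circ> chart_inv c) (chart_range c)"
  by (simp add: C1_fun_def)

text \<open>The chain rule and \<open>tangent_coords_transition\<close> make the derivative independent of the chart.\<close>

lemma radial_deriv_eq:
  assumes \<zeta>: "C1_fun \<zeta>" and d: "d \<in> \<A>" "p \<in> fst d"
  shows "radial_deriv \<zeta> p =
    frechet_derivative (\<zeta> \<circ> chart_inv d) (at (snd d p)) (tangent_coords F d (snd d p))"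
proof -
  let ?c = "chart_at \<A> p"
  let ?y = "snd ?c p" and ?\<tau> = "transition ?c d"
  let ?\<tau>' = "frechet_derivative ?\<tau> (at ?y)"
  note c = chart_at(1)[of p]
  have y: "?y \<in> overlap ?c d" using chart_at(2) d by (auto simp: overlap_def)
  have \<tau>y: "?\<tau> ?y = snd d p" by (rule transition_chart[OF chart_at])
  let ?L = "frechet_derivative (\<zeta> \<circ> chart_inv d) (at (snd d p))"
  have "((\<zeta> \<circ> chart_inv d) has_derivative ?L) (at (?\<tau> ?y))"
    unfolding \<tau>y by (rule C1_on_has_derivative[OF C1_fun_in_charts[OF \<zeta> d(1)] chart_in_range[OF d]])
  from has_derivative_compose[OF has_derivative_transition[OF c d(1) y] this]
  have "((\<lambda>z. (\<zeta> \<circ> chart_inv d) (?\<tau> z)) has_derivative (\<lambda>v. ?L (?\<tau>' v))) (at ?y)" .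
  then have "((\<zeta> \<circ> chart_inv ?c) has_derivative (\<lambda>v. ?L (?\<tau>' v))) (at ?y)"
  proof (rule has_derivative_transform_within_open[OF _ open_overlap[OF c d(1)] y])
    fix z assume "z \<in> overlap ?c d"
    then obtain q where q: "q \<in> fst ?c" "q \<in> fst d" "z = snd ?c q" by (auto simp: overlap_def)
    then show "(\<zeta> \<circ> chart_inv d) (?\<tau> z) = (\<zeta> \<circ> chart_inv ?c) z"
      by (simp add: transition_chart[OF c q(1)] chart_inv_chart[OF c q(1)] chart_inv_chart[OF d(1) q(2)])
  qed
  from frechet_derivative_at[OF this, symmetric]
  have "radial_deriv \<zeta> p = ?L (?\<tau>' (tangent_coords F ?c ?y))"
    by (simp add: radial_deriv_def Let_def)
  then show ?thesis
    using tangent_coords_transition[OF c d(1) y] by (simp add: \<tau>y)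
qed

lemma radial_deriv_zero:
  assumes "open W" "p \<in> W" "\<And>q. q \<in> W \<Longrightarrow> \<zeta> q = 0"
  shows "radial_deriv \<zeta> p = 0"
proof -
  let ?c = "chart_at \<A> p"
  have "((\<lambda>y. 0) has_derivative (\<lambda>v. 0)) (at (snd ?c p))" by simp
  then have "((\<zeta> \<circ> chart_inv ?c) has_derivative (\<lambda>v. 0)) (at (snd ?c p))"
    by (rule has_derivative_transform_within_open[OF _ open_chart_preimage[OF chart_at(1) assms(1)]])
       (use assms chart_in_range[OF chart_at] chart_inv_chart[OF chart_at] in auto)
  from frechet_derivative_at[OF this, symmetric] show ?thesis by (simp add: radial_deriv_def Let_def)
qed

lemma radial_div_sum:
  assumes "finite I" "\<And>i. i \<in> I \<Longrightarrow> C1_fun (\<zeta> i)"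
  shows "radial_div (\<lambda>p. \<Sum>i\<in>I. \<zeta> i p) p = (\<Sum>i\<in>I. radial_div (\<zeta> i) p)"
proof -
  let ?c = "chart_at \<A> p"
  let ?y = "snd ?c p"
  have "((\<lambda>y. \<Sum>i\<in>I. (\<zeta> i \<circ> chart_inv ?c) y) has_derivative
     (\<lambda>v. \<Sum>i\<in>I. frechet_derivative (\<zeta> i \<circ> chart_inv ?c) (at ?y) v)) (at ?y)"
    by (intro has_derivative_sum C1_on_has_derivative[OF C1_fun_in_charts[OF assms(2) chart_at(1)]] chart_in_range[OF chart_at])
  moreover have "(\<lambda>y. \<Sum>i\<in>I. (\<zeta> i \<circ> chart_inv ?c) y) = (\<lambda>p. \<Sum>i\<in>I. \<zeta> i p) \<circ> chart_inv ?c"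
    by (simp add: fun_eq_iff)
  ultimately have "((\<lambda>p. \<Sum>i\<in>I. \<zeta> i p) \<circ> chart_inv ?c has_derivative
     (\<lambda>v. \<Sum>i\<in>I. frechet_derivative (\<zeta> i \<circ> chart_inv ?c) (at ?y) v)) (at ?y)" by simp
  from frechet_derivative_at[OF this, symmetric]
  have "radial_deriv (\<lambda>p. \<Sum>i\<in>I. \<zeta> i p) p = (\<Sum>i\<in>I. radial_deriv (\<zeta> i) p)"
    by (simp add: radial_deriv_def Let_def)
  then show ?thesis by (simp add: radial_div_def sum.distrib sum_distrib_right)
qed

lemma continuous_normal_field: "continuous_on UNIV normal_field"
proof (rule continuous_in_charts)
  fix c assume c: "c \<in> \<A>"
  interpret c: immersed_patch F c by (rule patch[OF c])
  have "continuous_on (chart_range c) (\<lambda>y. local_rep F c y - local_deriv F c y (tangent_coords F c y))"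
    by (intro continuous_on_diff C1_on_continuous[OF c.C1_on_G]
        continuous_on_linear_family[OF c.linear_D C1_on_continuous[OF c.C1_on_D] C1_on_continuous[OF c.C1_on_tangent_coords]])
  then show "continuous_on (chart_range c) (normal_field \<circ> chart_inv c)"
    by (rule continuous_on_eq)
       (simp add: normal_field_eq[OF c chart_inv_in_domain[OF c]] chart_chart_inv[OF c] normal_position_def)
qed

lemma continuous_radial_div:
  assumes \<zeta>: "C1_fun \<zeta>" shows "continuous_on UNIV (radial_div \<zeta>)"
proof -
  have "continuous_on UNIV (radial_deriv \<zeta>)"
  proof (rule continuous_in_charts)
    fix c assume c: "c \<in> \<A>"
    interpret c: immersed_patch F c by (rule patch[OF c])
    note C1 = C1_fun_in_charts[OF \<zeta> c]
    have "continuous_on (chart_range c) (\<lambda>y. frechet_derivative (\<zeta> \<circ> chart_inv c) (at y) (tangent_coords F c y))"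
      by (rule continuous_on_linear_family[OF has_derivative_linear[OF C1_on_has_derivative[OF C1]]
          C1_on_continuous_deriv[OF C1] C1_on_continuous[OF c.C1_on_tangent_coords]])
    then show "continuous_on (chart_range c) (radial_deriv \<zeta> \<circ> chart_inv c)"
      by (rule continuous_on_eq)
         (simp add: radial_deriv_eq[OF \<zeta> c chart_inv_in_domain[OF c]] chart_chart_inv[OF c])
  qed
  then show ?thesis
    unfolding radial_div_def[abs_def] using C1_fun_continuous[OF \<zeta>] continuous_normal_field
    by (intro continuous_intros) auto
qed

text \<open>The place where the self-expander equation enters: \<open>\<langle>x\<^sup>\<bottom>, H\<rangle> = |x\<^sup>\<bottom>|\<^sup>2 / 2\<close>.\<close>

lemma integral_radial_div_in_chart:
  assumes se: "self_expander \<A> F" and c: "c \<in> \<A>" and \<zeta>: "C1_fun \<zeta>"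
    and K: "compact K" "K \<subseteq> fst c" "\<And>p. p \<notin> K \<Longrightarrow> \<zeta> p = 0"
  shows "integrable \<sigma> (radial_div \<zeta>)" "integral\<^sup>L \<sigma> (radial_div \<zeta>) = 0"
proof -
  interpret c: immersed_patch F c by (rule patch[OF c])
  let ?Z = "\<zeta> \<circ> chart_inv c"
  let ?E = "\<lambda>y. indicator (chart_range c) y * (vol_density F c y *
    (frechet_derivative ?Z (at y) (tangent_coords F c y) +
     ?Z y * (real CARD('n) + normal_position F c y \<bullet> trace_hess F c y)))"
  have C: "compact (snd c ` K)" "snd c ` K \<subseteq> chart_range c"
    using compact_continuous_image[OF continuous_on_subset[OF continuous_chart[OF c] K(2)] K(1)] K(2)
    by (auto simp: chart_range_def)
  have Z0: "?Z y = 0" if "y \<in> chart_range c - snd c ` K" for y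
  proof -
    have "chart_inv c y \<notin> K" using that chart_chart_inv[OF c, of y] by force
    then show ?thesis using K by simp
  qed
  have E: "?E y = indicator (chart_range c) y * (vol_density F c y * radial_div \<zeta> (chart_inv c y))" for y
  proof (cases "y \<in> chart_range c")
    case True
    let ?p = "chart_inv c y"
    have p: "?p \<in> fst c" "snd c ?p = y" using True chart_inv_in_domain[OF c] chart_chart_inv[OF c] by auto
    have N: "normal_field ?p = normal_position F c y" using normal_field_eq[OF c p(1)] p by simp
    have "mean_curvature \<A> F ?p = (1/2) *\<^sub>R normal_field ?p"
      using se by (simp add: self_expander_def normal_field_def)
    then have "normal_position F c y \<bullet> trace_hess F c y = (norm (normal_field ?p))\<^sup>2 / 2"
      using normal_field_inner_mean_curvature[OF c p(1)] by (simp add: p N power2_norm_eq_inner)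
    then show ?thesis
      using radial_deriv_eq[OF \<zeta> c p(1)] by (simp add: radial_div_def p)
  qed (simp add: indicator_def)
  have meas: "radial_div \<zeta> \<in> borel_measurable borel"
    by (rule borel_measurable_continuous_onI[OF continuous_radial_div[OF \<zeta>]])
  have zero: "radial_div \<zeta> p = 0" if "p \<notin> fst c" for p
  proof -
    have "p \<in> - K" using that K by auto
    moreover have "open (- K)" using K compact_imp_closed by blast
    ultimately show ?thesis
      using radial_deriv_zero[of "- K" p \<zeta>] K by (auto simp: radial_div_def)
  qed
  have "integrable lborel ?E" "integral\<^sup>L lborel ?E = 0"
    by (rule c.integral_divergence_in_chart(1)[OF C1_fun_in_charts[OF \<zeta> c] C Z0], assumption)
       (rule c.integral_divergence_in_chart(2)[OF C1_fun_in_charts[OF \<zeta> c] C Z0], assumption)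
  then show "integrable \<sigma> (radial_div \<zeta>)" "integral\<^sup>L \<sigma> (radial_div \<zeta>) = 0"
    unfolding E using integrable_volume_chart[OF c meas zero] integral_volume_chart[OF c meas zero] by auto
qed

text \<open>A radial bump in the coordinates of a chart, extended by zero. It is \<open>C\<^sup>1\<close> in any other chart
  because the complement of its compact, hence closed, support and the chart overlap
  form an open cover.\<close>

lemma ex_bump:
  obtains \<beta> :: "'p \<Rightarrow> real" and c K where "c \<in> \<A>" "C1_fun \<beta>" "compact K" "K \<subseteq> fst c"
    "\<And>q. q \<notin> K \<Longrightarrow> \<beta> q = 0" "\<And>q. 0 \<le> \<beta> q" "0 < \<beta> p"
proof -
  let ?c = "chart_at \<A> p"
  note c = chart_at(1)[of p]
  let ?x = "snd ?c p"
  obtain e where e: "e > 0" "cball ?x e \<subseteq> chart_range ?c"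
    using open_chart_range[OF c] chart_in_range[OF chart_at] open_contains_cball by blast
  define b where "b y = (max 0 (e\<^sup>2 - (y - ?x) \<bullet> (y - ?x)))\<^sup>2" for y
  have diff: "C1_on (\<lambda>y. y - ?x) UNIV"
    by (rule C1_on_diff[OF C1_on_linear[OF bounded_linear_ident] C1_on_const])
  have b: "C1_on b UNIV"
    unfolding b_def
    by (rule C1_on_compose[OF C1_on_diff[OF C1_on_const C1_on_inner[OF diff diff]] C1_on_max_square]) simp
  have b0: "b y = 0" if "y \<notin> cball ?x e" for y
  proof -
    have "e < norm (y - ?x)" using that by (simp add: dist_norm norm_minus_commute)
    then have "e\<^sup>2 < (norm (y - ?x))\<^sup>2" using e by (intro power_strict_mono) auto
    then show ?thesis by (simp add: b_def power2_norm_eq_inner)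
  qed
  define K where "K = chart_inv ?c ` cball ?x e"
  have K: "compact K" "K \<subseteq> fst ?c"
    unfolding K_def using e chart_inv_in_domain[OF c]
      compact_continuous_image[OF continuous_on_subset[OF continuous_chart_inv[OF c] e(2)] compact_cball]
    by auto
  define \<beta> where "\<beta> q = (if q \<in> fst ?c then b (snd ?c q) else 0)" for q
  have \<beta>0: "\<beta> q = 0" if "q \<notin> K" for q
  proof (cases "q \<in> fst ?c")
    case True
    then have "snd ?c q \<notin> cball ?x e" using that chart_inv_chart[OF c True] by (force simp: K_def)
    then show ?thesis using b0 by (simp add: \<beta>_def)
  qed (simp add: \<beta>_def)
  have "C1_on (\<beta> \<circ> chart_inv d) (chart_range d)" if d: "d \<in> \<A>" for d
  proof -
    let ?W = "chart_range d \<inter> chart_inv d -` (- K)"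
    have W: "open ?W" by (rule open_chart_preimage[OF d]) (use K compact_imp_closed in blast)
    have "C1_on (\<beta> \<circ> chart_inv d) ?W"
      by (rule C1_on_cong[OF W C1_on_const[of 0]]) (use \<beta>0 in auto)
    moreover have "C1_on (\<beta> \<circ> chart_inv d) (overlap d ?c)"
    proof (rule C1_on_cong[OF open_overlap[OF d c] C1_on_compose[OF C1_on_transition(1)[OF d c] b]])
      fix z assume "z \<in> overlap d ?c"
      then obtain q where q: "q \<in> fst d" "q \<in> fst ?c" "z = snd d q" by (auto simp: overlap_def)
      then show "b (transition d ?c z) = (\<beta> \<circ> chart_inv d) z"
        by (simp add: transition_chart[OF d q(1)] chart_inv_chart[OF d q(1)] \<beta>_def)
    qed simp
    ultimately have "C1_on (\<beta> \<circ> chart_inv d) (?W \<union> overlap d ?c)"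
      by (rule C1_on_Un[OF W open_overlap[OF d c]])
    moreover have "chart_range d \<subseteq> ?W \<union> overlap d ?c"
    proof
      fix z assume z: "z \<in> chart_range d"
      then have "z = snd d (chart_inv d z)" "chart_inv d z \<in> fst d"
        using chart_chart_inv[OF d] chart_inv_in_domain[OF d] by auto
      then show "z \<in> ?W \<union> overlap d ?c" using z K unfolding overlap_def by blast
    qed
    ultimately show ?thesis by (rule C1_on_subset)
  qed
  then have C1: "C1_fun \<beta>" by (simp add: C1_fun_def)
  have pos: "0 < \<beta> p" using e chart_at(2)[of p] by (simp add: \<beta>_def b_def)
  have nonneg: "0 \<le> \<beta> q" for q by (simp add: \<beta>_def b_def)
  show thesis by (rule that[OF c C1 K \<beta>0 nonneg pos])
qed

text \<open>Integration by parts on \<open>\<Sigma>\<close>. Finitely many bumps \<open>\<beta>\<^sub>i\<close> have a sum \<open>s\<close> that is positive on the support \<open>K\<close>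
  of \<open>\<zeta>\<close>, and \<open>\<zeta> = \<Sum>\<^sub>i \<beta>\<^sub>i \<zeta> / s\<close> is a sum of functions supported in single charts.\<close>

theorem integral_radial_div:
  assumes se: "self_expander \<A> F" and \<zeta>: "C1_fun \<zeta>"
    and K: "compact K" "\<And>p. p \<notin> K \<Longrightarrow> \<zeta> p = 0"
  shows "integrable \<sigma> (radial_div \<zeta>)" "integral\<^sup>L \<sigma> (radial_div \<zeta>) = 0"
proof -
  have "\<forall>p. \<exists>\<beta> c L. c \<in> \<A> \<and> C1_fun (\<beta> :: 'p \<Rightarrow> real) \<and> compact L \<and> L \<subseteq> fst c \<and>
    (\<forall>q. q \<notin> L \<longrightarrow> \<beta> q = 0) \<and> (\<forall>q. 0 \<le> \<beta> q) \<and> 0 < \<beta> p"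
    using ex_bump by metis
  then obtain \<beta> :: "'p \<Rightarrow> 'p \<Rightarrow> real" and c L where
    \<beta>: "\<And>p. c p \<in> \<A>" "\<And>p. C1_fun (\<beta> p)" "\<And>p. compact (L p)" "\<And>p. L p \<subseteq> fst (c p)"
      "\<And>p q. q \<notin> L p \<Longrightarrow> \<beta> p q = 0" "\<And>p q. 0 \<le> \<beta> p q" "\<And>p. 0 < \<beta> p p"
    by metis
  have "open {q. 0 < \<beta> p q}" for p
    using C1_fun_continuous[OF \<beta>(2)[of p]] by (intro open_Collect_less continuous_intros)
  moreover have "K \<subseteq> (\<Union>p\<in>K. {q. 0 < \<beta> p q})" using \<beta>(7) by auto
  ultimately obtain I where I: "I \<subseteq> K" "finite I" "K \<subseteq> (\<Union>p\<in>I. {q. 0 < \<beta> p q})"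
    using compactE_image[OF K(1), of K "\<lambda>p. {q. 0 < \<beta> p q}"] by metis
  define s where "s q = (\<Sum>i\<in>I. \<beta> i q)" for q
  have s: "C1_fun s" unfolding s_def[abs_def] by (rule C1_fun_sum) (rule \<beta>)
  have s_pos: "0 < s q" if "q \<in> K" for q
  proof -
    obtain i where "i \<in> I" "0 < \<beta> i q" using I(3) \<open>q \<in> K\<close> by auto
    then show ?thesis unfolding s_def using I(2) \<beta>(6) by (intro sum_pos2[of I i]) auto
  qed
  \<comment> \<open>Where \<open>s\<close> vanishes so does \<open>\<zeta>\<close>, and the quotient is \<open>0\<close> by the convention for division by zero.\<close>
  define r where "r q = \<zeta> q / s q" for q
  have r: "C1_fun r"
    unfolding C1_fun_def
  proof
    fix d assume d: "d \<in> \<A>"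
    let ?W = "chart_range d \<inter> chart_inv d -` (- K)" and ?V = "chart_range d \<inter> chart_inv d -` {q. 0 < s q}"
    have W: "open ?W" by (rule open_chart_preimage[OF d]) (use K compact_imp_closed in blast)
    have "open {q. 0 < s q}"
      using C1_fun_continuous[OF s] by (intro open_Collect_less continuous_intros)
    then have V: "open ?V" by (rule open_chart_preimage[OF d])
    have "C1_on (r \<circ> chart_inv d) ?W"
      by (rule C1_on_cong[OF W C1_on_const[of 0]]) (use K in \<open>auto simp: r_def\<close>)
    moreover have "C1_on (r \<circ> chart_inv d) ?V"
    proof -
      have "C1_on (\<lambda>y. (\<zeta> \<circ> chart_inv d) y / (s \<circ> chart_inv d) y) ?V"
        by (intro C1_on_divide C1_on_subset[OF C1_fun_in_charts[OF \<zeta> d]] C1_on_subset[OF C1_fun_in_charts[OF s d]]) auto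
      then show ?thesis by (simp add: r_def o_def)
    qed
    ultimately have "C1_on (r \<circ> chart_inv d) (?W \<union> ?V)" by (rule C1_on_Un[OF W V])
    then show "C1_on (r \<circ> chart_inv d) (chart_range d)"
      by (rule C1_on_subset) (use s_pos in auto)
  qed
  have split: "\<zeta> = (\<lambda>q. \<Sum>i\<in>I. \<beta> i q * r q)"
  proof
    fix q
    have "\<zeta> q = s q * r q" using s_pos[of q] K(2)[of q] by (cases "q \<in> K") (auto simp: r_def)
    then show "\<zeta> q = (\<Sum>i\<in>I. \<beta> i q * r q)" by (simp add: s_def sum_distrib_right)
  qed
  have C1: "C1_fun (\<lambda>q. \<beta> i q * r q)" for i by (rule C1_fun_mult[OF \<beta>(2) r])
  have green: "integrable \<sigma> (radial_div (\<lambda>q. \<beta> i q * r q))" "integral\<^sup>L \<sigma> (radial_div (\<lambda>q. \<beta> i q * r q)) = 0" for i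
    using integral_radial_div_in_chart[OF se \<beta>(1)[of i] C1[of i] \<beta>(3)[of i] \<beta>(4)[of i]] \<beta>(5)[of _ i] by auto
  have eq: "radial_div \<zeta> = (\<lambda>p. \<Sum>i\<in>I. radial_div (\<lambda>q. \<beta> i q * r q) p)"
    by (subst split) (simp add: fun_eq_iff radial_div_sum[OF I(2) C1])
  show "integrable \<sigma> (radial_div \<zeta>)" "integral\<^sup>L \<sigma> (radial_div \<zeta>) = 0"
    unfolding eq using green by (simp_all add: Bochner_Integration.integral_sum)
qed

lemma inner_normal_field: "F p \<bullet> normal_field p = (norm (normal_field p))\<^sup>2"
proof -
  have "normal_field p \<bullet> (F p - normal_field p) = 0"
    using normal_part_decomposition(1)[of p "F p"] normal_part_decomposition(2)[of "F p" p] by (auto simp: normal_field_def orthogonal_comp_def orthogonal_def inner_commute)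
  then show ?thesis by (simp add: inner_diff_right power2_norm_eq_inner inner_commute)
qed

lemma norm_normal_field_le: "(norm (normal_field p))\<^sup>2 \<le> (norm (F p))\<^sup>2"
proof -
  have "0 \<le> (F p - normal_field p) \<bullet> (F p - normal_field p)" by simp
  also have "\<dots> = F p \<bullet> F p - normal_field p \<bullet> normal_field p"
    using inner_normal_field[of p] by (simp add: inner_diff_left inner_diff_right inner_commute power2_norm_eq_inner)
  finally show ?thesis by (simp add: power2_norm_eq_inner)
qed

lemma C1_fun_norm_square:
  assumes "\<And>s. (f has_real_derivative f' s) (at s)" "continuous_on UNIV f'"
  shows "C1_fun (\<lambda>p. f ((norm (F p))\<^sup>2))"
  unfolding C1_fun_def
proof
  fix c assume c: "c \<in> \<A>"
  have "C1_on f UNIV" by (rule C1_on_real[OF assms])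
  then have "C1_on (\<lambda>y. f ((F \<circ> chart_inv c) y \<bullet> (F \<circ> chart_inv c) y)) (chart_range c)"
    by (rule C1_on_compose[OF C1_on_inner[OF C1_fun_in_charts[OF C1_fun_F c] C1_fun_in_charts[OF C1_fun_F c]]]) simp
  then show "C1_on ((\<lambda>p. f ((norm (F p))\<^sup>2)) \<circ> chart_inv c) (chart_range c)"
    by (simp add: o_def power2_norm_eq_inner)
qed

text \<open>\<open>\<langle>\<nabla>u, x\<^sup>T\<rangle> = 2 |x\<^sup>T|\<^sup>2 = 2 (u - |x\<^sup>\<bottom>|\<^sup>2)\<close>.\<close>

lemma radial_deriv_norm_square:
  assumes f: "\<And>s. (f has_real_derivative f' s) (at s)"
  shows "radial_deriv (\<lambda>p. f ((norm (F p))\<^sup>2)) p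
    = 2 * f' ((norm (F p))\<^sup>2) * ((norm (F p))\<^sup>2 - (norm (normal_field p))\<^sup>2)"
proof -
  let ?c = "chart_at \<A> p"
  let ?y = "snd ?c p"
  interpret c: immersed_patch F ?c by (rule patch[OF chart_at(1)])
  have y: "?y \<in> chart_range ?c" by (rule chart_in_range[OF chart_at])
  have Fp: "local_rep F ?c ?y = F p" by (simp add: local_rep_def chart_inv_chart[OF chart_at])
  have D: "local_deriv F ?c ?y (tangent_coords F ?c ?y) = F p - normal_field p"
    using normal_field_eq[OF chart_at] by (simp add: normal_position_def Fp)
  have "((\<lambda>y. local_rep F ?c y \<bullet> local_rep F ?c y) has_derivative
      (\<lambda>v. local_rep F ?c ?y \<bullet> local_deriv F ?c ?y v + local_deriv F ?c ?y v \<bullet> local_rep F ?c ?y)) (at ?y)"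
    by (intro has_derivative_inner c.has_derivative_G y)
  from DERIV_compose_FDERIV[OF f this]
  have "((\<lambda>y. f (local_rep F ?c y \<bullet> local_rep F ?c y)) has_derivative
      (\<lambda>v. (local_rep F ?c ?y \<bullet> local_deriv F ?c ?y v + local_deriv F ?c ?y v \<bullet> local_rep F ?c ?y) * f' (local_rep F ?c ?y \<bullet> local_rep F ?c ?y))) (at ?y)" .
  moreover have "(\<lambda>y. f (local_rep F ?c y \<bullet> local_rep F ?c y)) = (\<lambda>p. f ((norm (F p))\<^sup>2)) \<circ> chart_inv ?c"
    by (simp add: fun_eq_iff local_rep_def power2_norm_eq_inner)
  ultimately have "(((\<lambda>p. f ((norm (F p))\<^sup>2)) \<circ> chart_inv ?c) has_derivative
      (\<lambda>v. (local_rep F ?c ?y \<bullet> local_deriv F ?c ?y v + local_deriv F ?c ?y v \<bullet> local_rep F ?c ?y) * f' (local_rep F ?c ?y \<bullet> local_rep F ?c ?y))) (at ?y)"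
    by simp
  from frechet_derivative_at[OF this, symmetric]
  have "radial_deriv (\<lambda>p. f ((norm (F p))\<^sup>2)) p
    = (F p \<bullet> (F p - normal_field p) + (F p - normal_field p) \<bullet> F p) * f' (F p \<bullet> F p)"
    by (simp add: radial_deriv_def Let_def D Fp)
  then show ?thesis
    using inner_normal_field[of p]
    by (simp add: inner_diff_left inner_diff_right power2_norm_eq_inner inner_commute algebra_simps)
qed

text \<open>Integration by parts for \<open>\<zeta> = f(|x|\<^sup>2)\<close>, which is compactly supported because the immersion is proper.\<close>

theorem self_expander_integral_identity:
  assumes se: "self_expander \<A> F" and proper: "proper_map_into F"
    and f: "\<And>s. (f has_real_derivative f' s) (at s)" "continuous_on UNIV f'"
    and R: "\<And>s. s > R \<Longrightarrow> f s = 0"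
  defines "J \<equiv> \<lambda>p. 2 * f' ((norm (F p))\<^sup>2) * ((norm (F p))\<^sup>2 - (norm (normal_field p))\<^sup>2)
     + f ((norm (F p))\<^sup>2) * (real CARD('n) + (norm (normal_field p))\<^sup>2 / 2)"
  shows "integrable \<sigma> J" "integral\<^sup>L \<sigma> J = 0"
proof -
  let ?K = "F -` cball 0 (sqrt (max 0 R))"
  have "compact ?K" using proper by (simp add: proper_map_into_def)
  moreover have "f ((norm (F p))\<^sup>2) = 0" if "p \<notin> ?K" for p
  proof (rule R)
    have "sqrt (max 0 R) < norm (F p)" using that by simp
    then have "max 0 R < (norm (F p))\<^sup>2" using real_less_rsqrt real_sqrt_less_iff
      by (metis norm_ge_zero real_sqrt_abs abs_of_nonneg)
    then show "R < (norm (F p))\<^sup>2" by simp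
  qed
  moreover have "radial_div (\<lambda>p. f ((norm (F p))\<^sup>2)) = J"
    by (simp add: fun_eq_iff radial_div_def J_def radial_deriv_norm_square[OF f(1)])
  ultimately show "integrable \<sigma> J" "integral\<^sup>L \<sigma> J = 0"
    using integral_radial_div[OF se C1_fun_norm_square[OF f]] by metis+
qed

end

section \<open>Infinite weighted volume\<close>

text \<open>A bounded nondecreasing \<open>C\<^sup>1\<close> function that is positive exactly above \<open>\<rho>\<close>; it confines the test
  functions to the region where the curvature bound holds.\<close>

definition ramp :: "real \<Rightarrow> real \<Rightarrow> real" where
  "ramp \<rho> s = (max 0 (s - \<rho>))\<^sup>2 / (1 + (max 0 (s - \<rho>))\<^sup>2)"

definition ramp' :: "real \<Rightarrow> real \<Rightarrow> real" where
  "ramp' \<rho> s = 2 * max 0 (s - \<rho>) / (1 + (max 0 (s - \<rho>))\<^sup>2)\<^sup>2"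

lemma one_plus_square_pos: "0 < 1 + (x::real)\<^sup>2"
  by (simp add: add_pos_nonneg)

lemma has_real_derivative_shifted_max_square:
  "((\<lambda>s::real. (max 0 (s - \<rho>))\<^sup>2) has_real_derivative 2 * max 0 (s - \<rho>)) (at s)"
proof -
  have "((\<lambda>s. s - \<rho>) has_real_derivative 1) (at s)" by (auto intro!: derivative_eq_intros)
  from DERIV_chain2[where f = "\<lambda>s::real. (max 0 s)\<^sup>2", OF has_real_derivative_max_square this]
  show ?thesis by simp
qed

lemma has_real_derivative_ramp: "(ramp \<rho> has_real_derivative ramp' \<rho> s) (at s)"
proof -
  let ?m = "max 0 (s - \<rho>)"
  have nz: "1 + ?m\<^sup>2 \<noteq> 0" using one_plus_square_pos[of ?m] by simp
  have "((\<lambda>s. (max 0 (s - \<rho>))\<^sup>2 / (1 + (max 0 (s - \<rho>))\<^sup>2)) has_real_derivative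
     (2 * ?m * (1 + ?m\<^sup>2) - ?m\<^sup>2 * (0 + 2 * ?m)) / ((1 + ?m\<^sup>2) * (1 + ?m\<^sup>2))) (at s)"
    by (intro DERIV_divide DERIV_add DERIV_const has_real_derivative_shifted_max_square nz)
  also have "(2 * ?m * (1 + ?m\<^sup>2) - ?m\<^sup>2 * (0 + 2 * ?m)) / ((1 + ?m\<^sup>2) * (1 + ?m\<^sup>2)) = ramp' \<rho> s"
    by (simp add: ramp'_def power2_eq_square algebra_simps)
  finally show ?thesis by (simp add: ramp_def[abs_def])
qed

lemma continuous_ramp': "continuous_on UNIV (ramp' \<rho>)"
  unfolding ramp'_def[abs_def] using one_plus_square_pos
  by (intro continuous_intros) (metis order_less_irrefl power_zero_numeral zero_less_power2 zero_eq_power2)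

lemma ramp_bounds: "0 \<le> ramp \<rho> s" "ramp \<rho> s \<le> 1" "0 \<le> ramp' \<rho> s"
  using one_plus_square_pos[of "max 0 (s - \<rho>)"] by (simp_all add: ramp_def ramp'_def)

lemma ramp_pos_iff: "0 < ramp \<rho> s \<longleftrightarrow> \<rho> < s"
  using one_plus_square_pos[of "max 0 (s - \<rho>)"] by (auto simp: ramp_def zero_less_divide_iff max_def)

text \<open>The integrand of \<open>self_expander_integral_identity\<close> at a point, for
  \<open>f(s) = \<theta>(s) (max 0 (1 - s / T))\<^sup>2 exp (- \<alpha> s / 4)\<close>, with \<open>M = |x\<^sup>\<bottom>|\<^sup>2\<close> and the values
  \<open>m = max 0 (1 - u / T)\<close> and \<open>w = exp (- \<alpha> u / 4)\<close>. The difference of the two sides is a sum of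
  three nonnegative terms: from \<open>\<theta>'\<close>, from \<open>bound\<close>, and from estimating \<open>u - M\<close> by \<open>u\<close> in the
  derivative of the cutoff.\<close>

lemma integrand_lower_bound:
  fixes u M w \<theta> \<theta>' m T \<alpha> n :: real
  assumes "0 \<le> M" "M \<le> u" "0 < w" "0 \<le> \<theta>" "0 \<le> \<theta>'" "0 \<le> m" "0 < T"
    and bound: "0 < \<theta> \<Longrightarrow> \<alpha> * u \<le> (1 + \<alpha>) * M"
  shows "w * (\<theta> * (n * m\<^sup>2 - 4 * m * (u / T))) \<le>
    2 * ((\<theta>' * m\<^sup>2 + \<theta> * (2 * m * (- 1 / T))) * w + \<theta> * m\<^sup>2 * (- (\<alpha> / 4) * w)) * (u - M)
      + \<theta> * m\<^sup>2 * w * (n + M / 2)" (is "?l \<le> ?r")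
proof -
  have "?r - ?l = w * (2 * \<theta>' * m\<^sup>2 * (u - M) + \<theta> * m\<^sup>2 * ((1 + \<alpha>) * M - \<alpha> * u) / 2 + 4 * \<theta> * m * M / T)"
    using \<open>0 < T\<close> by (simp add: field_simps power2_eq_square)
  moreover have "0 \<le> \<theta> * m\<^sup>2 * ((1 + \<alpha>) * M - \<alpha> * u)"
    using bound assms(4) by (cases "\<theta> = 0") auto
  ultimately show ?thesis using assms by (smt (verit) divide_nonneg_pos mult_nonneg_nonneg zero_le_power2)
qed

context immersed_manifold begin

lemma continuous_F: "continuous_on UNIV F"
  by (rule C1_fun_continuous[OF C1_fun_F])

text \<open>A finite weighted volume would force \<open>u \<le> r\<^sub>0\<^sup>2\<close> almost everywhere, by test functions supported where
  the curvature bound holds. This is impossible because a compactly supported \<open>f(u)\<close> with constant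
  value \<open>1\<close> for \<open>u \<le> r\<^sub>0\<^sup>2\<close> would then make \<open>\<sigma>\<close> zero.\<close>

theorem weighted_volume_infinite:
  assumes se: "self_expander \<A> F" and proper: "proper_map_into F"
    and a: "0 \<le> a" "a < 1/2" and r\<^sub>0: "0 < r\<^sub>0"
    and H: "\<And>p. F p \<notin> ball 0 r\<^sub>0 \<Longrightarrow> a * norm (F p) \<le> norm (mean_curvature \<A> F p)"
    and \<alpha>: "\<alpha> = 4 * a\<^sup>2 / (1 - 4 * a\<^sup>2)"
  shows "(\<integral>\<^sup>+ p. ennreal (exp (- (\<alpha> / 4) * (norm (F p))\<^sup>2)) \<partial>\<sigma>) = \<infinity>"
proof (rule ccontr)
  assume fin: "(\<integral>\<^sup>+ p. ennreal (exp (- (\<alpha> / 4) * (norm (F p))\<^sup>2)) \<partial>\<sigma>) \<noteq> \<infinity>"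
  define n where "n = real CARD('n)"
  have n: "n > 0" by (simp add: n_def)
  define \<rho> where "\<rho> = r\<^sub>0\<^sup>2"
  define u where "u p = (norm (F p))\<^sup>2" for p
  define M where "M p = (norm (normal_field p))\<^sup>2" for p
  define w where "w s = exp (- (\<alpha> / 4) * s)" for s
  have M: "0 \<le> M p" "M p \<le> u p" for p by (simp_all add: M_def u_def norm_normal_field_le)
  have Fm[measurable]: "F \<in> borel_measurable \<sigma>"
    using borel_measurable_continuous_onI[OF continuous_F] by (simp cong: measurable_cong_sets)
  have um[measurable]: "u \<in> borel_measurable \<sigma>" unfolding u_def[abs_def] by measurable
  have int_w: "integrable \<sigma> (\<lambda>p. w (u p))"
  proof (rule integrableI_nonneg)
    show "(\<lambda>p. w (u p)) \<in> borel_measurable \<sigma>" unfolding w_def by measurable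
    show "(\<integral>\<^sup>+ p. ennreal (w (u p)) \<partial>\<sigma>) < \<infinity>" using fin by (simp add: w_def u_def top.not_eq_extremum)
  qed (simp add: w_def)
  have w': "(w has_real_derivative - (\<alpha> / 4) * w s) (at s)" for s
    unfolding w_def by (auto intro!: derivative_eq_intros)
  have a2: "4 * a\<^sup>2 < 1"
    using power_strict_mono[OF a(2) a(1), of 2] by (simp add: power2_eq_square)
  have bound: "\<alpha> * u p \<le> (1 + \<alpha>) * M p" if "\<rho> < u p" for p
  proof -
    have "r\<^sub>0\<^sup>2 < (norm (F p))\<^sup>2" using that by (simp add: \<rho>_def u_def)
    then have "r\<^sub>0 < norm (F p)" by (rule power2_less_imp_less) simp
    then have "a * norm (F p) \<le> norm (mean_curvature \<A> F p)" by (intro H) simp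
    moreover have "mean_curvature \<A> F p = (1/2) *\<^sub>R normal_field p"
      using se by (simp add: self_expander_def normal_field_def)
    ultimately have "2 * a * norm (F p) \<le> norm (normal_field p)" by simp
    then have "(2 * a * norm (F p))\<^sup>2 \<le> M p" unfolding M_def using a by (intro power_mono) auto
    then have 1: "4 * a\<^sup>2 * u p \<le> M p" by (simp add: u_def power_mult_distrib)
    have 2: "1 + \<alpha> = 1 / (1 - 4 * a\<^sup>2)" "\<alpha> = 4 * a\<^sup>2 * (1 + \<alpha>)" using a2 by (simp_all add: \<alpha> field_simps)
    then have "0 \<le> 1 + \<alpha>" using a2 by simp
    from mult_left_mono[OF 1 this] show ?thesis using 2(2) by (metis mult.assoc mult.commute)
  qed
  \<comment> \<open>\<open>n\<close> times the cutoff minus its error term; it is bounded uniformly in \<open>T\<close> because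
    \<open>0 \<le> s / T \<le> 1\<close> where the cutoff is nonzero, and tends to \<open>n\<close>.\<close>
  define k where "k T s = n * (max 0 (1 - s / T))\<^sup>2 - 4 * max 0 (1 - s / T) * (s / T)" for T s
  have k_bound: "\<bar>k T s\<bar> \<le> n + 4" if T: "T > 0" and s: "0 \<le> s" for T s :: real
  proof -
    define m where "m = max 0 (1 - s / T)"
    have m: "0 \<le> m" "m \<le> 1" using T s by (auto simp: m_def)
    have 1: "0 \<le> n * m\<^sup>2" "n * m\<^sup>2 \<le> n * 1" using m n by (auto intro!: mult_left_mono power_le_one)
    have "m * (s / T) \<le> 1 * 1"
    proof (cases "s / T \<le> 1")
      case True then show ?thesis using m T s by (intro mult_mono) auto
    qed (simp add: m_def)
    moreover have "0 \<le> m * (s / T)" using m T s by simp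
    moreover have "k T s = n * m\<^sup>2 - 4 * (m * (s / T))" by (simp add: k_def m_def)
    ultimately show ?thesis using 1 n by linarith
  qed
  have ineq: "(\<integral>p. w (u p) * (ramp \<rho> (u p) * k T (u p)) \<partial>\<sigma>) \<le> 0"
    and int_k: "integrable \<sigma> (\<lambda>p. w (u p) * (ramp \<rho> (u p) * k T (u p)))" if T: "T > 0" for T
  proof -
    define f where "f s = ramp \<rho> s * (max 0 (1 - s / T))\<^sup>2 * w s" for s
    define f' where "f' s = (ramp' \<rho> s * (max 0 (1 - s / T))\<^sup>2 + ramp \<rho> s * (2 * max 0 (1 - s / T) * (- 1 / T))) * w s
       + ramp \<rho> s * (max 0 (1 - s / T))\<^sup>2 * (- (\<alpha> / 4) * w s)" for s
    have m': "((\<lambda>s. (max 0 (1 - s / T))\<^sup>2) has_real_derivative 2 * max 0 (1 - s / T) * (- 1 / T)) (at s)" for s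
      by (rule DERIV_chain2[OF has_real_derivative_max_square]) (use T in \<open>auto intro!: derivative_eq_intros\<close>)
    have f: "(f has_real_derivative f' s) (at s)" for s
      unfolding f_def[abs_def] f'_def
      using DERIV_mult[OF DERIV_mult[OF has_real_derivative_ramp m'] w', of \<rho> s] by (simp add: algebra_simps)
    have contr: "continuous_on UNIV (ramp \<rho>)" "continuous_on UNIV w"
      by (auto intro!: continuous_at_imp_continuous_on DERIV_isCont[OF has_real_derivative_ramp] DERIV_isCont[OF w'])
    have f': "continuous_on UNIV f'"
      unfolding f'_def[abs_def] using T by (intro continuous_intros contr continuous_ramp') auto
    have "f s = 0" if "s > T" for s using that T by (simp add: f_def field_simps max_def)
    note J = self_expander_integral_identity[OF se proper f f' this]
    have le: "w (u p) * (ramp \<rho> (u p) * k T (u p)) \<le> 2 * f' (u p) * (u p - M p) + f (u p) * (n + M p / 2)" for p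
      unfolding k_def f_def f'_def
      by (rule integrand_lower_bound) (use M T bound[of p] ramp_bounds in \<open>auto simp: w_def ramp_pos_iff\<close>)
    have [measurable]: "k T \<in> borel_measurable borel" "w \<in> borel_measurable borel" "ramp \<rho> \<in> borel_measurable borel"
      unfolding k_def[abs_def] w_def[abs_def] ramp_def[abs_def] by measurable
    show int: "integrable \<sigma> (\<lambda>p. w (u p) * (ramp \<rho> (u p) * k T (u p)))"
    proof (rule Bochner_Integration.integrable_bound)
      show "integrable \<sigma> (\<lambda>p. (n + 4) * w (u p))" using int_w by simp
      show "(\<lambda>p. w (u p) * (ramp \<rho> (u p) * k T (u p))) \<in> borel_measurable \<sigma>" by measurable
      show "AE p in \<sigma>. norm (w (u p) * (ramp \<rho> (u p) * k T (u p))) \<le> norm ((n + 4) * w (u p))"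
      proof (rule AE_I2)
        fix p
        have "ramp \<rho> (u p) * \<bar>k T (u p)\<bar> \<le> 1 * (n + 4)"
          using ramp_bounds[of \<rho> "u p"] k_bound[OF T, of "u p"] n by (intro mult_mono) (auto simp: u_def)
        then have "w (u p) * (ramp \<rho> (u p) * \<bar>k T (u p)\<bar>) \<le> w (u p) * (n + 4)"
          by (intro mult_left_mono) (auto simp: w_def)
        then show "norm (w (u p) * (ramp \<rho> (u p) * k T (u p))) \<le> norm ((n + 4) * w (u p))"
          using n ramp_bounds[of \<rho> "u p"] by (simp add: abs_mult w_def mult.commute)
      qed
    qed
    have "(\<integral>p. w (u p) * (ramp \<rho> (u p) * k T (u p)) \<partial>\<sigma>) \<le> (\<integral>p. 2 * f' (u p) * (u p - M p) + f (u p) * (n + M p / 2) \<partial>\<sigma>)"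
      by (rule integral_mono[OF int]) (use J(1) le in \<open>simp_all add: u_def M_def n_def\<close>)
    also have "\<dots> = 0" using J(2) by (simp add: u_def M_def n_def)
    finally show "(\<integral>p. w (u p) * (ramp \<rho> (u p) * k T (u p)) \<partial>\<sigma>) \<le> 0" .
  qed
  have [measurable]: "k T \<in> borel_measurable borel" "w \<in> borel_measurable borel" "ramp \<rho> \<in> borel_measurable borel" for T
    unfolding k_def[abs_def] w_def[abs_def] ramp_def[abs_def] by measurable
  have lim: "(\<lambda>j. \<integral>p. w (u p) * (ramp \<rho> (u p) * k (real (Suc j)) (u p)) \<partial>\<sigma>)
      \<longlonglongrightarrow> (\<integral>p. w (u p) * (ramp \<rho> (u p) * n) \<partial>\<sigma>)"
  proof (rule integral_dominated_convergence[where w = "\<lambda>p. (n + 4) * w (u p)"])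
    show "integrable \<sigma> (\<lambda>p. (n + 4) * w (u p))" using int_w by simp
    show "AE p in \<sigma>. (\<lambda>j. w (u p) * (ramp \<rho> (u p) * k (real (Suc j)) (u p))) \<longlonglongrightarrow> w (u p) * (ramp \<rho> (u p) * n)"
    proof (rule AE_I2)
      fix p
      have s: "(\<lambda>j. u p / real (Suc j)) \<longlonglongrightarrow> 0"
        using tendsto_mult[OF tendsto_const[of "u p"] LIMSEQ_inverse_real_of_nat] by (simp add: divide_inverse)
      have "(\<lambda>j. k (real (Suc j)) (u p)) \<longlonglongrightarrow> n * (max 0 (1 - 0))\<^sup>2 - 4 * max 0 (1 - 0) * 0"
        unfolding k_def by (intro tendsto_intros s)
      then show "(\<lambda>j. w (u p) * (ramp \<rho> (u p) * k (real (Suc j)) (u p))) \<longlonglongrightarrow> w (u p) * (ramp \<rho> (u p) * n)"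
        by (intro tendsto_intros) simp
    qed
    show "AE p in \<sigma>. norm (w (u p) * (ramp \<rho> (u p) * k (real (Suc j)) (u p))) \<le> (n + 4) * w (u p)" for j
    proof (rule AE_I2)
      fix p
      have "ramp \<rho> (u p) * \<bar>k (real (Suc j)) (u p)\<bar> \<le> 1 * (n + 4)"
        using ramp_bounds[of \<rho> "u p"] k_bound[of "real (Suc j)" "u p"] n by (intro mult_mono) (auto simp: u_def)
      then have "w (u p) * (ramp \<rho> (u p) * \<bar>k (real (Suc j)) (u p)\<bar>) \<le> w (u p) * (n + 4)"
        by (intro mult_left_mono) (auto simp: w_def)
      then show "norm (w (u p) * (ramp \<rho> (u p) * k (real (Suc j)) (u p))) \<le> (n + 4) * w (u p)"
        using ramp_bounds[of \<rho> "u p"] by (simp add: abs_mult w_def mult.commute)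
    qed
  qed measurable
  have nonneg: "0 \<le> w (u p) * (ramp \<rho> (u p) * n)" for p
    using n ramp_bounds[of \<rho> "u p"] by (simp add: w_def)
  have "(\<integral>p. w (u p) * (ramp \<rho> (u p) * n) \<partial>\<sigma>) \<le> 0"
    by (rule LIMSEQ_le_const2[OF lim]) (use ineq in auto)
  then have zero: "(\<integral>p. w (u p) * (ramp \<rho> (u p) * n) \<partial>\<sigma>) = 0"
    using Bochner_Integration.integral_nonneg[of \<sigma> "\<lambda>p. w (u p) * (ramp \<rho> (u p) * n)"] nonneg
    by (simp add: order_antisym)
  have "integrable \<sigma> (\<lambda>p. w (u p) * (ramp \<rho> (u p) * n))"
  proof (rule Bochner_Integration.integrable_bound)
    show "integrable \<sigma> (\<lambda>p. n * w (u p))" using int_w by simp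
    show "AE p in \<sigma>. norm (w (u p) * (ramp \<rho> (u p) * n)) \<le> norm (n * w (u p))"
      using n ramp_bounds by (intro AE_I2) (auto simp: abs_mult w_def mult_le_cancel_left1)
  qed measurable
  then have "AE p in \<sigma>. w (u p) * (ramp \<rho> (u p) * n) = 0"
    using integral_nonneg_eq_0_iff_AE[of \<sigma> "\<lambda>p. w (u p) * (ramp \<rho> (u p) * n)"] zero nonneg by simp
  then have AE_u: "AE p in \<sigma>. u p \<le> \<rho>"
  proof eventually_elim
    case (elim p)
    then have "ramp \<rho> (u p) = 0" using n by (simp add: w_def)
    then show ?case using ramp_pos_iff[of \<rho> "u p"] by linarith
  qed
  \<comment> \<open>Equal to \<open>1\<close> up to \<open>\<rho>\<close> and to \<open>0\<close> from \<open>\<rho> + 1\<close> on, so only its constant part is seen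
    by \<open>\<sigma>\<close>.\<close>
  define g where "g s = (max 0 (1 - (max 0 (s - \<rho>))\<^sup>2))\<^sup>2" for s
  define g' where "g' s = 2 * max 0 (1 - (max 0 (s - \<rho>))\<^sup>2) * (- (2 * max 0 (s - \<rho>)))" for s
  have g: "(g has_real_derivative g' s) (at s)" for s
  proof -
    have "((\<lambda>s. 1 - (max 0 (s - \<rho>))\<^sup>2) has_real_derivative 0 - 2 * max 0 (s - \<rho>)) (at s)"
      by (intro DERIV_diff DERIV_const has_real_derivative_shifted_max_square)
    from DERIV_chain2[OF has_real_derivative_max_square this] show ?thesis
      by (simp add: g_def[abs_def] g'_def)
  qed
  have g': "continuous_on UNIV g'" unfolding g'_def[abs_def] by (intro continuous_intros)
  have g0: "g s = 0" if "s > \<rho> + 1" for s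
  proof -
    have "1 \<le> max 0 (s - \<rho>)" using that by simp
    then have "1 \<le> (max 0 (s - \<rho>))\<^sup>2" by (rule one_le_power)
    then show ?thesis by (simp add: g_def)
  qed
  note J = self_expander_integral_identity[OF se proper g g' g0]
  let ?J = "\<lambda>p. 2 * g' (u p) * (u p - M p) + g (u p) * (n + M p / 2)"
  have int_J: "integrable \<sigma> ?J" and zero_J: "integral\<^sup>L \<sigma> ?J = 0"
    using J by (simp_all add: u_def M_def n_def)
  have AE_J: "AE p in \<sigma>. n \<le> ?J p"
    using AE_u
  proof eventually_elim
    case (elim p)
    then show ?case using M[of p] by (simp add: g_def g'_def)
  qed
  then have "AE p in \<sigma>. 0 \<le> ?J p" by eventually_elim (use n in simp)
  from integral_nonneg_eq_0_iff_AE[OF int_J this] zero_J have "AE p in \<sigma>. ?J p = 0" by blast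
  with AE_J have "AE p in \<sigma>. False" by eventually_elim (use n in simp)
  then have "emeasure \<sigma> UNIV = 0" using emeasure_eq_0_AE[of "\<lambda>_. True" \<sigma>] by simp
  then show False using volume_measure_nonzero by simp
qed

end

theorem theorem1p2:
  fixes \<A> :: "('p::{t2_space, second_countable_topology}, 'n::finite) chart set"
    and F :: "'p \<Rightarrow> real ^ 'm::finite"
  assumes "smooth_atlas \<A>"
    and "smooth_immersion \<A> F"
    and "CARD('n) < CARD('m)"
    and "complete_immersion F"
    and "proper_map_into F"
    and "self_expander \<A> F"
  shows "(\<forall>a b r\<^sub>0 \<alpha> :: real.
            0 \<le> a \<and> a < 1/2 \<and> 0 \<le> b \<and> 0 < r\<^sub>0 \<and>
            (\<forall>p. F p \<notin> ball 0 r\<^sub>0 \<longrightarrow> norm (mean_curvature \<A> F p) \<ge> a * norm (F p) + b) \<and>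
            \<alpha> = 4 * a\<^sup>2 / (1 - 4 * a\<^sup>2) \<longrightarrow>
            (\<integral>\<^sup>+ p. ennreal (exp (- (\<alpha> / 4) * (norm (F p))\<^sup>2)) \<partial>volume_measure \<A> F) = \<infinity>) \<and>
         (\<forall>b r\<^sub>0 :: real.
            0 \<le> b \<and> 0 < r\<^sub>0 \<and>
            (\<forall>p. F p \<notin> ball 0 r\<^sub>0 \<longrightarrow>
                 norm (mean_curvature \<A> F p) \<ge> 1 / (2 * sqrt 2) * norm (F p) + b) \<longrightarrow>
            (\<integral>\<^sup>+ p. ennreal (exp (- (norm (F p))\<^sup>2 / 4)) \<partial>volume_measure \<A> F) = \<infinity>)"
proof -
  interpret immersed_manifold \<A> F by unfold_locales (fact assms)+
  have main: "(\<integral>\<^sup>+ p. ennreal (exp (- (\<alpha> / 4) * (norm (F p))\<^sup>2)) \<partial>volume_measure \<A> F) = \<infinity>"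
    if h: "0 \<le> a" "a < 1/2" "0 \<le> b" "0 < r\<^sub>0"
      "\<forall>p. F p \<notin> ball 0 r\<^sub>0 \<longrightarrow> norm (mean_curvature \<A> F p) \<ge> a * norm (F p) + b"
      "\<alpha> = 4 * a\<^sup>2 / (1 - 4 * a\<^sup>2)" for a b r\<^sub>0 \<alpha> :: real
  proof (rule weighted_volume_infinite[OF assms(6,5) h(1,2,4) _ h(6)])
    fix p assume "F p \<notin> ball 0 r\<^sub>0"
    with h(5) have "a * norm (F p) + b \<le> norm (mean_curvature \<A> F p)" by blast
    with h(3) show "a * norm (F p) \<le> norm (mean_curvature \<A> F p)" by linarith
  qed
  have "(\<integral>\<^sup>+ p. ennreal (exp (- (norm (F p))\<^sup>2 / 4)) \<partial>volume_measure \<A> F) = \<infinity>"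
    if h: "0 \<le> b" "0 < r\<^sub>0"
      "\<forall>p. F p \<notin> ball 0 r\<^sub>0 \<longrightarrow> norm (mean_curvature \<A> F p) \<ge> 1 / (2 * sqrt 2) * norm (F p) + b"
    for b r\<^sub>0 :: real
  proof -
    \<comment> \<open>The slope \<open>a = 1 / (2 \<surd>2)\<close> is the one with \<open>\<alpha> = 1\<close>.\<close>
    have "1 / (2 * sqrt 2) < (1/2::real)" by (simp add: field_simps)
    moreover have "(1::real) = 4 * (1 / (2 * sqrt 2))\<^sup>2 / (1 - 4 * (1 / (2 * sqrt 2))\<^sup>2)"
      by (simp add: power_divide power_mult_distrib)
    ultimately show ?thesis using main[of "1 / (2 * sqrt 2)" b r\<^sub>0 1] h by simp
  qed
  with main show ?thesis by blast
qed

end
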